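(* As $n\to\infty$, the maximum number $\mathrm{ex}(n,TP_3)$ of edges in an $n$-vertex $TP_3$-free graph satisfies $$\mathrm{ex}(n,TP_3)=\frac{1}{4}n^2+n+o(n).$$
   Context: All graphs are finite and simple. For a graph $H$, a graph is $H$-free if it does not contain $H$ as a (not necessarily induced) subgraph, and $\mathrm{ex}(n,H)$ denotes the maximum number of edges in an $n$-vertex $H$-free graph. For $k\ge 1$, the triangular pyramid with $k$ layers, $TP_k$, is the graph with vertices $x_r^{i}$ for $1\le i\le k+1$ and $1\le r\le i$ (superscripts are indices), whose edges are: the edges of the paths $x_1^{i}x_2^{i}\cdots x_i^{i}$ for each $1\le i\le k+1$ (i.e. $x_r^{i}x_{r+1}^{i}$ for $1\le r\le i-1$), together with the edges $x_r^{i-1}x_r^{i}$ and $x_r^{i-1}x_{r+1}^{i}$ for all $2\le i\le k+1$ and $1\le r\le i-1$. In particular $TP_3$ has $10$ vertices and $18$ edges. *)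

theory Defs
  imports Complex_Main "HOL-Library.Ramsey" "HOL-Library.Landau_Symbols"
begin

text \<open>A graph is a pair of a vertex set and a set of edges, an edge being a two-element vertex set.\<close>

type_synonym 'a ugraph = "'a set \<times> 'a set set"

abbreviation verts :: "'a ugraph \<Rightarrow> 'a set" where
  "verts \<equiv> fst"

abbreviation edges :: "'a ugraph \<Rightarrow> 'a set set" where
  "edges \<equiv> snd"

definition simple_graph :: "'a ugraph \<Rightarrow> bool" where
  "simple_graph G \<longleftrightarrow> finite (verts G) \<and> edges G \<subseteq> [verts G]\<^bsup>2\<^esup>"

definition contains_copy :: "'a ugraph \<Rightarrow> 'b ugraph \<Rightarrow> bool" where
  "contains_copy G H \<longleftrightarrow>
     (\<exists>f. inj_on f (verts H) \<and> f ` verts H \<subseteq> verts G \<and> (\<forall>e\<in>edges H. f ` e \<in> edges G))"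

text \<open>
  Every finite graph is isomorphic to one whose vertices are natural numbers, so it suffices to let
  the \<open>n\<close>-vertex host graphs range over those.
  The maximum is over a nonempty set as soon as \<open>H\<close> has an edge (see below); otherwise
  every sufficiently large graph contains \<open>H\<close>, and the value is unspecified.
\<close>

definition ex_edge_counts :: "nat \<Rightarrow> 'b ugraph \<Rightarrow> nat set" where
  "ex_edge_counts n H =
     {card (edges G) | G :: nat ugraph.
        simple_graph G \<and> card (verts G) = n \<and> \<not> contains_copy G H}"

definition ex :: "nat \<Rightarrow> 'b ugraph \<Rightarrow> nat" where
  "ex n H = Max (ex_edge_counts n H)"

text \<open>The pair \<open>(i, r)\<close> stands for the vertex \<open>x\<close> with superscript \<open>i\<close> and subscript \<open>r\<close>.\<close>

definition triangular_pyramid :: "nat \<Rightarrow> (nat \<times> nat) ugraph" where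
  "triangular_pyramid k =
     ({(i, r). 1 \<le> i \<and> i \<le> k + 1 \<and> 1 \<le> r \<and> r \<le> i},
      {{(i, r), (i, r + 1)} | i r. 1 \<le> i \<and> i \<le> k + 1 \<and> 1 \<le> r \<and> r \<le> i - 1}
      \<union> {{(i - 1, r), (i, r)} | i r. 2 \<le> i \<and> i \<le> k + 1 \<and> 1 \<le> r \<and> r \<le> i - 1}
      \<union> {{(i - 1, r), (i, r + 1)} | i r. 2 \<le> i \<and> i \<le> k + 1 \<and> 1 \<le> r \<and> r \<le> i - 1})"

lemma finite_ex_edge_counts: "finite (ex_edge_counts n H)"
proof (rule finite_subset)
  show "ex_edge_counts n H \<subseteq> {..n choose 2}"
  proof
    fix m
    assume "m \<in> ex_edge_counts n H"
    then obtain G :: "nat ugraph" where G: "simple_graph G" "card (verts G) = n" "m = card (edges G)"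
      unfolding ex_edge_counts_def by blast
    have "m \<le> card ([verts G]\<^bsup>2\<^esup>)"
      using G(1) unfolding G(3) simple_graph_def by (intro card_mono finite_imp_finite_nsets) simp_all
    also have "\<dots> = n choose 2"
      using G(2) by simp
    finally show "m \<in> {..n choose 2}"
      by simp
  qed
qed simp

lemma ex_edge_counts_nonempty:
  assumes "edges H \<noteq> {}"
  shows "ex_edge_counts n H \<noteq> {}"
proof -
  let ?G = "({..<n}, {}) :: nat ugraph"
  have "simple_graph ?G \<and> card (verts ?G) = n \<and> \<not> contains_copy ?G H"
    using assms by (simp add: simple_graph_def contains_copy_def)
  then have "card (edges ?G) \<in> ex_edge_counts n H"
    unfolding ex_edge_counts_def by blast
  then show ?thesis
    by blast
qed

lemma simple_graph_triangular_pyramid: "simple_graph (triangular_pyramid k)"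
proof -
  have "verts (triangular_pyramid k) \<subseteq> {..k+1} \<times> {..k+1}"
    by (auto simp: triangular_pyramid_def)
  then have "finite (verts (triangular_pyramid k))"
    by (rule finite_subset) simp
  moreover have "edges (triangular_pyramid k) \<subseteq> [verts (triangular_pyramid k)]\<^bsup>2\<^esup>"
    by (auto simp: triangular_pyramid_def nsets_def card_insert_if)
  ultimately show ?thesis
    by (simp add: simple_graph_def)
qed

lemma card_edges_triangular_pyramid_3: "card (edges (triangular_pyramid 3)) = 18"
proof -
  let ?P = "Sigma {2..4::nat} (\<lambda>i. {1..i - 1})"
  let ?f = "\<lambda>(i, r). {(i, r), (i, r + 1)} :: (nat \<times> nat) set"
  let ?g = "\<lambda>(i, r). {(i - 1, r), (i, r)} :: (nat \<times> nat) set"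
  let ?h = "\<lambda>(i, r). {(i - 1, r), (i, r + 1)} :: (nat \<times> nat) set"
  have P: "finite ?P" "card ?P = 6"
    by (simp_all add: numeral_eq_Suc atLeastAtMostSuc_conv)
  have edges: "edges (triangular_pyramid 3) = ?f ` ?P \<union> ?g ` ?P \<union> ?h ` ?P"
    unfolding triangular_pyramid_def snd_conv
    by (intro arg_cong2[of _ _ _ _ "(\<union>)"]) (force simp: image_def)+
  have inj: "inj_on ?f ?P" "inj_on ?g ?P" "inj_on ?h ?P"
    by (auto simp: inj_on_def doubleton_eq_iff)
  have disj: "?f ` ?P \<inter> ?g ` ?P = {}" "(?f ` ?P \<union> ?g ` ?P) \<inter> ?h ` ?P = {}"
    by (auto simp: doubleton_eq_iff)
  have union: "card (A \<union> B \<union> C) = card A + card B + card C"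
    if "finite A" "finite B" "finite C" "A \<inter> B = {}" "(A \<union> B) \<inter> C = {}"
    for A B C :: "(nat \<times> nat) set set"
    using that by (simp add: card_Un_disjoint)
  have "card (edges (triangular_pyramid 3)) = card (?f ` ?P) + card (?g ` ?P) + card (?h ` ?P)"
    unfolding edges by (intro union disj finite_imageI P(1))
  also have "\<dots> = 6 + 6 + 6"
    unfolding card_image[OF inj(1)] card_image[OF inj(2)] card_image[OF inj(3)] P(2) ..
  finally show ?thesis
    by simp
qed

lemma card_verts_triangular_pyramid_3: "card (verts (triangular_pyramid 3)) = 10"
proof -
  have "verts (triangular_pyramid 3) = Sigma {1..4} (\<lambda>i. {1..i})"
    by (auto simp: triangular_pyramid_def)
  then show ?thesis
    by (simp add: numeral_eq_Suc atLeastAtMostSuc_conv)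
qed

end

theory Submission
  imports Defs "HOL-Analysis.Convex"
begin

text \<open>
  Lower bound: in the join of \<open>K\<^sub>2\<close> with a balanced complete bipartite graph every triangle meets the
  two dominating vertices, while \<open>TP\<^sub>3\<close> has three disjoint triangles, at its corners.

  Upper bound: deleting vertices of degree below \<open>n / 2\<close>, we may assume minimum degree \<open>n / 2\<close>.  A graph
  with many triangles contains \<open>K\<^bsub>4,4,4\<^esub>\<close> and hence \<open>TP\<^sub>3\<close>; with few triangles, the neighbourhood of a
  suitable vertex and its complement form an almost complete cut with few inner edges, which we improve to
  a maximum cut \<open>(A, B)\<close>.  Let \<open>W\<close> be the set of vertices of linear degree inside their class.  Three
  vertices of \<open>W\<close> with common neighbours in both classes give \<open>TP\<^sub>3\<close> (they take alternate vertices of the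
  hexagon around the centre), so the degrees in \<open>W\<close> exceed \<open>n / 2\<close> by at most
  \<open>n - 2 (n - |N(W)|) + o(n)\<close> in total.  Outside \<open>W\<close> the two classes are almost completely joined.  Removing an
  independent set of three or four vertices from \<open>TP\<^sub>3\<close> can leave the spider with three legs of length two
  or the hexagon, so \<open>A - W\<close> contains neither and any set of \<open>k\<close> of its vertices spans at most \<open>2 k\<close> edges.
  If \<open>W\<close> is nonempty, few inner edges meet \<open>N(W)\<close>, since three disjoint ones at a neighbourhood \<open>N(w)\<close>
  give \<open>TP\<^sub>3\<close> with centre \<open>w\<close>; the remaining ones number at most \<open>2 (n - |N(W)|)\<close>.  If \<open>W\<close> is
  empty, a star with three leaves in one class and three disjoint edges in the other give \<open>TP\<^sub>3\<close>, which
  bounds the inner edges minus the missing edges by \<open>n + o(n)\<close>.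
\<close>

subsection \<open>Degree sums\<close>

text \<open>The obstacle is the meaning of linear degree. If \<open>W\<close> consists of the
  vertices of inner degree at least \<eta> n, the inner edges near \<open>W\<close> are bounded
  through an almost complete pair that keeps only vertices of inner degree below \<eta>' n; the
  error is about |W| \<eta>' n, and |W| is only known to be at most 8 / \<eta>^2. So \<eta>' must be
  far below \<eta>^2, and the vertices between the two thresholds fit neither argument. They are
  deleted, and each costs only its degree excess over n / 2. Minimum degree n / 2 makes every excess
  nonnegative, while the doubled excess of all high vertices stays below 3 n at each scale. Hence,
  along a decreasing sequence of thresholds, some consecutive pair has little excess in between, and
  that pair serves as \<eta> and \<eta>'. The linear term n arises twice: as the excess allowed to
  \<open>W\<close>, and, if \<open>W\<close> is empty, because a class of about n / 2 vertices spans
  at most two edges per vertex.\<close>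

definition deg_in :: "('a \<Rightarrow> 'a \<Rightarrow> bool) \<Rightarrow> 'a set \<Rightarrow> 'a \<Rightarrow> nat" where
  "deg_in R S v = card {u \<in> S. R v u}"

text \<open>Each edge inside \<open>S\<close> is counted from both ends, so the target n^2 / 4 + n
  reads n^2 / 2 + 2 n below. With relation and vertex set kept apart, an induced subgraph is a
  change of \<open>S\<close> only, and \<open>R\<close> can also be non-adjacency or a selection of
  edges.\<close>

definition deg_sum :: "('a \<Rightarrow> 'a \<Rightarrow> bool) \<Rightarrow> 'a set \<Rightarrow> nat" where
  "deg_sum R S = (\<Sum>v\<in>S. deg_in R S v)"

lemma deg_in_mono: "S \<subseteq> T \<Longrightarrow> finite T \<Longrightarrow> deg_in R S v \<le> deg_in R T v"
  unfolding deg_in_def by (rule card_mono) auto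

lemma deg_in_le_card: "finite S \<Longrightarrow> deg_in R S v \<le> card S"
  unfolding deg_in_def by (rule card_mono) auto

lemma deg_in_Un:
  assumes "finite S" "finite T" "S \<inter> T = {}"
  shows "deg_in R (S \<union> T) v = deg_in R S v + deg_in R T v"
proof -
  have "{u \<in> S \<union> T. R v u} = {u \<in> S. R v u} \<union> {u \<in> T. R v u}" by auto
  then show ?thesis
    unfolding deg_in_def using assms by (simp add: card_Un_disjoint disjoint_iff)
qed

lemma deg_in_Un_le: "finite S \<Longrightarrow> finite T \<Longrightarrow> deg_in R (S \<union> T) v \<le> deg_in R S v + deg_in R T v"
proof -
  assume "finite S" "finite T"
  have "{u \<in> S \<union> T. R v u} = {u \<in> S. R v u} \<union> {u \<in> T. R v u}" by auto
  then show ?thesis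
    unfolding deg_in_def by (simp add: card_Un_le)
qed

lemma deg_in_insert:
  assumes "finite S" "x \<notin> S"
  shows "deg_in R (insert x S) v = deg_in R S v + (if R v x then 1 else 0)"
proof -
  have "{u \<in> insert x S. R v u} = (if R v x then insert x {u \<in> S. R v u} else {u \<in> S. R v u})"
    by auto
  then show ?thesis
    unfolding deg_in_def using assms by simp
qed

lemma deg_in_compl:
  assumes "finite S"
  shows "deg_in R S v + card {u \<in> S. \<not> R v u} = card S"
proof -
  have "card S = card ({u \<in> S. R v u} \<union> {u \<in> S. \<not> R v u})"
    by (rule arg_cong[where f = card]) auto
  also have "\<dots> = card {u \<in> S. R v u} + card {u \<in> S. \<not> R v u}"
    using assms by (intro card_Un_disjoint) auto
  finally show ?thesis unfolding deg_in_def by simp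
qed

lemma deg_in_eq_sum: "finite S \<Longrightarrow> deg_in R S v = (\<Sum>u\<in>S. if R v u then 1 else 0)"
  unfolding deg_in_def by (simp add: sum.If_cases Int_def)

lemma deg_in_swap:
  assumes "symp R" "finite S" "finite T"
  shows "(\<Sum>v\<in>S. deg_in R T v) = (\<Sum>u\<in>T. deg_in R S u)"
proof -
  have "(\<Sum>v\<in>S. deg_in R T v) = (\<Sum>v\<in>S. \<Sum>u\<in>T. if R v u then 1 else 0)"
    using assms by (simp add: deg_in_eq_sum)
  also have "\<dots> = (\<Sum>u\<in>T. \<Sum>v\<in>S. if R v u then 1 else 0)"
    by (rule sum.swap)
  also have "\<dots> = (\<Sum>u\<in>T. \<Sum>v\<in>S. if R u v then 1 else 0)"
    using sympD[OF assms(1)] by (intro sum.cong refl if_cong) blast+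
  also have "\<dots> = (\<Sum>u\<in>T. deg_in R S u)"
    using assms by (simp add: deg_in_eq_sum)
  finally show ?thesis .
qed

lemma deg_sum_Un:
  assumes "symp R" "finite S" "finite T" "S \<inter> T = {}"
  shows "deg_sum R (S \<union> T) = deg_sum R S + deg_sum R T + 2 * (\<Sum>v\<in>S. deg_in R T v)"
  using assms deg_in_swap[OF assms(1-3)] unfolding deg_sum_def
  by (simp add: sum.union_disjoint deg_in_Un sum.distrib)

lemma deg_sum_insert:
  assumes "symp R" "irreflp R" "finite S" "x \<notin> S"
  shows "deg_sum R (insert x S) = deg_sum R S + 2 * deg_in R S x"
proof -
  have "deg_sum R {x} = 0"
    using assms(2) by (auto simp: deg_sum_def deg_in_def irreflp_def)
  then show ?thesis
    using deg_sum_Un[of R "{x}" S] assms by simp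
qed

lemma deg_in_le_deg_in: "(\<And>u. u \<in> S \<Longrightarrow> R v u \<Longrightarrow> Q v u) \<Longrightarrow> finite S \<Longrightarrow> deg_in R S v \<le> deg_in Q S v"
  unfolding deg_in_def by (rule card_mono) auto

text \<open>
  The centre \<open>c\<close> is \<open>(3, 2)\<close>, its neighbours \<open>h1, \<dots>, h6\<close> in cyclic order are
  \<open>(2, 1), (2, 2), (3, 3), (4, 3), (4, 2), (3, 1)\<close>, and the corners \<open>k1, k2, k3\<close> are \<open>(1, 1), (4, 4), (4, 1)\<close>.
\<close>
definition has_pyramid :: "('a \<Rightarrow> 'a \<Rightarrow> bool) \<Rightarrow> 'a set \<Rightarrow> bool" where
  "has_pyramid R S \<longleftrightarrow> (\<exists>c h1 h2 h3 h4 h5 h6 k1 k2 k3.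
     distinct [c, h1, h2, h3, h4, h5, h6, k1, k2, k3] \<and> {c, h1, h2, h3, h4, h5, h6, k1, k2, k3} \<subseteq> S \<and>
     R c h1 \<and> R c h2 \<and> R c h3 \<and> R c h4 \<and> R c h5 \<and> R c h6 \<and>
     R h1 h2 \<and> R h2 h3 \<and> R h3 h4 \<and> R h4 h5 \<and> R h5 h6 \<and> R h6 h1 \<and>
     R k1 h1 \<and> R k1 h2 \<and> R k2 h3 \<and> R k2 h4 \<and> R k3 h5 \<and> R k3 h6)"

definition has_spider :: "('a \<Rightarrow> 'a \<Rightarrow> bool) \<Rightarrow> 'a set \<Rightarrow> bool" where
  "has_spider R S \<longleftrightarrow> (\<exists>v x1 y1 x2 y2 x3 y3. distinct [v, x1, y1, x2, y2, x3, y3] \<and>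
     {v, x1, y1, x2, y2, x3, y3} \<subseteq> S \<and>
     R v x1 \<and> R x1 y1 \<and> R v x2 \<and> R x2 y2 \<and> R v x3 \<and> R x3 y3)"

definition has_hexagon :: "('a \<Rightarrow> 'a \<Rightarrow> bool) \<Rightarrow> 'a set \<Rightarrow> bool" where
  "has_hexagon R S \<longleftrightarrow> (\<exists>h1 h2 h3 h4 h5 h6. distinct [h1, h2, h3, h4, h5, h6] \<and>
     {h1, h2, h3, h4, h5, h6} \<subseteq> S \<and>
     R h1 h2 \<and> R h2 h3 \<and> R h3 h4 \<and> R h4 h5 \<and> R h5 h6 \<and> R h6 h1)"

section \<open>Distinct elements and common neighbours\<close>

lemma obtain_distinct2:
  assumes "card T \<ge> 2"
  obtains a b where "a \<in> T" "b \<in> T" "a \<noteq> b"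
proof -
  obtain U where U: "U \<subseteq> T" "card U = 2"
    by (rule obtain_subset_with_card_n[OF assms])
  then obtain a b where "U = {a, b}" "a \<noteq> b"
    unfolding card_2_iff by blast
  then show thesis
    using U(1) by (intro that[of a b]) simp_all
qed

lemma obtain_distinct3:
  assumes "card T \<ge> 3"
  obtains a b c where "a \<in> T" "b \<in> T" "c \<in> T" "a \<noteq> b" "a \<noteq> c" "b \<noteq> c"
proof -
  obtain U where U: "U \<subseteq> T" "card U = 3"
    by (rule obtain_subset_with_card_n[OF assms])
  obtain a b c where "U = {a, b, c}" "a \<noteq> b" "b \<noteq> c" "c \<noteq> a"
    using U(2) unfolding card_3_iff by metis
  then show thesis
    using U(1) by (intro that[of a b c]) simp_all
qed

lemma obtain_distinct4:
  assumes "card T \<ge> 4"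
  obtains a b c d where "a \<in> T" "b \<in> T" "c \<in> T" "d \<in> T" "distinct [a, b, c, d]"
proof -
  have "T \<noteq> {}" using assms by auto
  then obtain a where a: "a \<in> T" by blast
  then have "card (T - {a}) \<ge> 3"
    using assms by (simp add: card_Diff_singleton)
  then obtain b c d where "b \<in> T - {a}" "c \<in> T - {a}" "d \<in> T - {a}" "b \<noteq> c" "b \<noteq> d" "c \<noteq> d"
    by (rule obtain_distinct3)
  then show thesis
    using a by (intro that[of a b c d]) auto
qed

text \<open>Union bound: each \<open>s\<close> rules out at most \<open>m\<close> elements of
  \<open>Y\<close>.\<close>

lemma common_neighbours:
  fixes m :: real
  assumes "finite S" "finite Y" "\<And>s. s \<in> S \<Longrightarrow> card {y \<in> Y. \<not> R s y} \<le> m"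
    and "card Y \<ge> card S * m + t"
  shows "card {y \<in> Y. \<forall>s\<in>S. R s y} \<ge> t"
proof -
  have "card (\<Union>s\<in>S. {y \<in> Y. \<not> R s y}) \<le> (\<Sum>s\<in>S. card {y \<in> Y. \<not> R s y})"
    using assms(1) by (rule card_UN_le)
  from of_nat_mono[OF this, where 'a = real]
  have "real (card (\<Union>s\<in>S. {y \<in> Y. \<not> R s y})) \<le> (\<Sum>s\<in>S. real (card {y \<in> Y. \<not> R s y}))"
    by simp
  also have "\<dots> \<le> card S * m"
    using sum_bounded_above[of S "\<lambda>s. real (card {y \<in> Y. \<not> R s y})" m] assms(3) by simp
  finally have 1: "real (card (\<Union>s\<in>S. {y \<in> Y. \<not> R s y})) \<le> card S * m" .
  have "card Y = card ({y \<in> Y. \<forall>s\<in>S. R s y} \<union> (\<Union>s\<in>S. {y \<in> Y. \<not> R s y}))"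
    by (rule arg_cong[where f = card]) auto
  also have "\<dots> \<le> card {y \<in> Y. \<forall>s\<in>S. R s y} + card (\<Union>s\<in>S. {y \<in> Y. \<not> R s y})"
    by (rule card_Un_le)
  finally have "card Y \<le> card {y \<in> Y. \<forall>s\<in>S. R s y} + card (\<Union>s\<in>S. {y \<in> Y. \<not> R s y})" .
  then have "real (card Y) \<le> real (card {y \<in> Y. \<forall>s\<in>S. R s y}) + card (\<Union>s\<in>S. {y \<in> Y. \<not> R s y})"
    by linarith
  then show ?thesis using 1 assms(4) by linarith
qed

subsection \<open>Graphs without a spider and without a hexagon\<close>

text \<open>Hall's theorem for three subsets of \<open>{a, b, c}\<close> with at least two elements
  each: the only obstruction to distinct representatives is that all three equal one pair, which the
  last three disjuncts cover.\<close>

lemma sdr3: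
  fixes P Q S :: "'a \<Rightarrow> bool"
  assumes "(P a \<and> P b) \<or> (P a \<and> P c) \<or> (P b \<and> P c)"
    "(Q a \<and> Q b) \<or> (Q a \<and> Q c) \<or> (Q b \<and> Q c)"
    "(S a \<and> S b) \<or> (S a \<and> S c) \<or> (S b \<and> S c)"
  shows "(P a \<and> Q b \<and> S c) \<or> (P a \<and> Q c \<and> S b) \<or> (P b \<and> Q a \<and> S c) \<or> (P b \<and> Q c \<and> S a) \<or>
    (P c \<and> Q a \<and> S b) \<or> (P c \<and> Q b \<and> S a) \<or>
    (P a \<and> Q a \<and> S a \<and> P b \<and> Q b \<and> S b) \<or> (P a \<and> Q a \<and> S a \<and> P c \<and> Q c \<and> S c) \<or>
    (P b \<and> Q b \<and> S b \<and> P c \<and> Q c \<and> S c)"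
  using assms by satx

lemma has_spider_mono: "has_spider R S \<Longrightarrow> S \<subseteq> T \<Longrightarrow> has_spider R T"
  unfolding has_spider_def by (meson order_trans)

lemma has_hexagon_mono: "has_hexagon R S \<Longrightarrow> S \<subseteq> T \<Longrightarrow> has_hexagon R T"
  unfolding has_hexagon_def by (meson order_trans)

text \<open>The legs come from disjoint edges of which only some end is known to be next to
  \<open>v\<close>; each is turned so that this end comes first.\<close>

lemma has_spiderI:
  assumes "symp R" "distinct [v, x1, y1, x2, y2, x3, y3]" "{v, x1, y1, x2, y2, x3, y3} \<subseteq> S"
    and e: "R x1 y1" "R x2 y2" "R x3 y3"
    and n: "R v x1 \<or> R v y1" "R v x2 \<or> R v y2" "R v x3 \<or> R v y3"
  shows "has_spider R S"
proof -
  have "\<exists>x y. {x, y} = {x1, y1} \<and> R x y \<and> R v x \<and> x \<noteq> y"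
    using e(1) n(1) sympD[OF assms(1) e(1)] assms(2) by (metis distinct_length_2_or_more insert_commute)
  then obtain a1 b1 where 1: "{a1, b1} = {x1, y1}" "R a1 b1" "R v a1" "a1 \<noteq> b1" by blast
  have "\<exists>x y. {x, y} = {x2, y2} \<and> R x y \<and> R v x \<and> x \<noteq> y"
    using e(2) n(2) sympD[OF assms(1) e(2)] assms(2) by (metis distinct_length_2_or_more insert_commute)
  then obtain a2 b2 where 2: "{a2, b2} = {x2, y2}" "R a2 b2" "R v a2" "a2 \<noteq> b2" by blast
  have "\<exists>x y. {x, y} = {x3, y3} \<and> R x y \<and> R v x \<and> x \<noteq> y"
    using e(3) n(3) sympD[OF assms(1) e(3)] assms(2) by (metis distinct_length_2_or_more insert_commute)
  then obtain a3 b3 where 3: "{a3, b3} = {x3, y3}" "R a3 b3" "R v a3" "a3 \<noteq> b3" by blast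
  have "distinct [v, a1, b1, a2, b2, a3, b3]"
    using assms(2) 1(1,4) 2(1,4) 3(1,4) by (auto simp: doubleton_eq_iff)
  moreover have "{v, a1, b1, a2, b2, a3, b3} \<subseteq> S"
    using assms(3) 1(1) 2(1) 3(1) by (auto simp: doubleton_eq_iff)
  ultimately show ?thesis
    unfolding has_spider_def using 1 2 3 by blast
qed

lemma has_hexagonI_K33:
  assumes "symp R" "distinct [v, p, q, x, y, z]" "{v, p, q, x, y, z} \<subseteq> S"
    "R v x" "R v y" "R v z" "R x p" "R y p" "R z p" "R x q" "R y q" "R z q"
  shows "has_hexagon R S"
  unfolding has_hexagon_def
  by (rule exI[of _ v], rule exI[of _ x], rule exI[of _ p], rule exI[of _ y], rule exI[of _ q], rule exI[of _ z])
    (use assms(2-) assms(1)[THEN sympD] in auto)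

text \<open>A graph on five vertices with minimum degree two has a Hamiltonian path, and
  \<open>v\<close> closes it to a hexagon. Minimum degree two is stated as: a neighbour remains
  after excluding any \<open>w\<close>.\<close>

lemma has_hexagon_min_degree:
  assumes "symp R" and dist: "distinct [v, a, b, c, d, e]" and sub: "{v, a, b, c, d, e} \<subseteq> S"
    and v: "R v a" "R v b" "R v c" "R v d" "R v e"
    and deg: "\<And>x w. x \<in> {a, b, c, d, e} \<Longrightarrow> \<exists>z\<in>{a, b, c, d, e} - {x, w}. R x z"
  shows "has_hexagon R S"
proof -
  note sym = sympD[OF assms(1)]
  let ?Q = "{a, b, c, d, e}"
  have path5: "has_hexagon R S"
    if "set [p, q, r, s, t] \<subseteq> ?Q" "distinct [p, q, r, s, t]" "R p q" "R q r" "R r s" "R s t" for p q r s t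
    unfolding has_hexagon_def
    by (rule exI[of _ v], rule exI[of _ p], rule exI[of _ q], rule exI[of _ r], rule exI[of _ s], rule exI[of _ t])
      (use that dist sub v sym in auto)
  \<comment> \<open>A path on four of the five vertices suffices: if the fifth vertex
    \<open>t\<close> sees neither end, its two neighbours are \<open>q\<close> and \<open>r\<close>,
    and it fits between them.\<close>
  have path4: "has_hexagon R S"
    if Q: "set [p, q, r, s, t] = ?Q" and D: "distinct [p, q, r, s, t]" and P: "R p q" "R q r" "R r s" for p q r s t
  proof (cases "R t p \<or> R t s")
    case True
    then show ?thesis
      using path5[of t p q r s] path5[of p q r s t] Q D P sym by auto
  next
    case False
    have "\<exists>z\<in>?Q - {t, q}. R t z" "\<exists>z\<in>?Q - {t, r}. R t z"
      using deg[of t q] deg[of t r] Q by auto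
    then have "R t r" "R t q"
      using False unfolding Q[symmetric] by auto
    then show ?thesis
      using path5[of p q t r s] Q D P sym by auto
  qed
  have "\<exists>z\<in>?Q - {a, a}. R a z" using deg[of a a] by simp
  then obtain y where y: "y \<in> ?Q - {a}" "R a y" by auto
  obtain z where z: "z \<in> ?Q - {a, y}" "R a z" using deg[of a y] by auto
  have "card (?Q - {a, y, z}) = 2"
    using y z dist by auto
  then obtain s t where st: "?Q - {a, y, z} = {s, t}" "s \<noteq> t"
    by (auto simp: card_2_iff)
  have Q: "?Q = {a, y, z, s, t}" using st(1) y z by auto
  have stQ: "s \<in> ?Q" "t \<in> ?Q" "s \<notin> {a, y, z}" "t \<notin> {a, y, z}" using st by auto
  have D: "distinct [a, y, z, s, t]" using y z stQ st(2) by auto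
  show ?thesis
  proof (cases "R s y \<or> R s z \<or> R t y \<or> R t z")
    case True
    then show ?thesis
      using path4[of s y a z t] path4[of s z a y t] path4[of t y a z s] path4[of t z a y s]
        Q D y(2) z(2) sym by (auto simp: insert_commute)
  next
    \<comment> \<open>What remains is two triangles \<open>a y z\<close> and \<open>a s t\<close>
      with a common vertex.\<close>
    case False
    have "\<exists>w\<in>?Q - {s, t}. R s w" "\<exists>w\<in>?Q - {s, a}. R s w" "\<exists>w\<in>?Q - {t, s}. R t w" "\<exists>w\<in>?Q - {y, a}. R y w"
      using deg[of s t] deg[of s a] deg[of t s] deg[of y a] stQ y by auto
    then have "R s a" "R s t" "R t a" "R y z"
      using False sym unfolding Q by auto
    then show ?thesis
      using path5[of y z a s t] Q D z(2) sym by auto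
  qed
qed

text \<open>If no end of \<open>a b\<close> lies on all edges, one edge avoids \<open>a\<close> and
  so contains \<open>b\<close>, another avoids \<open>b\<close> and so contains \<open>a\<close>; as
  these two meet, they share a third vertex \<open>c\<close>. Every further edge meets all sides of
  the triangle.\<close>

lemma pairwise_meeting_edges:
  assumes F: "F a b" and sym: "\<And>u w. F u w \<Longrightarrow> F w u" and irr: "\<And>u. \<not> F u u"
    and meet: "\<And>u w u' w'. F u w \<Longrightarrow> F u' w' \<Longrightarrow> {u, w} \<inter> {u', w'} \<noteq> {}"
  shows "(\<exists>p q. F p q \<and> (\<forall>u w. F u w \<longrightarrow> p \<in> {u, w})) \<or>
    (\<exists>c. distinct [a, b, c] \<and> F b c \<and> F a c \<and> (\<forall>u w. F u w \<longrightarrow> {u, w} \<subseteq> {a, b, c}))"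
proof (cases "(\<forall>u w. F u w \<longrightarrow> a \<in> {u, w}) \<or> (\<forall>u w. F u w \<longrightarrow> b \<in> {u, w})")
  case True
  then show ?thesis using F sym[OF F] by blast
next
  case False
  then obtain u w u' w' where uw: "F u w" "a \<notin> {u, w}" and uw': "F u' w'" "b \<notin> {u', w'}" by blast
  obtain c where c: "F b c" "c \<noteq> a"
    using meet[OF F uw(1)] uw sym by blast
  have ac: "F a c"
    using meet[OF F uw'(1)] meet[OF c(1) uw'(1)] uw' sym c by blast
  have d: "a \<noteq> b" "b \<noteq> c" "a \<noteq> c" using F c ac irr by auto
  have "{u, w} \<subseteq> {a, b, c}" if "F u w" for u w
    using meet[OF F that] meet[OF c(1) that] meet[OF ac that] d by blast
  then show ?thesis using d c(1) ac by (intro disjI2 exI[of _ c]) simp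
qed

lemma two_other_neighbours:
  assumes "finite S" "deg_in R S x \<ge> 3"
  shows "\<exists>z\<in>S. R x z \<and> z \<noteq> v \<and> z \<noteq> w"
proof (rule ccontr)
  assume "\<not> ?thesis"
  then have "{u \<in> S. R x u} \<subseteq> {v, w}" by auto
  then have "card {u \<in> S. R x u} \<le> card {v, w}" by (intro card_mono) auto
  also have "\<dots> \<le> 2" by (simp add: card_insert_le_m1)
  finally show False using assms(2) by (simp add: deg_in_def)
qed

text \<open>
  The edges avoiding \<open>v\<close> that meet \<open>N(v)\<close> contain no three disjoint ones, as these would be the legs
  of a spider.  With five neighbours of degree at least three, such a configuration is a
  \<open>K\<^bsub>3,3\<^esub>\<close>, or lies on the five neighbours, or has a triangle that only \<open>v\<close> links to the rest.
\<close>
lemma closed_triangle_of_degree_5: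
  assumes R: "symp R" "irreflp R" and S: "finite S" "v \<in> S" "deg_in R S v \<ge> 5"
    and deg: "\<And>x. x \<in> S \<Longrightarrow> deg_in R S x \<ge> 3"
    and ns: "\<not> has_spider R S" and nh: "\<not> has_hexagon R S"
  shows "\<exists>a b c. distinct [a, b, c] \<and> {a, b, c} \<subseteq> S \<and> v \<notin> {a, b, c} \<and>
    (\<forall>x\<in>{a, b, c}. \<forall>z\<in>S. R x z \<longrightarrow> z \<in> {a, b, c, v})"
proof -
  note sym = sympD[OF R(1)]
  have irr: "\<not> R x x" for x using R(2) by (simp add: irreflp_def)
  obtain Q where Q: "Q \<subseteq> {u \<in> S. R v u}" "card Q = 5"
    using S(3) unfolding deg_in_def by (rule obtain_subset_with_card_n)
  have fQ: "finite Q" using Q(2) card_ge_0_finite[of Q] by simp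
  have vQ: "v \<notin> Q" using Q irr by auto
  have nb: "\<exists>z\<in>S. R x z \<and> z \<noteq> v \<and> z \<noteq> w" if "x \<in> Q" for x w
    using two_other_neighbours[OF S(1) deg] that Q(1) by blast
  show ?thesis
  proof (cases "\<exists>x1\<in>Q. \<exists>y\<in>S - Q - {v}. R x1 y")
    case False
    obtain xs where xs: "set xs = Q" "distinct xs" "length xs = 5"
      using finite_distinct_list[OF fQ] Q(2) distinct_card by metis
    then obtain a b c d e where "xs = [a, b, c, d, e]"
      by (auto simp: length_Suc_conv eval_nat_numeral)
    with xs have abc: "Q = {a, b, c, d, e}" "distinct [a, b, c, d, e]" by auto
    have "has_hexagon R S"
    proof (rule has_hexagon_min_degree[OF R(1)])
      show "distinct [v, a, b, c, d, e]" "{v, a, b, c, d, e} \<subseteq> S"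
        using abc vQ Q S(2) by auto
      show "R v a" "R v b" "R v c" "R v d" "R v e" using abc Q by auto
      show "\<exists>z\<in>{a, b, c, d, e} - {x, w}. R x z" if "x \<in> {a, b, c, d, e}" for x w
        using nb[of x w] that False irr unfolding abc(1)[symmetric] by blast
    qed
    then show ?thesis using nh by simp
  next
    case True
    then obtain x1 y where x1: "x1 \<in> Q" and y: "y \<in> S" "y \<notin> Q" "y \<noteq> v" "R x1 y" by auto
    define Q' where "Q' = Q - {x1}"
    have Q': "card Q' = 4" "finite Q'" "Q' \<subseteq> S" "x1 \<notin> Q'" "y \<notin> Q'" "v \<notin> Q'" "\<And>x. x \<in> Q' \<Longrightarrow> R v x"
      "Q' \<subseteq> Q"
      using Q x1 fQ y vQ by (auto simp: Q'_def)
    have x1': "x1 \<in> S" "R v x1" "x1 \<noteq> y" "x1 \<noteq> v" using x1 Q y vQ by auto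
    \<comment> \<open>The edge \<open>x1 y\<close> is fixed as one leg at \<open>v\<close>. Two
      disjoint edges of \<open>F\<close> would be the other two legs, so \<open>F\<close> is a star
      or a triangle, or empty.\<close>
    define F where "F u w \<longleftrightarrow> R u w \<and> (u \<in> Q' \<or> w \<in> Q') \<and> {u, w} \<subseteq> S - {v, x1, y}" for u w
    have Fsym: "F u w \<Longrightarrow> F w u" for u w using sym by (auto simp: F_def)
    have Firr: "\<not> F u u" for u using irr by (simp add: F_def)
    have Fnb: "z \<in> {v, x1, y} \<or> F x z" if "x \<in> Q'" "z \<in> S" "R x z" for x z
      using that Q' by (auto simp: F_def)
    have meet: "{u, w} \<inter> {u', w'} \<noteq> {}" if "F u w" "F u' w'" for u w u' w'
    proof
      assume disj: "{u, w} \<inter> {u', w'} = {}"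
      have "has_spider R S"
        by (rule has_spiderI[OF R(1), of v x1 y u w u' w'])
          (use that disj x1' y S(2) Q' irr in \<open>auto simp: F_def\<close>)
      then show False using ns by simp
    qed
    show ?thesis
    proof (cases "\<exists>u w. F u w")
      case False
      obtain a b c where abc: "a \<in> Q'" "b \<in> Q'" "c \<in> Q'" "a \<noteq> b" "a \<noteq> c" "b \<noteq> c"
        using obtain_distinct3[of Q'] Q'(1) by auto
      have *: "R x x1 \<and> R x y" if "x \<in> Q'" for x
        using nb[of x x1] nb[of x y] Fnb[OF that] False that Q'(8) by blast
      have "has_hexagon R S"
        by (rule has_hexagonI_K33[OF R(1), of v x1 y a b c])
          (use abc Q' x1' y S(2) * in auto)
      then show ?thesis using nh by simp
    next
      case True
      then obtain a b where ab: "F a b" by blast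
      from pairwise_meeting_edges[of F, OF ab Fsym Firr meet]
      consider (star) p q where "F p q" "\<And>u w. F u w \<Longrightarrow> p \<in> {u, w}"
        | (triangle) c where "distinct [a, b, c]" "F b c" "F a c" "\<And>u w. F u w \<Longrightarrow> {u, w} \<subseteq> {a, b, c}"
        by blast
      then show ?thesis
      proof cases
        case (star p q)
        then have p: "p \<notin> {v, x1, y}" "p \<in> S" by (auto simp: F_def)
        have "card (Q' - {p}) \<ge> 3"
          using Q'(1,2) by (simp add: card_Diff_singleton_if)
        then obtain a b c where abc: "a \<in> Q' - {p}" "b \<in> Q' - {p}" "c \<in> Q' - {p}" "a \<noteq> b" "a \<noteq> c" "b \<noteq> c"
          by (rule obtain_distinct3)
        have *: "(R x x1 \<and> R x y) \<or> (R x x1 \<and> R x p) \<or> (R x y \<and> R x p)" if x: "x \<in> Q' - {p}" for x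
        proof -
          have 1: "z \<in> {v, x1, y, p}" if "z \<in> S" "R x z" for z
            using Fnb[of x z] star(2)[of x z] x that by auto
          have "\<exists>z\<in>{x1, y, p}. R x z \<and> z \<noteq> w" for w
            using nb[of x w] 1 x Q'(8) by blast
          from this[of x1] this[of y] this[of p] show ?thesis by blast
        qed
        have sp: "has_spider R S" if "R s x1" "R t y" "R u p" "distinct [s, t, u]" "{s, t, u} \<subseteq> Q' - {p}" for s t u
          by (rule has_spiderI[OF R(1), of v s x1 t y u p])
            (use that p Q' x1' y S(2) in auto)
        have hx: "has_hexagon R S" if "R a s" "R b s" "R c s" "R a t" "R b t" "R c t" "s \<noteq> t" "{s, t} \<subseteq> {x1, y, p}" for s t
          by (rule has_hexagonI_K33[OF R(1), of v s t a b c])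
            (use that p Q' x1' y S(2) abc in auto)
        have xyp: "x1 \<noteq> y" "x1 \<noteq> p" "y \<noteq> p" using x1' p by auto
        have ns': "\<not> (R s x1 \<and> R t y \<and> R u p)" if "distinct [s, t, u]" "{s, t, u} \<subseteq> Q' - {p}" for s t u
          using sp that ns by blast
        have nh': "\<not> (R a s \<and> R b s \<and> R c s \<and> R a t \<and> R b t \<and> R c t)"
          if "s \<noteq> t" "{s, t} \<subseteq> {x1, y, p}" for s t
          using hx that nh by blast
        have n1: "\<not> (R a x1 \<and> R b y \<and> R c p)" "\<not> (R a x1 \<and> R c y \<and> R b p)"
          "\<not> (R b x1 \<and> R a y \<and> R c p)" "\<not> (R b x1 \<and> R c y \<and> R a p)"
          "\<not> (R c x1 \<and> R a y \<and> R b p)" "\<not> (R c x1 \<and> R b y \<and> R a p)"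
          using abc by (intro ns'; simp)+
        have n2: "\<not> (R a x1 \<and> R b x1 \<and> R c x1 \<and> R a y \<and> R b y \<and> R c y)"
          "\<not> (R a x1 \<and> R b x1 \<and> R c x1 \<and> R a p \<and> R b p \<and> R c p)"
          "\<not> (R a y \<and> R b y \<and> R c y \<and> R a p \<and> R b p \<and> R c p)"
          using xyp by (intro nh'; simp)+
        \<comment> \<open>Distinct representatives give three disjoint legs from \<open>a\<close>,
          \<open>b\<close>, \<open>c\<close> to \<open>x1\<close>, \<open>y\<close>,
          \<open>p\<close>; a common pair gives a \<open>K_{3,3}\<close> with \<open>v\<close> and
          that pair on one side.\<close>
        from sdr3[of "R a" x1 y p "R b" "R c", OF *[OF abc(1)] *[OF abc(2)] *[OF abc(3)]]
        have False
          using n1 n2 by satx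
        then show ?thesis ..
      next
        case (triangle c)
        let ?T = "{a, b, c}"
        have T: "?T \<subseteq> S - {v, x1, y}" using ab triangle by (auto simp: F_def)
        have d: "R d x1 \<and> R d y" if "d \<in> Q' - ?T" for d
        proof -
          have 1: "z \<in> {v, x1, y}" if "z \<in> S" "R d z" for z
            using Fnb[of d z] triangle(4)[of d z] \<open>d \<in> Q' - ?T\<close> that by auto
          show ?thesis using nb[of d x1] nb[of d y] 1 that Q'(8) by blast
        qed
        \<comment> \<open>If \<open>?T\<close> lies in \<open>Q'\<close>, an edge from
          \<open>t\<close> in \<open>?T\<close> to \<open>z\<close> in \<open>{x1, y}\<close> yields
          the legs \<open>t z\<close>, \<open>s u\<close>, \<open>d z'\<close>, so \<open>?T\<close>
          is closed up to \<open>v\<close>. Otherwise two vertices \<open>d\<close>,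
          \<open>e\<close> of \<open>Q'\<close> outside \<open>?T\<close> see both \<open>x1\<close>
          and \<open>y\<close>, and \<open>a b\<close>, \<open>d x1\<close>, \<open>e y\<close> are
          legs.\<close>
        show ?thesis
        proof (cases "?T \<subseteq> Q'")
          case True
          have "card (Q' - ?T) \<ge> 1"
            using Q'(1) card_Diff_subset[of ?T Q'] True triangle(1) by simp
          then obtain d where d': "d \<in> Q' - ?T"
            by (metis card.empty ex_in_conv not_one_le_zero)
          have "z \<in> {a, b, c, v}" if tz: "t \<in> ?T" "z \<in> S" "R t z" for t z
          proof (rule ccontr)
            assume z: "z \<notin> {a, b, c, v}"
            then have zz: "z \<in> {x1, y}" using Fnb[of t z] triangle(4)[of t z] tz True by auto
            then obtain z' where z': "z' \<in> {x1, y}" "z' \<noteq> z" using x1'(3) by auto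
            obtain s u where su: "?T = {t, s, u}" "R s u" "distinct [t, s, u]"
              using tz(1) triangle(1-3) ab that[of b c] that[of a c] that[of a b] by (auto simp: F_def)
            have "has_spider R S"
              by (rule has_spiderI[OF R(1), of v t z s u d z'])
                (use su tz z' zz d[OF d'] d' True T Q' S(2) x1' y in auto)
            then show False using ns by simp
          qed
          then show ?thesis using triangle(1) T by blast
        next
          case False
          have "card (Q' \<inter> ?T) < card ?T"
            by (rule psubset_card_mono) (use False in auto)
          then have "card (Q' \<inter> ?T) \<le> 2" using triangle(1) by simp
          then have "card (Q' - ?T) \<ge> 2"
            using Q'(1,2) by (simp add: card_Diff_subset_Int)
          then obtain d e where de: "d \<in> Q' - ?T" "e \<in> Q' - ?T" "d \<noteq> e"
            by (rule obtain_distinct2)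
          have "has_spider R S"
            by (rule has_spiderI[OF R(1), of v a b d x1 e y])
              (use ab d[OF de(1)] d[OF de(2)] de T Q' x1' y S(2) triangle(1) in \<open>auto simp: F_def\<close>)
          then show ?thesis using ns by simp
        qed
      qed
    qed
  qed
qed

text \<open>Induction on the vertex set. A vertex of degree at most two takes away at most 4. If all
  degrees are at least three and one is at least five, the closed triangle takes away at most 6 for
  its own edges and 6 for those to \<open>v\<close>, again 4 per vertex. Otherwise all degrees are
  at most four. Disjoint copies of \<open>K_5\<close> attain the bound.\<close>

lemma deg_sum_le_of_no_spider_hexagon:
  assumes R: "symp R" "irreflp R" and "finite S" "\<not> has_spider R S" "\<not> has_hexagon R S"
  shows "deg_sum R S \<le> 4 * card S"
  using assms(3-)
proof (induction S rule: finite_psubset_induct)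
  case (psubset S)
  have IH: "deg_sum R T \<le> 4 * card T" if "T \<subset> S" for T
    using psubset.IH[OF that] psubset.prems has_spider_mono has_hexagon_mono that by blast
  consider (low) v where "v \<in> S" "deg_in R S v \<le> 2" | (high) v where "v \<in> S" "\<not> deg_in R S v \<le> 4"
    "\<forall>x\<in>S. \<not> deg_in R S x \<le> 2" | (mid) "\<forall>x\<in>S. deg_in R S x \<le> 4"
    by blast
  then show ?case
  proof cases
    case low
    have S: "S = insert v (S - {v})" "v \<notin> S - {v}" using low by auto
    have f: "finite (S - {v})" using psubset.hyps by simp
    have "deg_sum R S = deg_sum R (S - {v}) + 2 * deg_in R (S - {v}) v"
      using deg_sum_insert[OF R f S(2)] S(1) by simp
    also have "\<dots> \<le> 4 * card (S - {v}) + 2 * 2"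
      using IH[of "S - {v}"] low deg_in_mono[of "S - {v}" S R v] psubset.hyps by fastforce
    also have "\<dots> = 4 * card S"
      using low psubset.hyps card_gt_0_iff[of S] by (simp add: card_Diff_singleton) fastforce
    finally show ?thesis .
  next
    case high
    have deg: "deg_in R S v \<ge> 5" "\<And>x. x \<in> S \<Longrightarrow> deg_in R S x \<ge> 3"
      using high by (auto simp: not_le)
    have "\<exists>a b c. distinct [a, b, c] \<and> {a, b, c} \<subseteq> S \<and> v \<notin> {a, b, c} \<and>
      (\<forall>x\<in>{a, b, c}. \<forall>z\<in>S. R x z \<longrightarrow> z \<in> {a, b, c, v})"
      using R psubset.hyps(1) high(1) deg psubset.prems by (rule closed_triangle_of_degree_5)
    then obtain a b c where abc: "distinct [a, b, c] \<and> {a, b, c} \<subseteq> S \<and> v \<notin> {a, b, c} \<and>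
      (\<forall>x\<in>{a, b, c}. \<forall>z\<in>S. R x z \<longrightarrow> z \<in> {a, b, c, v})"
      by (elim exE) (rule that)
    then have T: "distinct [a, b, c]" "{a, b, c} \<subseteq> S" "v \<notin> {a, b, c}"
      by simp_all
    have T4: "z \<in> {a, b, c, v}" if "x \<in> {a, b, c}" "z \<in> S" "R x z" for x z
      using abc[THEN conjunct2, THEN conjunct2, THEN conjunct2] that by blast
    let ?T = "{a, b, c}"
    have f: "finite (S - ?T)" using psubset.hyps by simp
    have 1: "deg_in R ?T x \<le> 2" if "x \<in> ?T" for x
    proof -
      have "{u \<in> ?T. R x u} \<subseteq> ?T - {x}" using R(2) by (auto simp: irreflp_def)
      then have "deg_in R ?T x \<le> card (?T - {x})" unfolding deg_in_def by (intro card_mono) auto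
      also have "\<dots> = 2" using that T(1) by auto
      finally show ?thesis .
    qed
    have 2: "deg_in R (S - ?T) x \<le> 1" if "x \<in> ?T" for x
    proof -
      have "{u \<in> S - ?T. R x u} \<subseteq> {v}" using T4[OF that] by auto
      then show ?thesis unfolding deg_in_def using card_mono[of "{v}"] by fastforce
    qed
    have "deg_sum R S = deg_sum R (?T \<union> (S - ?T))" using T(2) by (intro arg_cong[where f = "deg_sum R"]) auto
    also have "\<dots> = deg_sum R ?T + deg_sum R (S - ?T) + 2 * (\<Sum>x\<in>?T. deg_in R (S - ?T) x)"
      by (rule deg_sum_Un[OF R(1) _ f]) auto
    also have "\<dots> \<le> card ?T * 2 + 4 * card (S - ?T) + 2 * (card ?T * 1)"
      using sum_bounded_above[of ?T "deg_in R ?T" 2] 1 sum_bounded_above[of ?T "deg_in R (S - ?T)" 1] 2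
        IH[of "S - ?T"] T(2) unfolding deg_sum_def by (intro add_mono mult_le_mono) auto
    also have "\<dots> = 4 * card S"
    proof -
      have "card (S - ?T) = card S - 3" "card S \<ge> 3"
        using T(1,2) psubset.hyps card_mono[OF psubset.hyps(1) T(2)] by (simp_all add: card_Diff_subset)
      then show ?thesis using T(1) by simp
    qed
    finally show ?thesis .
  next
    case mid
    then show ?thesis
      unfolding deg_sum_def using sum_bounded_above[of S "deg_in R S" 4] by (simp add: mult.commute)
  qed
qed

subsection \<open>Matchings\<close>

definition matching :: "('a \<Rightarrow> 'a \<Rightarrow> bool) \<Rightarrow> 'a set \<Rightarrow> ('a \<times> 'a) set \<Rightarrow> bool" where
  "matching R S M \<longleftrightarrow> finite M \<and> (\<forall>e\<in>M. fst e \<in> S \<and> snd e \<in> S \<and> R (fst e) (snd e)) \<and>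
     (\<forall>e\<in>M. \<forall>e'\<in>M. e \<noteq> e' \<longrightarrow> {fst e, snd e} \<inter> {fst e', snd e'} = {})"

definition matched :: "('a \<times> 'a) set \<Rightarrow> 'a set" where
  "matched M = fst ` M \<union> snd ` M"

lemma matchingD:
  assumes "matching R S M"
  shows "finite M" "(p, q) \<in> M \<Longrightarrow> p \<in> S" "(p, q) \<in> M \<Longrightarrow> q \<in> S" "(p, q) \<in> M \<Longrightarrow> R p q"
    "(p, q) \<in> M \<Longrightarrow> (p', q') \<in> M \<Longrightarrow> (p, q) \<noteq> (p', q') \<Longrightarrow> {p, q} \<inter> {p', q'} = {}"
  using assms unfolding matching_def by force+

lemma matching_subset: "matching R S M \<Longrightarrow> M' \<subseteq> M \<Longrightarrow> matching R S M'"
  unfolding matching_def using finite_subset[of M' M] by blast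

lemma matching_insert:
  assumes "matching R (S - {a, b}) M" "a \<in> S" "b \<in> S" "R a b"
  shows "matching R S (insert (a, b) M)"
  using assms unfolding matching_def by auto

lemma matching_three:
  assumes M: "matching R S M" and "card M \<ge> 3" and irr: "irreflp R"
  obtains p1 q1 p2 q2 p3 q3 where "distinct [p1, q1, p2, q2, p3, q3]"
    "{p1, q1, p2, q2, p3, q3} \<subseteq> S" "R p1 q1" "R p2 q2" "R p3 q3" "{(p1, q1), (p2, q2), (p3, q3)} \<subseteq> M"
proof -
  obtain e1 e2 e3 where e: "e1 \<in> M" "e2 \<in> M" "e3 \<in> M" "e1 \<noteq> e2" "e1 \<noteq> e3" "e2 \<noteq> e3"
    using obtain_distinct3[OF assms(2)] .
  obtain p1 q1 p2 q2 p3 q3 where pq: "e1 = (p1, q1)" "e2 = (p2, q2)" "e3 = (p3, q3)"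
    by (cases e1, cases e2, cases e3)
  have R: "R p1 q1" "R p2 q2" "R p3 q3" using matchingD(4)[OF M] e pq by auto
  have "p1 \<noteq> q1" "p2 \<noteq> q2" "p3 \<noteq> q3" using R irr by (auto simp: irreflp_def)
  moreover have "{p1, q1} \<inter> {p2, q2} = {}" "{p1, q1} \<inter> {p3, q3} = {}" "{p2, q2} \<inter> {p3, q3} = {}"
    using matchingD(5)[OF M] e unfolding pq by blast+
  ultimately have "distinct [p1, q1, p2, q2, p3, q3]" by auto
  then show thesis
    using R that matchingD(2,3)[OF M] e pq by simp
qed

text \<open>Each discarded edge is charged to an end in \<open>Z\<close>; disjoint edges are charged
  to different vertices.\<close>

lemma matching_avoiding:
  assumes M: "matching R S M" and Z: "finite Z"
  obtains M' where "M' \<subseteq> M" "matching R (S - Z) M'" "card M \<le> card M' + card Z"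
proof -
  define M' where "M' = {e \<in> M. fst e \<notin> Z \<and> snd e \<notin> Z}"
  define z where "z e = (if fst e \<in> Z then fst e else snd e)" for e :: "'a \<times> 'a"
  have "inj_on z (M - M')"
  proof (rule inj_onI, rule ccontr)
    fix e e' assume e: "e \<in> M - M'" "e' \<in> M - M'" "z e = z e'" "e \<noteq> e'"
    have "z e \<in> {fst e, snd e} \<inter> {fst e', snd e'}"
      using e(3) by (auto simp: z_def split: if_splits)
    moreover have "{fst e, snd e} \<inter> {fst e', snd e'} = {}"
      using matchingD(5)[OF M, of "fst e" "snd e" "fst e'" "snd e'"] e by simp
    ultimately show False by blast
  qed
  moreover have "z ` (M - M') \<subseteq> Z" by (auto simp: z_def M'_def)
  ultimately have "card (M - M') \<le> card Z" using Z by (metis card_inj_on_le)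
  moreover have "card M = card M' + card (M - M')"
  proof -
    have "M' \<subseteq> M" by (auto simp: M'_def)
    then show ?thesis using matchingD(1)[OF M] by (metis card_Diff_subset card_mono finite_subset le_add_diff_inverse)
  qed
  moreover have "matching R (S - Z) M'"
    using M unfolding matching_def M'_def by auto
  ultimately show thesis by (intro that[of M']) (auto simp: M'_def)
qed

lemma deg_sum_remove_edge:
  assumes "symp R" "irreflp R" "finite S" "a \<in> S" "b \<in> S" "a \<noteq> b"
  shows "deg_sum R S \<le> deg_sum R (S - {a, b}) + 2 * (deg_in R S a + deg_in R S b)"
proof -
  have 1: "deg_sum R S = deg_sum R (S - {a}) + 2 * deg_in R (S - {a}) a"
    using deg_sum_insert[of R "S - {a}" a] assms by (simp add: insert_absorb)
  have "S - {a} = insert b (S - {a, b})" using assms by auto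
  then have 2: "deg_sum R (S - {a}) = deg_sum R (S - {a, b}) + 2 * deg_in R (S - {a, b}) b"
    using deg_sum_insert[of R "S - {a, b}" b] assms by simp
  have "deg_in R (S - {a}) a \<le> deg_in R S a" "deg_in R (S - {a, b}) b \<le> deg_in R S b"
    using assms by (auto intro: deg_in_mono)
  then show ?thesis using 1 2 by simp
qed

text \<open>Greedy choice: deleting both ends of an edge lowers the degree sum by at most
  \<open>4 * D\<close>, so after \<open>k - 1\<close> choices an edge is still left.\<close>

lemma matching_exists:
  fixes D :: real
  assumes R: "symp R" "irreflp R" and "finite S" "\<And>v. v \<in> S \<Longrightarrow> deg_in R S v \<le> D"
    and "deg_sum R S > 4 * (real k - 1) * D" "D \<ge> 0"
  shows "\<exists>M. matching R S M \<and> card M = k"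
  using assms(3-5)
proof (induction k arbitrary: S)
  case 0
  show ?case by (rule exI[of _ "{}"]) (simp add: matching_def)
next
  case (Suc k)
  have "4 * (real (Suc k) - 1) * D \<ge> 0" using \<open>D \<ge> 0\<close> by simp
  with Suc.prems(3) have "deg_sum R S > 0" by linarith
  then obtain a where a: "a \<in> S" "deg_in R S a \<noteq> 0"
    unfolding deg_sum_def by (metis sum.neutral less_numeral_extra(3))
  then have "{u \<in> S. R a u} \<noteq> {}" unfolding deg_in_def by (metis card.empty)
  then obtain b where b: "b \<in> S" "R a b" by blast
  have ab: "a \<noteq> b" using b(2) R(2) by (auto simp: irreflp_def)
  have "real (deg_sum R S) \<le> deg_sum R (S - {a, b}) + 2 * (real (deg_in R S a) + deg_in R S b)"
    using of_nat_mono[OF deg_sum_remove_edge[OF R Suc.prems(1) a(1) b(1) ab], where 'a = real] by simp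
  also have "\<dots> \<le> deg_sum R (S - {a, b}) + 4 * D"
    using Suc.prems(2)[OF a(1)] Suc.prems(2)[OF b(1)] by simp
  finally have "deg_sum R (S - {a, b}) > 4 * (real k - 1) * D"
    using Suc.prems(3) by (simp add: algebra_simps)
  moreover have "deg_in R (S - {a, b}) v \<le> D" if "v \<in> S - {a, b}" for v
    using deg_in_mono[of "S - {a, b}" S R v] Suc.prems(1) Suc.prems(2)[of v] that by force
  ultimately obtain M where M: "matching R (S - {a, b}) M" "card M = k"
    using Suc.IH[of "S - {a, b}"] Suc.prems(1) by auto
  have "(a, b) \<notin> M" using matchingD(2)[OF M(1)] by blast
  then show ?case
    using matching_insert[OF M(1) a(1) b] M(2) matchingD(1)[OF M(1)]
    by (intro exI[of _ "insert (a, b) M"]) simp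
qed

text \<open>An edge avoiding all matched vertices could be added. The point is the dichotomy: either
  there is a large matching, or all edges are covered by few vertices.\<close>

lemma maximal_matching:
  assumes "finite S" "symp R"
  obtains M where "matching R S M" "\<And>x y. x \<in> S \<Longrightarrow> y \<in> S \<Longrightarrow> R x y \<Longrightarrow> x \<in> matched M \<or> y \<in> matched M"
proof -
  have "finite {M. matching R S M}"
    by (rule finite_subset[of _ "Pow (S \<times> S)"]) (use assms(1) in \<open>auto simp: matching_def\<close>)
  moreover have "{} \<in> {M. matching R S M}" by (simp add: matching_def)
  ultimately obtain M where M: "M \<in> {M. matching R S M}" "\<And>M'. M' \<in> {M. matching R S M} \<Longrightarrow> M \<subseteq> M' \<Longrightarrow> M = M'"
    using finite_has_maximal[of "{M. matching R S M}"] by blast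
  have "x \<in> matched M \<or> y \<in> matched M" if "x \<in> S" "y \<in> S" "R x y" for x y
  proof (rule ccontr)
    assume "\<not> ?thesis"
    then have n: "x \<notin> matched M" "y \<notin> matched M" by auto
    have d: "{fst e, snd e} \<inter> {x, y} = {}" if "e \<in> M" for e
      using n imageI[OF that, of fst] imageI[OF that, of snd] unfolding matched_def by auto
    have "matching R S (insert (x, y) M)"
      using M(1) that d by (simp add: matching_def Int_commute) metis
    then have "M = insert (x, y) M" using M(2) by blast
    then show False using n(1) unfolding matched_def by force
  qed
  then show thesis using that M(1) by blast
qed

lemma card_matched_le: "finite M \<Longrightarrow> card (matched M) \<le> 2 * card M"
  unfolding matched_def
  by (rule order_trans[OF card_Un_le]) (use card_image_le[of M fst] card_image_le[of M snd] in linarith)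

lemma matched_subset: "matching R S M \<Longrightarrow> matched M \<subseteq> S"
  unfolding matched_def matching_def by auto

lemma deg_sum_cover:
  assumes "symp R" "finite S" "U \<subseteq> S" and cover: "\<And>x y. x \<in> S \<Longrightarrow> y \<in> S \<Longrightarrow> R x y \<Longrightarrow> x \<in> U \<or> y \<in> U"
  shows "deg_sum R S = deg_sum R U + 2 * (\<Sum>u\<in>U. deg_in R (S - U) u)"
proof -
  have "deg_in R (S - U) x = 0" if "x \<in> S - U" for x
  proof -
    have "{u \<in> S - U. R x u} = {}" using cover[of x] that by auto
    then show ?thesis unfolding deg_in_def by (metis card.empty)
  qed
  then have 1: "deg_sum R (S - U) = 0" unfolding deg_sum_def by simp
  have fin: "finite U" "finite (S - U)" using assms finite_subset by auto
  have "deg_sum R S = deg_sum R (U \<union> (S - U))"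
    using assms(3) by (intro arg_cong[where f = "deg_sum R"]) auto
  also have "\<dots> = deg_sum R U + 2 * (\<Sum>u\<in>U. deg_in R (S - U) u)"
    using deg_sum_Un[OF assms(1) fin] 1 by simp
  finally show ?thesis .
qed

lemma deg_sum_cover_le:
  assumes "symp R" "finite S" "U \<subseteq> S" and cover: "\<And>x y. x \<in> S \<Longrightarrow> y \<in> S \<Longrightarrow> R x y \<Longrightarrow> x \<in> U \<or> y \<in> U"
  shows "deg_sum R S \<le> 2 * (\<Sum>u\<in>U. deg_in R S u)"
proof -
  have fin: "finite U" "finite (S - U)" using assms finite_subset by auto
  have "deg_in R U u + 2 * deg_in R (S - U) u \<le> 2 * deg_in R S u" for u
  proof -
    have "deg_in R (U \<union> (S - U)) u = deg_in R U u + deg_in R (S - U) u"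
      by (rule deg_in_Un[OF fin]) auto
    moreover have "U \<union> (S - U) = S" using assms(3) by auto
    ultimately show ?thesis by simp
  qed
  then have "(\<Sum>u\<in>U. deg_in R U u + 2 * deg_in R (S - U) u) \<le> (\<Sum>u\<in>U. 2 * deg_in R S u)"
    by (intro sum_mono) simp
  then show ?thesis
    using deg_sum_cover[OF assms] by (simp add: deg_sum_def sum.distrib sum_distrib_left)
qed

subsection \<open>Building pyramids\<close>

lemma has_pyramid_mono: "has_pyramid R S \<Longrightarrow> S \<subseteq> T \<Longrightarrow> has_pyramid R T"
  unfolding has_pyramid_def by (meson order_trans)

lemma has_pyramidI:
  assumes "distinct [c, h1, h2, h3, h4, h5, h6, k1, k2, k3]"
    "{c, h1, h2, h3, h4, h5, h6, k1, k2, k3} \<subseteq> S"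
    "R c h1" "R c h2" "R c h3" "R c h4" "R c h5" "R c h6"
    "R h1 h2" "R h2 h3" "R h3 h4" "R h4 h5" "R h5 h6" "R h6 h1"
    "R k1 h1" "R k1 h2" "R k2 h3" "R k2 h4" "R k3 h5" "R k3 h6"
  shows "has_pyramid R S"
  unfolding has_pyramid_def
  by (rule exI[of _ c], rule exI[of _ h1], rule exI[of _ h2], rule exI[of _ h3], rule exI[of _ h4],
      rule exI[of _ h5], rule exI[of _ h6], rule exI[of _ k1], rule exI[of _ k2], rule exI[of _ k3])
    (use assms in simp)

lemma obtain_common_neighbours:
  fixes m :: real
  assumes "\<And>s. s \<in> set xs \<Longrightarrow> card {y \<in> Y. \<not> R s y} \<le> m" "finite Y"
    and "card Y \<ge> length xs * m + k" "distinct xs"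
  obtains Z where "Z \<subseteq> Y" "card Z = k" "\<And>s z. s \<in> set xs \<Longrightarrow> z \<in> Z \<Longrightarrow> R s z"
proof -
  have "k \<le> card {y \<in> Y. \<forall>s\<in>set xs. R s y}"
    using common_neighbours[of "set xs" Y R m k] assms by (simp add: distinct_card)
  then obtain Z where "Z \<subseteq> {y \<in> Y. \<forall>s\<in>set xs. R s y}" "card Z = k"
    by (rule obtain_subset_with_card_n)
  then show thesis using that by blast
qed

lemma obtain_common3:
  fixes m :: real
  assumes "\<And>s. s \<in> set xs \<Longrightarrow> card {y \<in> Y. \<not> R s y} \<le> m" "finite Y"
    and "card Y \<ge> length xs * m + 3" "distinct xs"
  obtains y1 y2 y3 where "{y1, y2, y3} \<subseteq> Y" "distinct [y1, y2, y3]"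
    "\<And>s z. s \<in> set xs \<Longrightarrow> z \<in> {y1, y2, y3} \<Longrightarrow> R s z"
proof -
  obtain Z where Z: "Z \<subseteq> Y" "card Z = 3" "\<And>s z. s \<in> set xs \<Longrightarrow> z \<in> Z \<Longrightarrow> R s z"
    by (rule obtain_common_neighbours[of xs Y R m 3]) (use assms in auto)
  obtain y1 y2 y3 where "y1 \<in> Z" "y2 \<in> Z" "y3 \<in> Z" "y1 \<noteq> y2" "y1 \<noteq> y3" "y2 \<noteq> y3"
    using obtain_distinct3[of Z] Z(2) by auto
  then show thesis using Z by (intro that[of y1 y2 y3]) auto
qed

text \<open>The spider is the pyramid without \<open>h1, h3, h5\<close>; common neighbours in
  \<open>B\<close> of its seven vertices restore these three.\<close>

lemma pyramid_of_spider:
  fixes m :: real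
  assumes R: "symp R" and "has_spider R A" "finite B" "A \<inter> B = {}"
    and m: "\<And>x. x \<in> A \<Longrightarrow> card {y \<in> B. \<not> R x y} \<le> m" and B: "card B \<ge> 7 * m + 3"
  shows "has_pyramid R (A \<union> B)"
proof -
  obtain v x1 y1 x2 y2 x3 y3 where s: "distinct [v, x1, y1, x2, y2, x3, y3]" "{v, x1, y1, x2, y2, x3, y3} \<subseteq> A"
     "R v x1" "R x1 y1" "R v x2" "R x2 y2" "R v x3" "R x3 y3"
    using assms(2) unfolding has_spider_def by (elim exE conjE) (rule that)
  let ?xs = "[v, x1, y1, x2, y2, x3, y3]"
  obtain z1 z2 z3 where z: "{z1, z2, z3} \<subseteq> B" "distinct [z1, z2, z3]"
    "\<And>s z. s \<in> set ?xs \<Longrightarrow> z \<in> {z1, z2, z3} \<Longrightarrow> R s z"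
    by (rule obtain_common3[of ?xs B R m]) (use m s assms(3) B in auto)
  have disj: "set ?xs \<inter> set [z1, z2, z3] = {}"
    using s(2) z(1) assms(4) by simp blast
  have D: "distinct (?xs @ [z1, z2, z3])"
    unfolding distinct_append using s(1) z(2) disj by blast
  \<comment> \<open>The reversed list provides every inequality in the opposite orientation.\<close>
  note D' = iffD2[OF distinct_rev D]
  show ?thesis
    by (rule has_pyramidI[of v z1 x1 z2 x2 z3 x3 y1 y2 y3])
      (use D D' s(2-) z(1,3) sympD[OF R] in simp_all)
qed

text \<open>The centre and the three corners form an independent set, so four common neighbours of
  the hexagon can play these parts.\<close>

lemma pyramid_of_hexagon:
  fixes m :: real
  assumes R: "symp R" and "has_hexagon R A" "finite B" "A \<inter> B = {}"
    and m: "\<And>x. x \<in> A \<Longrightarrow> card {y \<in> B. \<not> R x y} \<le> m" and B: "card B \<ge> 6 * m + 4"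
  shows "has_pyramid R (A \<union> B)"
proof -
  obtain h1 h2 h3 h4 h5 h6 where h: "distinct [h1, h2, h3, h4, h5, h6]" "{h1, h2, h3, h4, h5, h6} \<subseteq> A"
     "R h1 h2" "R h2 h3" "R h3 h4" "R h4 h5" "R h5 h6" "R h6 h1"
    using assms(2) unfolding has_hexagon_def by (elim exE conjE) (rule that)
  let ?xs = "[h1, h2, h3, h4, h5, h6]"
  obtain Z where Z: "Z \<subseteq> B" "card Z = 4" "\<And>s z. s \<in> set ?xs \<Longrightarrow> z \<in> Z \<Longrightarrow> R s z"
    by (rule obtain_common_neighbours[of ?xs B R m 4]) (use m h assms(3) B in auto)
  obtain c k1 k2 k3 where z: "c \<in> Z" "k1 \<in> Z" "k2 \<in> Z" "k3 \<in> Z" "distinct [c, k1, k2, k3]"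
    by (rule obtain_distinct4[of Z]) (use Z(2) in auto)
  have disj: "set ?xs \<inter> set [c, k1, k2, k3] = {}"
    using h(2) z Z(1) assms(4) by simp blast
  have D: "distinct (?xs @ [c, k1, k2, k3])"
    unfolding distinct_append using h(1) z(5) disj by blast
  have B: "{c, k1, k2, k3} \<subseteq> B" using z Z(1) by blast
  note D' = iffD2[OF distinct_rev D]
  show ?thesis
    by (rule has_pyramidI[of c h1 h2 h3 h4 h5 h6 k1 k2 k3])
      (use D D' h(2-) z(1-4) Z(3) B sympD[OF R] in simp_all)
qed

text \<open>Around the centre \<open>w\<close>, the hexagon is \<open>p1 z1 p2 z2 p3 z3\<close> with
  the \<open>z\<close>'s in \<open>Y\<close>, and the \<open>q\<close>'s are the corners. Only the
  \<open>p\<close> end of each edge has to be seen by \<open>w\<close>.\<close>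

lemma pyramid_of_centre:
  fixes m :: real
  assumes R: "symp R" and A: "distinct [p1, q1, p2, q2, p3, q3]" "{p1, q1, p2, q2, p3, q3} \<subseteq> A"
    and e: "R p1 q1" "R p2 q2" "R p3 q3" and w: "R w p1" "R w p2" "R w p3" "w \<notin> A" "w \<notin> Y"
    and Y: "finite Y" "A \<inter> Y = {}" "\<And>y. y \<in> Y \<Longrightarrow> R w y"
    and m: "\<And>x. x \<in> A \<Longrightarrow> card {y \<in> Y. \<not> R x y} \<le> m" "card Y \<ge> 6 * m + 3"
  shows "has_pyramid R (insert w (A \<union> Y))"
proof -
  let ?xs = "[p1, q1, p2, q2, p3, q3]"
  obtain z1 z2 z3 where z: "{z1, z2, z3} \<subseteq> Y" "distinct [z1, z2, z3]"
    "\<And>s z. s \<in> set ?xs \<Longrightarrow> z \<in> {z1, z2, z3} \<Longrightarrow> R s z"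
    by (rule obtain_common3[of ?xs Y R m]) (use m A Y in auto)
  have disj: "set ?xs \<inter> set [z1, z2, z3] = {}" "w \<notin> set (?xs @ [z1, z2, z3])"
    using A(2) z(1) Y(2) w(4,5) by (simp, blast) (use A(2) z(1) w(4,5) in \<open>simp, blast\<close>)
  have "distinct (?xs @ [z1, z2, z3])"
    unfolding distinct_append using A(1) z(2) disj(1) by blast
  with disj(2) have D: "distinct (w # ?xs @ [z1, z2, z3])"
    using distinct.simps(2)[of w] by blast
  have wz: "R w z1" "R w z2" "R w z3" using Y(3) z(1) by simp_all
  note D' = iffD2[OF distinct_rev D]
  show ?thesis
    by (rule has_pyramidI[of w p1 z1 p2 z2 p3 z3 q1 q2 q3])
      (use D D' A(2) e w z(1,3) wz sympD[OF R] in simp_all)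
qed

text \<open>The centre is \<open>b\<close>, the hexagon is \<open>b1 q1 b2 q2 b3 q3\<close>, and the
  corners are the \<open>p\<close>'s.\<close>

lemma pyramid_of_star:
  assumes R: "symp R" and A: "distinct [p1, q1, p2, q2, p3, q3]" "{p1, q1, p2, q2, p3, q3} \<subseteq> A"
    and e: "R p1 q1" "R p2 q2" "R p3 q3" "R b q1" "R b q2" "R b q3"
    and B: "distinct [b, b1, b2, b3]" "{b, b1, b2, b3} \<subseteq> B" "R b b1" "R b b2" "R b b3"
    and c: "\<And>y x. y \<in> {b1, b2, b3} \<Longrightarrow> x \<in> {p1, q1, p2, q2, p3, q3} \<Longrightarrow> R y x" and "A \<inter> B = {}"
  shows "has_pyramid R (A \<union> B)"
proof -
  let ?xs = "[p1, q1, p2, q2, p3, q3]"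
  have disj: "set ?xs \<inter> set [b, b1, b2, b3] = {}"
    using A(2) B(2) assms(16) by simp blast
  have D: "distinct (?xs @ [b, b1, b2, b3])"
    unfolding distinct_append using A(1) B(1) disj by blast
  note D' = iffD2[OF distinct_rev D]
  show ?thesis
    by (rule has_pyramidI[of b b1 q1 b2 q2 b3 q3 p1 p2 p3])
      (use D D' A(2) e B(2-) c sympD[OF R] in simp_all)
qed

text \<open>The hexagon is \<open>w1 z1 w2 z2 w3 z3\<close> with the \<open>z\<close>'s in
  \<open>Y\<close>; the centre and all corners come from \<open>X\<close>.\<close>

lemma pyramid_of_three:
  fixes m :: real
  assumes R: "symp R" "irreflp R"
    and w: "distinct [w1, w2, w3]" "\<And>w z. w \<in> {w1, w2, w3} \<Longrightarrow> z \<in> X \<union> Y \<Longrightarrow> R w z"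
    and XY: "finite Y" "X \<inter> Y = {}" "card X \<ge> 4" "card Y \<ge> 4 * m + 3"
    and m: "\<And>x. x \<in> X \<Longrightarrow> card {y \<in> Y. \<not> R x y} \<le> m"
  shows "has_pyramid R ({w1, w2, w3} \<union> X \<union> Y)"
proof -
  obtain c k1 k2 k3 where x: "c \<in> X" "k1 \<in> X" "k2 \<in> X" "k3 \<in> X" "distinct [c, k1, k2, k3]"
    by (rule obtain_distinct4[OF XY(3)])
  let ?xs = "[c, k1, k2, k3]"
  obtain z1 z2 z3 where z: "{z1, z2, z3} \<subseteq> Y" "distinct [z1, z2, z3]"
    "\<And>s z. s \<in> set ?xs \<Longrightarrow> z \<in> {z1, z2, z3} \<Longrightarrow> R s z"
    by (rule obtain_common3[of ?xs Y R m]) (use m x XY in auto)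
  have disj: "set ?xs \<inter> set [z1, z2, z3] = {}"
    using x z(1) XY(2) by simp blast
  have w': "w \<notin> X \<union> Y" if "w \<in> {w1, w2, w3}" for w
    using w(2)[OF that, of w] R(2) by (auto simp: irreflp_def)
  have "set [w1, w2, w3] \<inter> set (?xs @ [z1, z2, z3]) = {}"
    using w'[of w1] w'[of w2] w'[of w3] x z(1) by simp blast
  then have D: "distinct ([w1, w2, w3] @ ?xs @ [z1, z2, z3])"
    unfolding distinct_append using w(1) x(5) z(2) disj by simp
  have wx: "R w z" if "w \<in> {w1, w2, w3}" "z \<in> {c, k1, k2, k3, z1, z2, z3}" for w z
    using w(2)[OF that(1), of z] that(2) x z(1) by blast
  note D' = iffD2[OF distinct_rev D]
  show ?thesis
    by (rule has_pyramidI[of c w1 z1 w2 z2 w3 z3 k1 k2 k3])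
      (use D D' x(1-4) z(1,3) wx sympD[OF R(1)] in simp_all)
qed

subsection \<open>Vertices of small degree inside their class\<close>

lemma orient_edge:
  assumes "symp R" "R p q" "P p \<or> P q"
  obtains p' q' where "{p', q'} = {p, q}" "R p' q'" "P q'"
  using assms(2,3) sympD[OF assms(1,2)] by (metis insert_commute)

lemma pyramid_of_star_matching:
  assumes R: "symp R" "irreflp R" and M: "matching R A M" "card M \<ge> 3"
    and b: "\<And>p q. (p, q) \<in> M \<Longrightarrow> R b p \<or> R b q"
    and B: "distinct [b, b1, b2, b3]" "{b, b1, b2, b3} \<subseteq> B" "R b b1" "R b b2" "R b b3"
    and c: "\<And>y x. y \<in> {b1, b2, b3} \<Longrightarrow> x \<in> matched M \<Longrightarrow> R y x" and disj: "A \<inter> B = {}"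
  shows "has_pyramid R (A \<union> B)"
proof -
  obtain p1 q1 p2 q2 p3 q3 where pq: "distinct [p1, q1, p2, q2, p3, q3]"
    "{p1, q1, p2, q2, p3, q3} \<subseteq> A" "R p1 q1" "R p2 q2" "R p3 q3" "{(p1, q1), (p2, q2), (p3, q3)} \<subseteq> M"
    by (rule matching_three[OF M R(2)])
  have bpq: "R b p1 \<or> R b q1" "R b p2 \<or> R b q2" "R b p3 \<or> R b q3"
    using b pq(6) by simp_all
  obtain a1 c1 where 1: "{a1, c1} = {p1, q1}" "R a1 c1" "R b c1"
    using orient_edge[OF R(1) pq(3), of "R b"] bpq(1) by blast
  obtain a2 c2 where 2: "{a2, c2} = {p2, q2}" "R a2 c2" "R b c2"
    using orient_edge[OF R(1) pq(4), of "R b"] bpq(2) by blast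
  obtain a3 c3 where 3: "{a3, c3} = {p3, q3}" "R a3 c3" "R b c3"
    using orient_edge[OF R(1) pq(5), of "R b"] bpq(3) by blast
  have s: "{a1, c1, a2, c2, a3, c3} = {p1, q1, p2, q2, p3, q3}"
    using 1(1) 2(1) 3(1) by blast
  \<comment> \<open>Reorienting the edges permutes the six vertices, so counting them shows that
    they are still distinct.\<close>
  have "card (set [a1, c1, a2, c2, a3, c3]) = length [a1, c1, a2, c2, a3, c3]"
    using s distinct_card[OF pq(1)] by simp
  then have d: "distinct [a1, c1, a2, c2, a3, c3]" by (rule card_distinct)
  have sub: "{a1, c1, a2, c2, a3, c3} \<subseteq> A" using s pq(2) by simp
  have "{p1, q1, p2, q2, p3, q3} \<subseteq> matched M"
    using pq(6) unfolding matched_def by force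
  then have adj: "R y x" if "y \<in> {b1, b2, b3}" "x \<in> {a1, c1, a2, c2, a3, c3}" for x y
    using c[OF that(1), of x] that(2) unfolding s by blast
  show ?thesis
    using R(1) d sub 1(2) 2(2) 3(2) 1(3) 2(3) 3(3) B adj disj by (rule pyramid_of_star)
qed

lemma pyramid_of_centre_matching:
  fixes m :: real
  assumes R: "symp R" "irreflp R" and M: "matching R A M" "card M \<ge> 3"
    and b: "\<And>p q. (p, q) \<in> M \<Longrightarrow> R w p \<or> R w q" and w: "w \<notin> A"
    and Y: "finite Y" "A \<inter> Y = {}" "\<And>y. y \<in> Y \<Longrightarrow> R w y"
    and m: "\<And>x. x \<in> A \<Longrightarrow> card {y \<in> Y. \<not> R x y} \<le> m" "card Y \<ge> 6 * m + 3"
  shows "has_pyramid R (insert w (A \<union> Y))"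
proof -
  obtain p1 q1 p2 q2 p3 q3 where pq: "distinct [p1, q1, p2, q2, p3, q3]"
    "{p1, q1, p2, q2, p3, q3} \<subseteq> A" "R p1 q1" "R p2 q2" "R p3 q3" "{(p1, q1), (p2, q2), (p3, q3)} \<subseteq> M"
    by (rule matching_three[OF M R(2)])
  have bpq: "R w p1 \<or> R w q1" "R w p2 \<or> R w q2" "R w p3 \<or> R w q3"
    using b pq(6) by simp_all
  obtain a1 c1 where 1: "{a1, c1} = {p1, q1}" "R a1 c1" "R w c1"
    using orient_edge[OF R(1) pq(3), of "R w"] bpq(1) by blast
  obtain a2 c2 where 2: "{a2, c2} = {p2, q2}" "R a2 c2" "R w c2"
    using orient_edge[OF R(1) pq(4), of "R w"] bpq(2) by blast
  obtain a3 c3 where 3: "{a3, c3} = {p3, q3}" "R a3 c3" "R w c3"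
    using orient_edge[OF R(1) pq(5), of "R w"] bpq(3) by blast
  have s: "{c1, a1, c2, a2, c3, a3} = {p1, q1, p2, q2, p3, q3}"
    using 1(1) 2(1) 3(1) by blast
  have "card (set [c1, a1, c2, a2, c3, a3]) = length [c1, a1, c2, a2, c3, a3]"
    using s distinct_card[OF pq(1)] by simp
  then have d: "distinct [c1, a1, c2, a2, c3, a3]" by (rule card_distinct)
  have sub: "{c1, a1, c2, a2, c3, a3} \<subseteq> A" using s pq(2) by simp
  have e: "R c1 a1" "R c2 a2" "R c3 a3" using 1(2) 2(2) 3(2) sympD[OF R(1)] by blast+
  have wY: "w \<notin> Y" using Y(3) R(2) by (auto simp: irreflp_def)
  show ?thesis
    using R(1) d sub e 1(3) 2(3) 3(3) w wY Y m by (rule pyramid_of_centre)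
qed

text \<open>\<open>A\<close> and \<open>B\<close> stand for the vertices of small degree inside the two classes of a maximum cut.\<close>

locale almost_complete =
  fixes R :: "'a \<Rightarrow> 'a \<Rightarrow> bool" and A B :: "'a set" and m :: real
  assumes sym: "symp R" and irr: "irreflp R" and fin: "finite A" "finite B" and disj: "A \<inter> B = {}"
    and free: "\<not> has_pyramid R (A \<union> B)" and m1: "m \<ge> 1"
    and missA: "\<And>x. x \<in> A \<Longrightarrow> card {y \<in> B. \<not> R x y} \<le> m"
    and missB: "\<And>y. y \<in> B \<Longrightarrow> card {x \<in> A. \<not> R y x} \<le> m"
    and degA: "\<And>x. x \<in> A \<Longrightarrow> deg_in R A x \<le> m"
    and degB: "\<And>y. y \<in> B \<Longrightarrow> deg_in R B y \<le> m"
    and cardA: "card A \<ge> 11 * m" and cardB: "card B \<ge> 11 * m"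
begin

lemma swapped: "almost_complete R B A m"
  by unfold_locales (use sym irr fin disj free m1 missA missB degA degB cardA cardB in \<open>auto simp: Un_commute Int_commute\<close>)

text \<open>As \<open>m \<ge> 1\<close>, the class size \<open>11 * m\<close> exceeds the
  \<open>7 * m + 3\<close> needed here and the \<open>6 * m + 4\<close> needed for the
  hexagon.\<close>

lemma no_spider: "\<not> has_spider R A"
  using pyramid_of_spider[OF sym _ fin(2) disj missA] free cardB m1 by auto

lemma no_hexagon: "\<not> has_hexagon R A"
  using pyramid_of_hexagon[OF sym _ fin(2) disj missA] free cardB m1 by auto

lemma sparse: "S \<subseteq> A \<Longrightarrow> deg_sum R S \<le> 4 * card S"
  using deg_sum_le_of_no_spider_hexagon[OF sym irr, of S] no_spider no_hexagon
    has_spider_mono[of R S A] has_hexagon_mono[of R S A] fin finite_subset by blast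

definition missing :: nat where
  "missing = (\<Sum>x\<in>A. card {y \<in> B. \<not> R x y})"

lemma missing_swap: "missing = (\<Sum>y\<in>B. card {x \<in> A. \<not> R y x})"
proof -
  have "symp (\<lambda>x y. \<not> R x y)" using sym by (auto simp: symp_def)
  from deg_in_swap[OF this fin] show ?thesis
    unfolding missing_def deg_in_def by simp
qed

text \<open>A vertex \<open>b\<close> with three neighbours in \<open>B\<close> is the head of a
  star whose four vertices miss at most \<open>4 * m\<close> vertices of \<open>A\<close>. Three
  matching edges avoid all of these, and together with the star they form a pyramid.\<close>

lemma deg_le_2_of_large_matching:
  assumes M: "matching R A M" "card M \<ge> 4 * m + 3" and b: "b \<in> B"
  shows "deg_in R B b \<le> 2"
proof (rule ccontr)
  assume "\<not> ?thesis"
  then have "card {u \<in> B. R b u} \<ge> 3" unfolding deg_in_def by simp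
  then obtain b1 b2 b3 where b': "b1 \<in> {u \<in> B. R b u}" "b2 \<in> {u \<in> B. R b u}" "b3 \<in> {u \<in> B. R b u}"
    "b1 \<noteq> b2" "b1 \<noteq> b3" "b2 \<noteq> b3"
    by (rule obtain_distinct3)
  define Z where "Z = (\<Union>y\<in>{b, b1, b2, b3}. {x \<in> A. \<not> R y x})"
  have "card Z \<le> (\<Sum>y\<in>{b, b1, b2, b3}. card {x \<in> A. \<not> R y x})"
    unfolding Z_def by (rule card_UN_le) simp
  from of_nat_mono[OF this, where 'a = real]
  have "real (card Z) \<le> (\<Sum>y\<in>{b, b1, b2, b3}. real (card {x \<in> A. \<not> R y x}))" by simp
  also have "\<dots> \<le> card {b, b1, b2, b3} * m"
    using sum_bounded_above[of "{b, b1, b2, b3}" "\<lambda>y. real (card {x \<in> A. \<not> R y x})" m] missB b b' by auto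
  also have "\<dots> \<le> 4 * m"
    using m1 card_insert_le_m1[of 4 "{b1, b2, b3}" b] card_insert_le_m1[of 3 "{b2, b3}" b1]
      card_insert_le_m1[of 2 "{b3}" b2] by (intro mult_right_mono) auto
  finally have Z: "real (card Z) \<le> 4 * m" .
  have "finite Z" unfolding Z_def using fin by auto
  with M(1) obtain M' where M': "M' \<subseteq> M" "matching R (A - Z) M'" "card M \<le> card M' + card Z"
    by (rule matching_avoiding)
  have adj: "R y x" if "y \<in> {b, b1, b2, b3}" "x \<in> matched M'" for x y
    using matched_subset[OF M'(2)] that unfolding Z_def by blast
  have c3: "card M' \<ge> 3" using M'(3) M(2) Z by linarith
  have "has_pyramid R (A \<union> B)"
  proof (rule pyramid_of_star_matching[OF sym irr matching_subset[OF M(1) M'(1)] c3])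
    show "R b p \<or> R b q" if "(p, q) \<in> M'" for p q
      using adj[of b p] that unfolding matched_def by force
    show "distinct [b, b1, b2, b3]"
      using b' irr by (auto simp: irreflp_def)
  qed (use b b' adj disj in auto)
  then show False using free by simp
qed

text \<open>Three hubs next to \<open>x\<close> would start the legs of a spider at
  \<open>x\<close>. Their ends are chosen greedily outside \<open>U\<close>: of four neighbours, one
  remains after excluding \<open>x\<close> and the two earlier ends.\<close>

lemma hub_degree:
  assumes "U \<subseteq> A" "x \<in> A - U"
  shows "deg_in R {u \<in> U. deg_in R (A - U) u \<ge> 4} x \<le> 2"
proof (rule ccontr)
  let ?L = "A - U"
  assume "\<not> ?thesis"
  then have "card {u \<in> {u \<in> U. deg_in R ?L u \<ge> 4}. R x u} \<ge> 3" unfolding deg_in_def[of R "{u \<in> U. _ u}"] by simp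
  then obtain u1 u2 u3 where u: "u1 \<in> {u \<in> {u \<in> U. deg_in R ?L u \<ge> 4}. R x u}"
    "u2 \<in> {u \<in> {u \<in> U. deg_in R ?L u \<ge> 4}. R x u}" "u3 \<in> {u \<in> {u \<in> U. deg_in R ?L u \<ge> 4}. R x u}"
    "u1 \<noteq> u2" "u1 \<noteq> u3" "u2 \<noteq> u3"
    by (rule obtain_distinct3)
  have leaf: "\<exists>l\<in>?L - set X. R u l" if "u \<in> {u \<in> {u \<in> U. deg_in R ?L u \<ge> 4}. R x u}" "length X \<le> 3" for u X
  proof (rule ccontr)
    assume "\<not> ?thesis"
    then have "{l \<in> ?L. R u l} \<subseteq> set X" by blast
    then have "deg_in R ?L u \<le> card (set X)" unfolding deg_in_def by (intro card_mono) simp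
    then show False using that card_length[of X] by simp
  qed
  obtain l1 where l1: "l1 \<in> ?L - {x}" "R u1 l1" using leaf[OF u(1), of "[x]"] by auto
  obtain l2 where l2: "l2 \<in> ?L - {x, l1}" "R u2 l2"
    using leaf[OF u(2), of "[x, l1]"] by auto
  obtain l3 where l3: "l3 \<in> ?L - {x, l1, l2}" "R u3 l3"
    using leaf[OF u(3), of "[x, l1, l2]"] by auto
  have "has_spider R A"
    by (rule has_spiderI[OF sym, of x u1 l1 u2 l2 u3 l3]) (use u l1 l2 l3 assms in auto)
  then show False using no_spider by simp
qed

text \<open>The factor 12 is 4 for the edges inside \<open>U\<close>, by \<open>sparse\<close>, plus
  twice 4 for the edges that leave \<open>U\<close> from a non-hub.\<close>

lemma deg_sum_le_hubs:
  assumes U: "U \<subseteq> A" "\<And>x y. x \<in> A \<Longrightarrow> y \<in> A \<Longrightarrow> R x y \<Longrightarrow> x \<in> U \<or> y \<in> U"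
  shows "deg_sum R A \<le> 12 * card U + 2 * (\<Sum>u\<in>{u \<in> U. deg_in R (A - U) u \<ge> 4}. deg_in R (A - U) u)"
proof -
  let ?L = "A - U" and ?H = "{u \<in> U. deg_in R (A - U) u \<ge> 4}"
  have fU: "finite U" using U(1) fin(1) finite_subset by blast
  have "(\<Sum>u\<in>U. deg_in R ?L u) = (\<Sum>u\<in>?H. deg_in R ?L u) + (\<Sum>u\<in>U - ?H. deg_in R ?L u)"
    using fU by (subst sum.subset_diff[of ?H U]) auto
  also have "(\<Sum>u\<in>U - ?H. deg_in R ?L u) \<le> of_nat (card (U - ?H)) * 4"
    by (rule sum_bounded_above) auto
  also have "\<dots> \<le> card U * 4" using fU by (simp add: card_mono)
  finally have "(\<Sum>u\<in>U. deg_in R ?L u) \<le> (\<Sum>u\<in>?H. deg_in R ?L u) + 4 * card U" by simp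
  then show ?thesis
    using deg_sum_cover[OF sym fin(1) U] sparse[OF U(1)] by simp
qed

text \<open>By \<open>deg_sum_le_hubs\<close>, more than \<open>60 * m\<close> edges lead from hubs
  out of \<open>U\<close>, since 300 - 12 * 14 = 132. At most \<open>m\<close> vertices outside
  \<open>U\<close> are not seen by \<open>b\<close>, each next to at most two hubs, so
  \<open>b\<close> loses only \<open>2 * m\<close> of these edges. The others have maximum degree at
  most \<open>m\<close> and thus contain six disjoint ones.\<close>

lemma hub_matching:
  assumes U: "U \<subseteq> A" "\<And>x y. x \<in> A \<Longrightarrow> y \<in> A \<Longrightarrow> R x y \<Longrightarrow> x \<in> U \<or> y \<in> U" "card U \<le> 14 * m"
    and big: "deg_sum R A > 300 * m" and b: "b \<in> B"
  obtains M where "matching R A M" "card M = 6" "\<And>p q. (p, q) \<in> M \<Longrightarrow> R b p \<or> R b q"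
proof -
  let ?L = "A - U" and ?H = "{u \<in> U. deg_in R (A - U) u \<ge> 4}"
  define Q where "Q x y \<longleftrightarrow> R x y \<and> ((y \<in> ?L \<and> R b y) \<or> (x \<in> ?L \<and> R b x))" for x y
  have "finite U" using U(1) fin(1) finite_subset by blast
  then have fU: "finite U" "finite ?H" by simp_all
  have Q: "symp Q" "irreflp Q" using sym irr unfolding Q_def symp_def irreflp_def by blast+
  have "real (deg_sum R A) \<le> 12 * card U + 2 * (\<Sum>u\<in>?H. deg_in R ?L u)"
    using of_nat_mono[OF deg_sum_le_hubs[OF U(1,2)], where 'a = real] by simp
  then have 1: "real (\<Sum>u\<in>?H. deg_in R ?L u) > 60 * m" using big U(3) m1 by simp
  have "deg_in R ?L u \<le> deg_in Q A u + deg_in R {y \<in> ?L. \<not> R b y} u" for u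
  proof -
    have "{y \<in> ?L. R u y} \<subseteq> {y \<in> A. Q u y} \<union> {y \<in> {y \<in> ?L. \<not> R b y}. R u y}"
      by (auto simp: Q_def)
    then have "card {y \<in> ?L. R u y} \<le> card ({y \<in> A. Q u y} \<union> {y \<in> {y \<in> ?L. \<not> R b y}. R u y})"
      using fin by (intro card_mono) auto
    also have "\<dots> \<le> card {y \<in> A. Q u y} + card {y \<in> {y \<in> ?L. \<not> R b y}. R u y}"
      by (rule card_Un_le)
    finally show ?thesis unfolding deg_in_def .
  qed
  then have "(\<Sum>u\<in>?H. deg_in R ?L u) \<le> (\<Sum>u\<in>?H. deg_in Q A u) + (\<Sum>u\<in>?H. deg_in R {y \<in> ?L. \<not> R b y} u)"
    by (simp add: sum.distrib[symmetric] sum_mono)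
  also have "(\<Sum>u\<in>?H. deg_in R {y \<in> ?L. \<not> R b y} u) = (\<Sum>y\<in>{y \<in> ?L. \<not> R b y}. deg_in R ?H y)"
    using fU fin by (intro deg_in_swap[OF sym]) auto
  also have "\<dots> \<le> of_nat (card {y \<in> ?L. \<not> R b y}) * 2"
    using hub_degree[OF U(1)] by (intro sum_bounded_above) simp
  also have "card {y \<in> ?L. \<not> R b y} \<le> card {y \<in> A. \<not> R b y}"
    using fin by (intro card_mono) auto
  also have "(\<Sum>u\<in>?H. deg_in Q A u) \<le> deg_sum Q A"
    unfolding deg_sum_def using fin U(1) by (intro sum_mono2) auto
  finally have "(\<Sum>u\<in>?H. deg_in R ?L u) \<le> deg_sum Q A + card {y \<in> A. \<not> R b y} * 2" by simp
  from of_nat_mono[OF this, where 'a = real]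
  have "real (\<Sum>u\<in>?H. deg_in R ?L u) \<le> deg_sum Q A + 2 * real (card {y \<in> A. \<not> R b y})" by simp
  also have "\<dots> \<le> deg_sum Q A + 2 * m" using missB[OF b] by simp
  finally have 2: "deg_sum Q A > 4 * (real 6 - 1) * m" using 1 m1 by simp
  have "deg_in Q A v \<le> m" if "v \<in> A" for v
    using deg_in_le_deg_in[of A Q v R] fin degA[OF that] unfolding Q_def by fastforce
  from matching_exists[OF Q fin(1) this 2] obtain M where M: "matching Q A M" "card M = 6"
    using m1 by auto
  show thesis
  proof (rule that[of M])
    show "matching R A M" using M(1) unfolding matching_def Q_def by blast
    show "R b p \<or> R b q" if "(p, q) \<in> M" for p q
      using matchingD(4)[OF M(1) that] unfolding Q_def by blast
  qed (rule M(2))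
qed

text \<open>
  For a hub \<open>b\<close> (a vertex of \<open>V\<close> with four neighbours, its leaves, outside \<open>V\<close>), two triples of
  disjoint edges in \<open>A\<close>, all seen by \<open>b\<close>, are available.  No three leaves of \<open>b\<close> are joined to all
  ends of one triple, so all but four leaves of \<open>b\<close> miss two vertices of \<open>A\<close>; as a leaf sees at most
  two hubs, the missing pairs pay for the edges in \<open>B\<close>.
\<close>
lemma deg_sum_le_missing:
  assumes U: "U \<subseteq> A" "\<And>x y. x \<in> A \<Longrightarrow> y \<in> A \<Longrightarrow> R x y \<Longrightarrow> x \<in> U \<or> y \<in> U" "card U \<le> 14 * m"
    and V: "V \<subseteq> B" "\<And>x y. x \<in> B \<Longrightarrow> y \<in> B \<Longrightarrow> R x y \<Longrightarrow> x \<in> V \<or> y \<in> V"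
    and big: "deg_sum R A > 300 * m"
  shows "deg_sum R B \<le> 2 * missing + 20 * card V"
proof -
  interpret swp: almost_complete R B A m by (rule swapped)
  let ?L = "B - V" and ?H = "{u \<in> V. deg_in R (B - V) u \<ge> 4}"
  define L' where "L' = {y \<in> ?L. card {x \<in> A. \<not> R y x} \<ge> 2}"
  have "finite V" using V(1) fin(2) finite_subset by blast
  then have fV: "finite V" "finite ?H" by simp_all
  have fL: "finite L'" using fin(2) by (simp add: L'_def)
  have leaf: "deg_in R ?L b \<le> 4 + deg_in R L' b" if b: "b \<in> ?H" for b
  proof -
    have bB: "b \<in> B" using b V(1) by auto
    obtain M where M: "matching R A M" "card M = 6" "\<And>p q. (p, q) \<in> M \<Longrightarrow> R b p \<or> R b q"
      using hub_matching[OF U big bB] by blast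
    have "3 \<le> card M" using M(2) by simp
    then obtain M1 where M1: "M1 \<subseteq> M" "card M1 = 3" by (rule obtain_subset_with_card_n)
    define M2 where "M2 = M - M1"
    have M2: "M2 \<subseteq> M" "card M2 = 3"
      using M1 M(2) card_Diff_subset[of M1 M] matchingD(1)[OF M(1)] finite_subset by (auto simp: M2_def)
    have few: "card {y \<in> ?L. R b y \<and> (\<forall>x\<in>matched N. R y x)} \<le> 2" if N: "N \<subseteq> M" "card N = 3" for N
    proof (rule ccontr)
      assume "\<not> ?thesis"
      then have "card {y \<in> ?L. R b y \<and> (\<forall>x\<in>matched N. R y x)} \<ge> 3" by simp
      then obtain b1 b2 b3 where y: "b1 \<in> {y \<in> ?L. R b y \<and> (\<forall>x\<in>matched N. R y x)}"
        "b2 \<in> {y \<in> ?L. R b y \<and> (\<forall>x\<in>matched N. R y x)}" "b3 \<in> {y \<in> ?L. R b y \<and> (\<forall>x\<in>matched N. R y x)}"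
        "b1 \<noteq> b2" "b1 \<noteq> b3" "b2 \<noteq> b3"
        by (rule obtain_distinct3)
      have N3: "3 \<le> card N" using N(2) by simp
      have "has_pyramid R (A \<union> B)"
      proof (rule pyramid_of_star_matching[OF sym irr matching_subset[OF M(1) N(1)] N3])
        show "R b p \<or> R b q" if "(p, q) \<in> N" for p q
          using M(3) N(1) that by blast
        show "distinct [b, b1, b2, b3]"
          using y irr by (auto simp: irreflp_def)
      qed (use y bB disj in auto)
      then show False using free by simp
    qed
    have disjM: "matched M1 \<inter> matched M2 = {}"
    proof -
      have "{fst e, snd e} \<inter> {fst e', snd e'} = {}" if "e \<in> M1" "e' \<in> M2" for e e'
      proof -
        have "e \<in> M" "e' \<in> M" "e \<noteq> e'" using that M1(1) by (auto simp: M2_def)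
        then show ?thesis using M(1) unfolding matching_def by metis
      qed
      then show ?thesis unfolding matched_def by blast
    qed
    have "{y \<in> ?L. R b y} \<subseteq> {y \<in> ?L. R b y \<and> (\<forall>x\<in>matched M1. R y x)} \<union>
      {y \<in> ?L. R b y \<and> (\<forall>x\<in>matched M2. R y x)} \<union> {y \<in> L'. R b y}"
    proof
      fix y assume y: "y \<in> {y \<in> ?L. R b y}"
      show "y \<in> {y \<in> ?L. R b y \<and> (\<forall>x\<in>matched M1. R y x)} \<union>
        {y \<in> ?L. R b y \<and> (\<forall>x\<in>matched M2. R y x)} \<union> {y \<in> L'. R b y}"
      proof (rule ccontr)
        assume n: "\<not> ?thesis"
        then obtain x1 where x1: "x1 \<in> matched M1" "\<not> R y x1" using y by blast
        obtain x2 where x2: "x2 \<in> matched M2" "\<not> R y x2" using n y by blast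
        have "x1 \<noteq> x2" using x1 x2 disjM by blast
        moreover have "{x1, x2} \<subseteq> {x \<in> A. \<not> R y x}"
          using x1 x2 matched_subset[OF matching_subset[OF M(1) M1(1)]]
            matched_subset[OF matching_subset[OF M(1) M2(1)]] by blast
        then have "card {x1, x2} \<le> card {x \<in> A. \<not> R y x}" using fin(1) by (intro card_mono) auto
        ultimately have "y \<in> L'" using y unfolding L'_def by simp
        then show False using n y by blast
      qed
    qed
    then have "card {y \<in> ?L. R b y} \<le> card ({y \<in> ?L. R b y \<and> (\<forall>x\<in>matched M1. R y x)} \<union>
      {y \<in> ?L. R b y \<and> (\<forall>x\<in>matched M2. R y x)} \<union> {y \<in> L'. R b y})"
      using fin(2) fL by (intro card_mono) auto
    also have "\<dots> \<le> card {y \<in> ?L. R b y \<and> (\<forall>x\<in>matched M1. R y x)} +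
      card {y \<in> ?L. R b y \<and> (\<forall>x\<in>matched M2. R y x)} + card {y \<in> L'. R b y}"
      by (meson add_le_mono1 card_Un_le order_trans)
    also have "\<dots> \<le> 2 + 2 + card {y \<in> L'. R b y}"
      using few[OF M1] few[OF M2] by (intro add_mono) simp_all
    finally show ?thesis unfolding deg_in_def by simp
  qed
  have "(\<Sum>b\<in>?H. deg_in R ?L b) \<le> (\<Sum>b\<in>?H. 4 + deg_in R L' b)"
    using leaf by (rule sum_mono)
  also have "\<dots> = 4 * card ?H + (\<Sum>b\<in>?H. deg_in R L' b)"
    by (simp only: sum.distrib sum_constant mult.commute)  simp
  also have "(\<Sum>b\<in>?H. deg_in R L' b) = (\<Sum>y\<in>L'. deg_in R ?H y)"
    by (rule deg_in_swap[OF sym fV(2) fL])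
  also have "\<dots> \<le> (\<Sum>y\<in>L'. card {x \<in> A. \<not> R y x})"
  proof (rule sum_mono)
    fix y assume y: "y \<in> L'"
    have "deg_in R ?H y \<le> 2" using swp.hub_degree[OF V(1), of y] y by (simp add: L'_def)
    also have "\<dots> \<le> card {x \<in> A. \<not> R y x}" using y by (simp add: L'_def)
    finally show "deg_in R ?H y \<le> card {x \<in> A. \<not> R y x}" .
  qed
  also have "\<dots> \<le> missing"
    unfolding missing_swap using fin(2) by (intro sum_mono2) (auto simp: L'_def)
  also have "card ?H \<le> card V" using fV by (intro card_mono) auto
  finally have "(\<Sum>b\<in>?H. deg_in R ?L b) \<le> 4 * card V + missing" by simp
  \<comment> \<open>The 20 is the 12 of \<open>deg_sum_le_hubs\<close> plus twice the four
    exceptional leaves of each hub.\<close>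
  then show ?thesis using swp.deg_sum_le_hubs[OF V] by simp
qed

text \<open>The matching bounds all degrees in \<open>B\<close> by two. If \<open>B\<close> also has
  a large matching, the same holds in \<open>A\<close>, and the total is at most twice the number of
  vertices. Otherwise O(m) vertices cover the inner edges of \<open>B\<close>, which then cost only
  O(m), and \<open>sparse\<close> bounds \<open>A\<close>.\<close>

lemma deg_sum_le_of_two_matchings:
  fixes h :: real
  assumes M: "matching R A M" "card M \<ge> 4 * m + 3"
    and h: "card A \<le> h" "card B \<le> h"
  shows "deg_sum R A + deg_sum R B \<le> 4 * h + 300 * m"
proof -
  interpret swp: almost_complete R B A m by (rule swapped)
  have B2: "deg_in R B b \<le> 2" if "b \<in> B" for b
    by (rule deg_le_2_of_large_matching[OF M that])
  obtain N where N: "matching R B N" "\<And>x y. x \<in> B \<Longrightarrow> y \<in> B \<Longrightarrow> R x y \<Longrightarrow> x \<in> matched N \<or> y \<in> matched N"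
    using maximal_matching[OF fin(2) sym] by blast
  show ?thesis
  proof (cases "card N \<ge> 4 * m + 3")
    case True
    have A2: "deg_in R A a \<le> 2" if "a \<in> A" for a
      by (rule swp.deg_le_2_of_large_matching[OF N(1) True that])
    have "deg_sum R A \<le> of_nat (card A) * 2" "deg_sum R B \<le> of_nat (card B) * 2"
      unfolding deg_sum_def by (rule sum_bounded_above[OF A2] sum_bounded_above[OF B2]; assumption)+
    then have "real (deg_sum R A) \<le> 2 * real (card A)" "real (deg_sum R B) \<le> 2 * real (card B)"
      by simp_all
    then show ?thesis using h m1 by linarith
  next
    case False
    have sub: "matched N \<subseteq> B" by (rule matched_subset[OF N(1)])
    have "deg_sum R B \<le> 2 * (\<Sum>u\<in>matched N. deg_in R B u)"
      by (rule deg_sum_cover_le[OF sym fin(2) sub N(2)])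
    also have "(\<Sum>u\<in>matched N. deg_in R B u) \<le> of_nat (card (matched N)) * 2"
      by (rule sum_bounded_above) (use B2 sub in blast)
    also have "card (matched N) \<le> 2 * card N" by (rule card_matched_le[OF matchingD(1)[OF N(1)]])
    finally have "deg_sum R B \<le> 8 * card N" by simp
    then have "real (deg_sum R B) \<le> 8 * real (card N)" by linarith
    moreover have "real (deg_sum R A) \<le> 4 * real (card A)" using sparse[OF order.refl] by linarith
    ultimately show ?thesis using False h m1 by linarith
  qed
qed

text \<open>If both classes have small maximal matchings, either \<open>A\<close> contributes only
  O(m) and \<open>sparse\<close> bounds \<open>B\<close>, or \<open>A\<close> has enough edges to
  supply a matching to every hub of \<open>B\<close>, and then missing pairs pay for
  \<open>B\<close>. In each case only one bound of the form \<open>4 * h\<close> is spent.\<close>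

lemma deg_sum_inner_le:
  fixes h :: real
  assumes h: "card A \<le> h" "card B \<le> h"
  shows "deg_sum R A + deg_sum R B \<le> 2 * missing + 4 * h + 300 * m"
proof -
  interpret swp: almost_complete R B A m by (rule swapped)
  obtain M where M: "matching R A M" "\<And>x y. x \<in> A \<Longrightarrow> y \<in> A \<Longrightarrow> R x y \<Longrightarrow> x \<in> matched M \<or> y \<in> matched M"
    using maximal_matching[OF fin(1) sym] by blast
  obtain N where N: "matching R B N" "\<And>x y. x \<in> B \<Longrightarrow> y \<in> B \<Longrightarrow> R x y \<Longrightarrow> x \<in> matched N \<or> y \<in> matched N"
    using maximal_matching[OF fin(2) sym] by blast
  consider (1) "card M \<ge> 4 * m + 3" | (2) "card N \<ge> 4 * m + 3"
    | (3) "card M \<le> 7 * m" "card N \<le> 7 * m" using m1 by linarith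
  then show ?thesis
  proof cases
    case 1
    then show ?thesis using deg_sum_le_of_two_matchings[OF M(1) _ h] by simp
  next
    case 2
    then show ?thesis using swp.deg_sum_le_of_two_matchings[OF N(1) _ h(2,1)] by simp
  next
    case 3
    have cM: "real (card (matched M)) \<le> 14 * m" "real (card (matched N)) \<le> 14 * m"
      using 3 card_matched_le[OF matchingD(1)[OF M(1)]] card_matched_le[OF matchingD(1)[OF N(1)]] by linarith+
    have s: "real (deg_sum R A) \<le> 4 * real (card A)" "real (deg_sum R B) \<le> 4 * real (card B)"
      using sparse[OF order.refl] swp.sparse[OF order.refl] by linarith+
    show ?thesis
    proof (cases "deg_sum R A > 300 * m")
      case True
      have "deg_sum R B \<le> 2 * missing + 20 * card (matched N)"
        by (rule deg_sum_le_missing[OF matched_subset[OF M(1)] M(2) cM(1) matched_subset[OF N(1)] N(2) True])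
      then have "real (deg_sum R B) \<le> 2 * real missing + 20 * real (card (matched N))" by linarith
      then show ?thesis using s(1) cM(2) h m1 by linarith
    next
      case False
      then show ?thesis using s(2) h by linarith
    qed
  qed
qed

end

subsection \<open>Many triangles force a pyramid\<close>

definition lists4 :: "'a set \<Rightarrow> 'a list set" where
  "lists4 X = {xs. set xs \<subseteq> X \<and> length xs = 4}"

lemma finite_lists4: "finite X \<Longrightarrow> finite (lists4 X)"
  unfolding lists4_def by (rule finite_lists_length_eq)

lemma card_lists4: "finite X \<Longrightarrow> card (lists4 X) = card X ^ 4"
  unfolding lists4_def by (rule card_lists_length_eq)

text \<open>Cauchy-Schwarz, applied twice.\<close>

lemma sum_power4_le:
  fixes f :: "'a \<Rightarrow> real"
  shows "(\<Sum>i\<in>I. f i) ^ 4 \<le> (\<Sum>i\<in>I. f i ^ 4) * real (card I) ^ 3"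
proof -
  have "(\<Sum>i\<in>I. f i) ^ 4 = ((\<Sum>i\<in>I. f i)\<^sup>2)\<^sup>2" by simp
  also have "\<dots> \<le> ((\<Sum>i\<in>I. (f i)\<^sup>2) * card I)\<^sup>2"
    by (rule power_mono[OF sum_squared_le_sum_of_squares]) simp
  also have "\<dots> = (\<Sum>i\<in>I. (f i)\<^sup>2)\<^sup>2 * (real (card I))\<^sup>2"
    by (rule power_mult_distrib)
  also have "\<dots> \<le> ((\<Sum>i\<in>I. ((f i)\<^sup>2)\<^sup>2) * card I) * (real (card I))\<^sup>2"
    by (rule mult_right_mono[OF sum_squared_le_sum_of_squares]) simp
  also have "\<dots> = (\<Sum>i\<in>I. f i ^ 4) * real (card I) ^ 3"
    by (simp add: power3_eq_cube power2_eq_square[of "real (card I)"])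
  finally show ?thesis .
qed

lemma card_pairs: "finite X \<Longrightarrow> finite Z \<Longrightarrow> card {(x, z). x \<in> X \<and> z \<in> Z \<and> Q x z} = (\<Sum>z\<in>Z. card {x \<in> X. Q x z})"
proof -
  assume fin: "finite X" "finite Z"
  have "{(x, z). x \<in> X \<and> z \<in> Z \<and> Q x z} = prod.swap ` (SIGMA z:Z. {x \<in> X. Q x z})"
    by (auto simp: image_def)
  then have "card {(x, z). x \<in> X \<and> z \<in> Z \<and> Q x z} = card (SIGMA z:Z. {x \<in> X. Q x z})"
    by (simp add: card_image)
  then show ?thesis using fin by simp
qed

text \<open>Each \<open>z\<close> contributes the fourth power of its degree, and the power mean
  inequality turns density \<open>d\<close> into \<open>d ^ 4\<close>. This is one round of the
  counting proof of Erdos for complete multipartite hypergraphs.\<close>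

lemma density_blowup:
  fixes d :: real
  assumes fin: "finite X" "finite Z" and d: "d \<ge> 0"
    and dens: "card {(x, z). x \<in> X \<and> z \<in> Z \<and> Q x z} \<ge> d * card X * card Z"
  shows "card {(xs, z). xs \<in> lists4 X \<and> z \<in> Z \<and> (\<forall>x\<in>set xs. Q x z)} \<ge> d ^ 4 * real (card X) ^ 4 * card Z"
proof (cases "Z = {}")
  case False
  then have Z: "real (card Z) > 0" using fin by (simp add: card_gt_0_iff)
  have "{xs \<in> lists4 X. \<forall>x\<in>set xs. Q x z} = lists4 {x \<in> X. Q x z}" for z
    by (auto simp: lists4_def)
  then have "card {(xs, z). xs \<in> lists4 X \<and> z \<in> Z \<and> (\<forall>x\<in>set xs. Q x z)} = (\<Sum>z\<in>Z. card {x \<in> X. Q x z} ^ 4)"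
    using card_pairs[of "lists4 X" Z "\<lambda>xs z. \<forall>x\<in>set xs. Q x z"] fin finite_lists4[OF fin(1)]
    by (simp add: card_lists4)
  then have 1: "real (card {(xs, z). xs \<in> lists4 X \<and> z \<in> Z \<and> (\<forall>x\<in>set xs. Q x z)}) =
    (\<Sum>z\<in>Z. real (card {x \<in> X. Q x z}) ^ 4)" (is "?N = ?S") by simp
  have "(d * card X * card Z) ^ 4 \<le> real (card {(x, z). x \<in> X \<and> z \<in> Z \<and> Q x z}) ^ 4"
    using dens d by (intro power_mono) auto
  also have "\<dots> = (\<Sum>z\<in>Z. real (card {x \<in> X. Q x z})) ^ 4"
    using card_pairs[OF fin] by simp
  also have "\<dots> \<le> ?S * real (card Z) ^ 3"
    by (rule sum_power4_le)
  finally have "(d ^ 4 * real (card X) ^ 4 * card Z) * real (card Z) ^ 3 \<le> ?N * real (card Z) ^ 3"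
    unfolding 1 by (simp add: power_mult_distrib eval_nat_numeral mult_ac)
  then show ?thesis using Z by simp
qed simp

text \<open>The 6 counts the pairs of positions that can coincide. The proof subtracts the exact
  number of distinct lists instead.\<close>

lemma card_nondistinct_lists4:
  assumes "finite V"
  shows "real (card {xs \<in> lists4 V. \<not> distinct xs}) \<le> 6 * real (card V) ^ 3"
proof (cases "card V \<ge> 4")
  case True
  then obtain m where m: "card V = m + 4" by (metis add.commute le_Suc_ex)
  have D: "{xs. length xs = 4 \<and> distinct xs \<and> set xs \<subseteq> V} \<subseteq> lists4 V"
    by (auto simp: lists4_def)
  have "{xs \<in> lists4 V. \<not> distinct xs} = lists4 V - {xs. length xs = 4 \<and> distinct xs \<and> set xs \<subseteq> V}"
    by (auto simp: lists4_def)
  then have "card {xs \<in> lists4 V. \<not> distinct xs} + card {xs. length xs = 4 \<and> distinct xs \<and> set xs \<subseteq> V} = card V ^ 4"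
    using card_Diff_subset[OF _ D] finite_subset[OF D finite_lists4[OF assms]] card_mono[OF finite_lists4[OF assms] D]
    by (simp add: card_lists4[OF assms])
  moreover have "card {xs. length xs = 4 \<and> distinct xs \<and> set xs \<subseteq> V} = \<Prod>{m + 1..m + 4}"
    using card_lists_distinct_length_eq[OF assms True] m by simp
  moreover have "\<Prod>{m + 1..m + 4} = (m + 1) * (m + 2) * (m + 3) * (m + 4)"
    by (simp add: eval_nat_numeral prod.nat_ivl_Suc' mult_ac)
  ultimately have "card {xs \<in> lists4 V. \<not> distinct xs} + (m + 1) * (m + 2) * (m + 3) * (m + 4) = (m + 4) ^ 4"
    using m by simp
  moreover have "(m + 4) ^ 4 \<le> 6 * (m + 4) ^ 3 + (m + 1) * (m + 2) * (m + 3) * (m + 4)"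
    by (simp add: power4_eq_xxxx power3_eq_cube algebra_simps)
  ultimately have "card {xs \<in> lists4 V. \<not> distinct xs} \<le> 6 * (m + 4) ^ 3"
    by linarith
  then have "real (card {xs \<in> lists4 V. \<not> distinct xs}) \<le> real (6 * (m + 4) ^ 3)"
    by (rule of_nat_mono)
  then show ?thesis using m by simp
next
  case False
  have "card {xs \<in> lists4 V. \<not> distinct xs} \<le> card V ^ 4"
    using card_mono[OF finite_lists4[OF assms], of "{xs \<in> lists4 V. \<not> distinct xs}"] by (simp add: card_lists4[OF assms])
  also have "\<dots> = card V * card V ^ 3" by (simp add: eval_nat_numeral)
  also have "\<dots> \<le> 6 * card V ^ 3" using False by (intro mult_right_mono) auto
  finally have "real (card {xs \<in> lists4 V. \<not> distinct xs}) \<le> real (6 * card V ^ 3)"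
    by (rule of_nat_mono)
  then show ?thesis by simp
qed

text \<open>Brings the next coordinate to the front for another round of
  \<open>density_blowup\<close>.\<close>

lemma card_triples_rotate:
  "card {(x, (y, z)). x \<in> X \<and> (y, z) \<in> Y \<times> Z \<and> Q x y z} = card {(y, (z, x)). y \<in> Y \<and> (z, x) \<in> Z \<times> X \<and> Q x y z}"
  by (rule bij_betw_same_card[of "\<lambda>(x, (y, z)). (y, (z, x))"], rule bij_betw_byWitness[of _ "\<lambda>(y, (z, x)). (x, (y, z))"]) auto

text \<open>The pyramid is 3-colourable with classes \<open>c, k1, k2, k3\<close>,
  \<open>h1, h3, h5\<close> and \<open>h2, h4, h6\<close>, so four vertices per class suffice.
  Adjacency across classes already makes them disjoint.\<close>

lemma has_pyramid_of_tripartite: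
  assumes R: "symp R" "irreflp R"
    and xs: "xs \<in> lists4 V" "distinct xs" and ys: "ys \<in> lists4 V" "distinct ys" and zs: "zs \<in> lists4 V" "distinct zs"
    and adj: "\<And>x y. x \<in> set xs \<Longrightarrow> y \<in> set ys \<Longrightarrow> R x y" "\<And>x z. x \<in> set xs \<Longrightarrow> z \<in> set zs \<Longrightarrow> R x z"
      "\<And>y z. y \<in> set ys \<Longrightarrow> z \<in> set zs \<Longrightarrow> R y z"
  shows "has_pyramid R V"
proof -
  obtain c k1 k2 k3 where x: "xs = [c, k1, k2, k3]"
    using xs(1) by (auto simp: lists4_def length_Suc_conv eval_nat_numeral)
  obtain h1 h3 h5 y where y: "ys = [h1, h3, h5, y]"
    using ys(1) by (auto simp: lists4_def length_Suc_conv eval_nat_numeral)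
  obtain h2 h4 h6 z where z: "zs = [h2, h4, h6, z]"
    using zs(1) by (auto simp: lists4_def length_Suc_conv eval_nat_numeral)
  have irr: "\<not> R x x" for x using R(2) by (simp add: irreflp_def)
  have d: "set xs \<inter> set ys = {}" "set xs \<inter> set zs = {}" "set ys \<inter> set zs = {}"
    using adj irr by blast+
  have "set ys \<inter> set (take 3 zs) = {}" "set xs \<inter> (set ys \<union> set (take 3 zs)) = {}"
    using d set_take_subset[of 3 zs] by blast+
  then have "distinct (xs @ ys @ take 3 zs)"
    using xs(2) ys(2) zs(2) by simp
  then have D: "distinct ([c, k1, k2, k3] @ [h1, h3, h5, y] @ [h2, h4, h6])"
    unfolding x y z by simp
  have a1: "R u h \<and> R h u" if "u \<in> {c, k1, k2, k3}" "h \<in> {h1, h3, h5, h2, h4, h6}" for h u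
    using adj(1)[of u h] adj(2)[of u h] that sympD[OF R(1)] unfolding x y z by auto
  have a2: "R h h' \<and> R h' h" if "h \<in> {h1, h3, h5}" "h' \<in> {h2, h4, h6}" for h h'
    using adj(3)[of h h'] that sympD[OF R(1)] unfolding y z by auto
  have V: "{c, k1, k2, k3} \<subseteq> V" "{h1, h3, h5} \<subseteq> V" "{h2, h4, h6} \<subseteq> V"
    using xs(1) ys(1) zs(1) unfolding x y z lists4_def by auto
  note D' = iffD2[OF distinct_rev D]
  show ?thesis
    by (rule has_pyramidI[of c h1 h2 h3 h4 h5 h6 k1 k2 k3])
      (use D D' V a1 a2 in simp_all)
qed

text \<open>Three rounds of blow-up raise the density to \<open>d ^ 64\<close> among n^12 triples of
  lists. At most 3 * 6 n^11 of these triples have a repetition in one of their lists, so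
  \<open>d ^ 64 * n > 18\<close> leaves a genuine \<open>K_{4,4,4}\<close>.\<close>

lemma has_pyramid_of_many_triangles:
  fixes d :: real
  assumes R: "symp R" "irreflp R" and V: "finite V" and d: "d \<ge> 0" and big: "d ^ 64 * card V > 18"
    and dens: "card {(x, (y, z)). x \<in> V \<and> (y, z) \<in> V \<times> V \<and> R x y \<and> R x z \<and> R y z} \<ge> d * real (card V) ^ 3"
  shows "has_pyramid R V"
proof -
  let ?n = "real (card V)" and ?L = "lists4 V"
  define T where "T x y z \<longleftrightarrow> R x y \<and> R x z \<and> R y z" for x y z
  note fL = finite_lists4[OF V] and cL = card_lists4[OF V]
  have "{(x, p). x \<in> V \<and> p \<in> V \<times> V \<and> (case p of (y, z) \<Rightarrow> T x y z)} =
    {(x, (y, z)). x \<in> V \<and> (y, z) \<in> V \<times> V \<and> R x y \<and> R x z \<and> R y z}"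
    unfolding T_def by auto
  then have "card {(x, p). x \<in> V \<and> p \<in> V \<times> V \<and> (case p of (y, z) \<Rightarrow> T x y z)} \<ge> d * card V * card (V \<times> V)"
    using dens by (simp add: card_cartesian_product power3_eq_cube mult_ac)
  from density_blowup[OF V _ d this]
  have "d ^ 4 * ?n ^ 4 * card (V \<times> V) \<le> card {(xs, p). xs \<in> ?L \<and> p \<in> V \<times> V \<and> (\<forall>x\<in>set xs. case p of (y, z) \<Rightarrow> T x y z)}"
    using V by simp
  also have "{(xs, p). xs \<in> ?L \<and> p \<in> V \<times> V \<and> (\<forall>x\<in>set xs. case p of (y, z) \<Rightarrow> T x y z)} =
    {(xs, (y, z)). xs \<in> ?L \<and> (y, z) \<in> V \<times> V \<and> (\<forall>x\<in>set xs. T x y z)}" by auto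
  also have "card \<dots> = card {(y, (z, xs)). y \<in> V \<and> (z, xs) \<in> V \<times> ?L \<and> (\<forall>x\<in>set xs. T x y z)}"
    by (rule card_triples_rotate)
  also have "{(y, (z, xs)). y \<in> V \<and> (z, xs) \<in> V \<times> ?L \<and> (\<forall>x\<in>set xs. T x y z)} =
    {(y, p). y \<in> V \<and> p \<in> V \<times> ?L \<and> (case p of (z, xs) \<Rightarrow> \<forall>x\<in>set xs. T x y z)}" by auto
  finally have "d ^ 4 * card V * card (V \<times> ?L) \<le> card {(y, p). y \<in> V \<and> p \<in> V \<times> ?L \<and> (case p of (z, xs) \<Rightarrow> \<forall>x\<in>set xs. T x y z)}"
    using cL by (simp add: card_cartesian_product mult_ac)
  from density_blowup[OF V _ _ this]
  have "(d ^ 4) ^ 4 * ?n ^ 4 * card (V \<times> ?L) \<le> card {(ys, p). ys \<in> ?L \<and> p \<in> V \<times> ?L \<and>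
      (\<forall>y\<in>set ys. case p of (z, xs) \<Rightarrow> \<forall>x\<in>set xs. T x y z)}"
    using V fL d by simp
  also have "{(ys, p). ys \<in> ?L \<and> p \<in> V \<times> ?L \<and> (\<forall>y\<in>set ys. case p of (z, xs) \<Rightarrow> \<forall>x\<in>set xs. T x y z)} =
    {(ys, (z, xs)). ys \<in> ?L \<and> (z, xs) \<in> V \<times> ?L \<and> (\<forall>y\<in>set ys. \<forall>x\<in>set xs. T x y z)}" by auto
  also have "card \<dots> = card {(z, (xs, ys)). z \<in> V \<and> (xs, ys) \<in> ?L \<times> ?L \<and> (\<forall>y\<in>set ys. \<forall>x\<in>set xs. T x y z)}"
    by (rule card_triples_rotate)
  also have "{(z, (xs, ys)). z \<in> V \<and> (xs, ys) \<in> ?L \<times> ?L \<and> (\<forall>y\<in>set ys. \<forall>x\<in>set xs. T x y z)} =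
    {(z, p). z \<in> V \<and> p \<in> ?L \<times> ?L \<and> (case p of (xs, ys) \<Rightarrow> \<forall>y\<in>set ys. \<forall>x\<in>set xs. T x y z)}" by auto
  finally have "(d ^ 4) ^ 4 * card V * card (?L \<times> ?L) \<le> card {(z, p). z \<in> V \<and> p \<in> ?L \<times> ?L \<and>
      (case p of (xs, ys) \<Rightarrow> \<forall>y\<in>set ys. \<forall>x\<in>set xs. T x y z)}"
    using cL by (simp add: card_cartesian_product mult_ac)
  from density_blowup[OF V _ _ this]
  have "((d ^ 4) ^ 4) ^ 4 * ?n ^ 4 * card (?L \<times> ?L) \<le> card {(zs, p). zs \<in> ?L \<and> p \<in> ?L \<times> ?L \<and>
      (\<forall>z\<in>set zs. case p of (xs, ys) \<Rightarrow> \<forall>y\<in>set ys. \<forall>x\<in>set xs. T x y z)}" (is "_ \<le> real (card ?G)")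
    using V fL d by simp
  moreover have "((d ^ 4) ^ 4) ^ 4 * ?n ^ 4 * card (?L \<times> ?L) = d ^ 64 * ?n * ?n ^ 11"
    using cL by (simp add: card_cartesian_product power_mult[symmetric] power_add[symmetric] flip: power_Suc power_Suc2)
  moreover have "d ^ 64 * ?n * ?n ^ 11 > 18 * ?n ^ 11"
    using big by (intro mult_strict_right_mono) (auto intro!: zero_less_power gr0I)
  ultimately have G: "18 * ?n ^ 11 < real (card ?G)" by linarith
  let ?N = "{xs \<in> ?L. \<not> distinct xs}"
  have "\<not> ?G \<subseteq> (?N \<times> ?L \<times> ?L) \<union> (?L \<times> ?N \<times> ?L) \<union> (?L \<times> ?L \<times> ?N)"
  proof
    assume "?G \<subseteq> (?N \<times> ?L \<times> ?L) \<union> (?L \<times> ?N \<times> ?L) \<union> (?L \<times> ?L \<times> ?N)"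
    then have "card ?G \<le> card ((?N \<times> ?L \<times> ?L) \<union> (?L \<times> ?N \<times> ?L) \<union> (?L \<times> ?L \<times> ?N))"
      using fL by (intro card_mono) auto
    also have "\<dots> \<le> card (?N \<times> ?L \<times> ?L) + card (?L \<times> ?N \<times> ?L) + card (?L \<times> ?L \<times> ?N)"
      by (meson add_le_mono1 card_Un_le order_trans)
    also have "\<dots> = 3 * card ?N * card V ^ 8"
      by (simp add: card_cartesian_product cL algebra_simps flip: power_add)
    finally have "real (card ?G) \<le> real (3 * card ?N * card V ^ 8)" by (rule of_nat_mono)
    also have "\<dots> = 3 * real (card ?N) * ?n ^ 8" by simp
    also have "\<dots> \<le> 3 * (6 * ?n ^ 3) * ?n ^ 8"
      using card_nondistinct_lists4[OF V] by (intro mult_right_mono mult_left_mono) auto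
    also have "\<dots> = 18 * ?n ^ 11" by (simp flip: power_add)
    finally show False using G by simp
  qed
  then obtain zs xs ys where g: "(zs, xs, ys) \<in> ?G" "distinct zs" "distinct xs" "distinct ys" by auto
  then have L: "zs \<in> ?L" "xs \<in> ?L" "ys \<in> ?L" and
    t: "\<And>x y z. x \<in> set xs \<Longrightarrow> y \<in> set ys \<Longrightarrow> z \<in> set zs \<Longrightarrow> T x y z" by auto
  have ne: "xs \<noteq> []" "ys \<noteq> []" "zs \<noteq> []" using L by (auto simp: lists4_def)
  show ?thesis
  proof (rule has_pyramid_of_tripartite[OF R L(2) g(3) L(3) g(4) L(1) g(2)])
    show "R x y" if "x \<in> set xs" "y \<in> set ys" for x y
      using t[OF that, of "hd zs"] ne by (simp add: T_def)
    show "R x z" if "x \<in> set xs" "z \<in> set zs" for x z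
      using t[OF that(1) _ that(2), of "hd ys"] ne by (simp add: T_def)
    show "R y z" if "y \<in> set ys" "z \<in> set zs" for y z
      using t[OF _ that, of "hd xs"] ne by (simp add: T_def)
  qed
qed

subsection \<open>Stability\<close>

lemma card_triangles:
  assumes "finite V"
  shows "card {(x, (y, z)). x \<in> V \<and> (y, z) \<in> V \<times> V \<and> R x y \<and> R x z \<and> R y z} =
    (\<Sum>x\<in>V. deg_sum R {y \<in> V. R x y})"
proof -
  have "{(x, (y, z)). x \<in> V \<and> (y, z) \<in> V \<times> V \<and> R x y \<and> R x z \<and> R y z} =
    (SIGMA x:V. SIGMA y:{y \<in> V. R x y}. {z \<in> {y \<in> V. R x y}. R y z})" by auto
  then show ?thesis
    using assms by (simp add: deg_sum_def deg_in_def)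
qed

lemma averaging:
  fixes f :: "'a \<Rightarrow> real" and c N :: real
  assumes "finite S" "card S \<le> N" "c > 0" "N > 0" "(\<Sum>x\<in>S. f x) \<ge> c * N"
  shows "\<exists>x\<in>S. f x \<ge> c"
proof (rule ccontr)
  assume "\<not> ?thesis"
  then have lt: "f x < c" if "x \<in> S" for x using that by force
  show False
  proof (cases "S = {}")
    case True
    then show False using assms(3-5) by (simp add: mult_le_0_iff)
  next
    case False
    have "(\<Sum>x\<in>S. f x) < (\<Sum>x\<in>S. c)"
      by (rule sum_strict_mono[OF assms(1) False lt])
    also have "\<dots> = card S * c" by simp
    also have "\<dots> \<le> c * N" using assms(2,3) by (simp add: mult.commute)
    finally show False using assms(5) by simp
  qed
qed

text \<open>\<open>A\<close> is a neighbourhood spanning few edges. All degrees are at least n / 2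
  and the complement \<open>B\<close> has at most n / 2 vertices, so the number of missing pairs
  between \<open>A\<close> and \<open>B\<close> is at most \<open>deg_sum R A\<close>. Hence an edge
  inside \<open>B\<close> has, on average, most of \<open>A\<close> as common neighbours; triangles
  being few, \<open>B\<close> spans few edges. The three errors c n^3, divided by |A| \<ge> n / 2,
  give 6 c n^2 for \<open>B\<close>, and \<open>A\<close> adds c n^2.\<close>

lemma almost_bipartite:
  fixes c :: real
  assumes R: "symp R" and V: "finite V" "V \<noteq> {}" and c: "c \<ge> 0"
    and deg: "\<And>v. v \<in> V \<Longrightarrow> deg_in R V v \<ge> card V / 2"
    and few: "(\<Sum>x\<in>V. deg_sum R {y \<in> V. R x y}) \<le> c * real (card V) ^ 3"
  shows "\<exists>A\<subseteq>V. deg_sum R A + deg_sum R (V - A) \<le> 7 * c * real (card V) ^ 2"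
proof -
  let ?n = "real (card V)"
  have n: "?n > 0" using V by (simp add: card_gt_0_iff)
  have "\<exists>x\<in>V. deg_sum R {y \<in> V. R x y} \<le> c * ?n ^ 2"
  proof (rule ccontr)
    assume "\<not> ?thesis"
    then have "(\<Sum>x\<in>V. c * ?n ^ 2) < (\<Sum>x\<in>V. real (deg_sum R {y \<in> V. R x y}))"
      using V by (intro sum_strict_mono) (auto simp: not_le)
    then show False using few by (simp add: power3_eq_cube power2_eq_square mult_ac)
  qed
  then obtain x where x: "x \<in> V" "deg_sum R {y \<in> V. R x y} \<le> c * ?n ^ 2" by blast
  define A where "A = {y \<in> V. R x y}"
  define B where "B = V - A"
  have AV: "A \<subseteq> V" "B \<subseteq> V" "A \<union> B = V" "A \<inter> B = {}" by (auto simp: A_def B_def)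
  have fin: "finite A" "finite B" using AV V finite_subset by blast+
  have dA: "deg_sum R A \<le> c * ?n ^ 2" using x by (simp add: A_def)
  have cA: "real (card A) \<ge> ?n / 2" using deg[OF x(1)] by (simp add: A_def deg_in_def)
  have cAB: "?n = real (card A) + card B"
    using card_Un_disjoint[OF fin AV(4)] AV(3) by simp
  define miss where "miss S v = card {u \<in> S. \<not> R v u}" for S v
  have "symp (\<lambda>u v. \<not> R u v)" using R by (auto simp: symp_def)
  from deg_in_swap[OF this fin] have miss_swap: "(\<Sum>a\<in>A. miss B a) = (\<Sum>b\<in>B. miss A b)"
    by (simp add: deg_in_def miss_def)
  have "real (card A) * (?n / 2) \<le> (\<Sum>a\<in>A. real (deg_in R V a))"
    using sum_bounded_below[of A "?n / 2" "\<lambda>a. real (deg_in R V a)"] deg AV by auto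
  also have "\<dots> = (\<Sum>a\<in>A. real (deg_in R A a) + (card B - real (miss B a)))"
  proof (rule sum.cong[OF refl])
    fix a
    have "deg_in R V a = deg_in R A a + deg_in R B a"
      using deg_in_Un[OF fin AV(4)] AV(3) by simp
    then show "real (deg_in R V a) = real (deg_in R A a) + (card B - real (miss B a))"
      using deg_in_compl[OF fin(2), of R a] unfolding miss_def by simp
  qed
  also have "\<dots> = deg_sum R A + real (card A) * card B - (\<Sum>a\<in>A. miss B a)"
    by (simp add: sum.distrib sum_subtractf deg_sum_def)
  finally have "real (\<Sum>a\<in>A. miss B a) \<le> deg_sum R A + real (card A) * (card B - ?n / 2)"
    by (simp add: algebra_simps)
  also have "\<dots> \<le> c * ?n ^ 2 + 0"
    using dA cA cAB by (intro add_mono mult_nonneg_nonpos) auto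
  finally have M: "real (\<Sum>b\<in>B. miss A b) \<le> c * ?n ^ 2" using miss_swap by simp
  have common: "real (card A) - miss A y - miss A z \<le> deg_in R {u \<in> V. R y u} z" for y z
  proof -
    have "A \<subseteq> {u \<in> {u \<in> V. R y u}. R z u} \<union> {u \<in> A. \<not> R y u} \<union> {u \<in> A. \<not> R z u}"
      using AV by auto
    then have "card A \<le> card ({u \<in> {u \<in> V. R y u}. R z u} \<union> {u \<in> A. \<not> R y u} \<union> {u \<in> A. \<not> R z u})"
      using V fin by (intro card_mono) auto
    also have "\<dots> \<le> card {u \<in> {u \<in> V. R y u}. R z u} + card {u \<in> A. \<not> R y u} + card {u \<in> A. \<not> R z u}"
      by (meson add_le_mono1 card_Un_le order_trans)
    finally show ?thesis unfolding miss_def deg_in_def by simp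
  qed
  have sumN: "(\<Sum>z\<in>{z \<in> B. R y z}. k) = real (deg_in R B y) * k" for y and k :: real
    by (simp add: deg_in_def)
  have "(\<Sum>y\<in>B. \<Sum>z\<in>{z \<in> B. R y z}. real (card A) - miss A y - miss A z) \<le>
    (\<Sum>y\<in>B. \<Sum>z\<in>{z \<in> B. R y z}. real (deg_in R {u \<in> V. R y u} z))"
    by (intro sum_mono common)
  also have "\<dots> \<le> (\<Sum>y\<in>B. \<Sum>z\<in>{z \<in> V. R y z}. real (deg_in R {u \<in> V. R y u} z))"
    using V AV by (intro sum_mono sum_mono2) auto
  also have "\<dots> \<le> (\<Sum>y\<in>V. \<Sum>z\<in>{z \<in> V. R y z}. real (deg_in R {u \<in> V. R y u} z))"
    using V AV by (intro sum_mono2) (auto intro: sum_nonneg)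
  also have "\<dots> = real (\<Sum>y\<in>V. deg_sum R {y' \<in> V. R y y'})"
    by (simp add: deg_sum_def)
  also have "\<dots> \<le> c * ?n ^ 3" by (rule few)
  finally have 1: "(\<Sum>y\<in>B. \<Sum>z\<in>{z \<in> B. R y z}. real (card A) - miss A y - miss A z) \<le> c * ?n ^ 3" .
  have swap: "(\<Sum>y\<in>B. \<Sum>z\<in>{z \<in> B. R y z}. real (miss A z)) = (\<Sum>z\<in>B. \<Sum>y\<in>{y \<in> B. R z y}. real (miss A z))"
  proof -
    have "(\<Sum>y\<in>B. \<Sum>z\<in>{z \<in> B. R y z}. real (miss A z)) = (\<Sum>y\<in>B. \<Sum>z\<in>B. if R y z then real (miss A z) else 0)"
      using fin by (simp add: sum.If_cases Int_def)
    also have "\<dots> = (\<Sum>z\<in>B. \<Sum>y\<in>B. if R y z then real (miss A z) else 0)"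
      by (rule sum.swap)
    also have "\<dots> = (\<Sum>z\<in>B. \<Sum>y\<in>B. if R z y then real (miss A z) else 0)"
      using sympD[OF R] by (intro sum.cong refl if_cong) blast+
    also have "\<dots> = (\<Sum>z\<in>B. \<Sum>y\<in>{y \<in> B. R z y}. real (miss A z))"
      using fin by (simp add: sum.If_cases Int_def)
    finally show ?thesis .
  qed
  have "(\<Sum>y\<in>B. real (deg_in R B y) * miss A y) \<le> (\<Sum>y\<in>B. ?n * miss A y)"
  proof (intro sum_mono mult_right_mono)
    fix y
    have "deg_in R B y \<le> card B" by (rule deg_in_le_card[OF fin(2)])
    then show "real (deg_in R B y) \<le> ?n" using cAB by simp
  qed simp
  also have "\<dots> = ?n * real (\<Sum>y\<in>B. miss A y)" by (simp add: sum_distrib_left)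
  also have "\<dots> \<le> ?n * (c * ?n ^ 2)" using M n by (intro mult_left_mono) auto
  finally have 2: "(\<Sum>y\<in>B. real (deg_in R B y) * miss A y) \<le> c * ?n ^ 3"
    by (simp add: power3_eq_cube power2_eq_square mult_ac)
  have "(\<Sum>y\<in>B. \<Sum>z\<in>{z \<in> B. R y z}. real (card A) - miss A y - miss A z) =
     (\<Sum>y\<in>B. real (deg_in R B y) * card A) - (\<Sum>y\<in>B. real (deg_in R B y) * miss A y)
     - (\<Sum>y\<in>B. real (deg_in R B y) * miss A y)"
    using swap by (simp only: sum_subtractf sumN)
  also have "(\<Sum>y\<in>B. real (deg_in R B y) * card A) = deg_sum R B * real (card A)"
    by (simp add: deg_sum_def sum_distrib_right)
  finally have "deg_sum R B * real (card A) \<le> 3 * c * ?n ^ 3" using 1 2 by linarith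
  moreover have "deg_sum R B * real (card A) \<ge> deg_sum R B * (?n / 2)"
    using cA by (intro mult_left_mono) auto
  ultimately have "deg_sum R B * ?n \<le> (6 * c * ?n ^ 2) * ?n"
    by (simp add: power3_eq_cube power2_eq_square mult_ac)
  then have "deg_sum R B \<le> 6 * c * ?n ^ 2" using n by (rule mult_right_le_imp_le)
  then have "deg_sum R A + deg_sum R (V - A) \<le> 7 * c * ?n ^ 2"
    using dA unfolding B_def by simp
  then show ?thesis using AV(1) by blast
qed

text \<open>The cut minimises the inner degree sum; moving \<open>v\<close> to the other side
  changes it by twice the difference of the two degrees of \<open>v\<close>.\<close>

lemma obtain_max_cut:
  assumes R: "symp R" "irreflp R" and V: "finite V" and A0: "A0 \<subseteq> V"
  obtains A B where "A \<union> B = V" "A \<inter> B = {}"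
    "deg_sum R A + deg_sum R B \<le> deg_sum R A0 + deg_sum R (V - A0)"
    "\<And>v. v \<in> A \<Longrightarrow> deg_in R A v \<le> deg_in R B v" "\<And>v. v \<in> B \<Longrightarrow> deg_in R B v \<le> deg_in R A v"
proof -
  define f where "f A = deg_sum R A + deg_sum R (V - A)" for A
  obtain A where A: "A \<subseteq> V" "\<And>A'. A' \<subseteq> V \<Longrightarrow> f A \<le> f A'"
    using ex_has_least_nat[of "\<lambda>A. A \<subseteq> V" A0 f] A0 by blast
  have move: "deg_in R A v \<le> deg_in R (V - A) v"
    if "A \<subseteq> V" "\<And>A'. A' \<subseteq> V \<Longrightarrow> f A \<le> f A'" "v \<in> A" for A v
  proof -
    have fin: "finite (A - {v})" "finite (V - A)" using V that(1) finite_subset by auto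
    have 1: "deg_sum R A = deg_sum R (A - {v}) + 2 * deg_in R (A - {v}) v"
      using deg_sum_insert[OF R fin(1), of v] that(3) by (simp add: insert_absorb)
    have "V - (A - {v}) = insert v (V - A)" using that by auto
    then have 2: "deg_sum R (V - (A - {v})) = deg_sum R (V - A) + 2 * deg_in R (V - A) v"
      using deg_sum_insert[OF R fin(2), of v] that(3) by simp
    have "A = insert v (A - {v})" using that(3) by auto
    then have "deg_in R A v = deg_in R (A - {v}) v"
      using deg_in_insert[OF fin(1), of v R v] R(2) by (auto simp: irreflp_def)
    moreover have "f A \<le> f (A - {v})" using that(1) by (intro that(2)) auto
    ultimately show ?thesis unfolding f_def 1 2 by simp
  qed
  have compl: "f (V - A') = f A'" if "A' \<subseteq> V" for A'
    using that by (simp add: f_def double_diff)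
  have B: "f (V - A) \<le> f A'" if "A' \<subseteq> V" for A'
    using A(2)[OF that] compl[OF A(1)] by simp
  have VA: "V - (V - A) = A" using A(1) by auto
  show thesis
  proof (rule that[of A "V - A"])
    show "deg_in R (V - A) v \<le> deg_in R A v" if "v \<in> V - A" for v
      using move[of "V - A" v] B that VA by simp
    show "deg_sum R A + deg_sum R (V - A) \<le> deg_sum R A0 + deg_sum R (V - A0)"
      using A(2)[OF A0] by (simp add: f_def)
  qed (use A move in auto)
qed

subsection \<open>Vertices of large degree inside their class\<close>

lemma obtain_max_value:
  fixes f :: "'a \<Rightarrow> nat"
  assumes "finite S"
  obtains p where "\<And>x. x \<in> S \<Longrightarrow> f x \<le> p" "p = 0 \<or> (\<exists>x\<in>S. f x = p)"
proof (cases "S = {}")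
  case True
  then show thesis by (intro that[of 0]) auto
next
  case False
  then have "Max (f ` S) \<in> f ` S" using assms by (intro Max_in) auto
  then show thesis using assms by (intro that[of "Max (f ` S)"]) auto
qed

text \<open>The single parameter \<open>s\<close> bounds both the imbalance of the classes and the
  density of inner edges; it is chosen after all degree thresholds.\<close>

locale max_cut =
  fixes R :: "'a \<Rightarrow> 'a \<Rightarrow> bool" and A B :: "'a set" and n s :: real
  assumes sym: "symp R" and irr: "irreflp R" and fin: "finite A" "finite B" and disj: "A \<inter> B = {}"
    and free: "\<not> has_pyramid R (A \<union> B)"
    and n: "n = real (card A) + real (card B)" "n > 0"
    and min_deg: "\<And>v. v \<in> A \<union> B \<Longrightarrow> deg_in R (A \<union> B) v \<ge> n / 2"
    and cutA: "\<And>v. v \<in> A \<Longrightarrow> deg_in R A v \<le> deg_in R B v"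
    and cutB: "\<And>v. v \<in> B \<Longrightarrow> deg_in R B v \<le> deg_in R A v"
    and s: "s > 0" and sizeA: "card A \<le> (1 / 2 + s) * n" and sizeB: "card B \<le> (1 / 2 + s) * n"
    and inner: "deg_sum R A + deg_sum R B \<le> s * n ^ 2"
begin

lemma swapped: "max_cut R B A n s"
  by unfold_locales
    (use sym irr fin disj free n min_deg cutA cutB s sizeA sizeB inner in \<open>auto simp: Un_commute Int_commute add.commute\<close>)

abbreviation d :: "'a \<Rightarrow> real" where "d v \<equiv> real (deg_in R (A \<union> B) v)"

lemma d_eq: "d v = real (deg_in R A v) + real (deg_in R B v)"
  using deg_in_Un[OF fin disj] by simp

text \<open>The set \<open>W\<close> of the overview; the threshold stays a parameter because two
  scales are compared later.\<close>

definition high :: "real \<Rightarrow> 'a set" where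
  "high \<eta> = {v \<in> A. deg_in R A v \<ge> \<eta> * n} \<union> {v \<in> B. deg_in R B v \<ge> \<eta> * n}"

lemma high_subset: "high \<eta> \<subseteq> A \<union> B"
  unfolding high_def by auto

lemma finite_high: "finite (high \<eta>)"
  using high_subset fin finite_subset by blast

lemma high_antimono: "\<eta>' \<le> \<eta> \<Longrightarrow> high \<eta> \<subseteq> high \<eta>'"
proof -
  assume "\<eta>' \<le> \<eta>"
  then have "\<eta>' * n \<le> \<eta> * n" using n(2) by simp
  then show ?thesis unfolding high_def by auto
qed

text \<open>Markov's inequality for the inner degrees.\<close>

lemma card_high: "\<eta> * card (high \<eta>) \<le> s * n"
proof -
  let ?A = "{v \<in> A. deg_in R A v \<ge> \<eta> * n}" and ?B = "{v \<in> B. deg_in R B v \<ge> \<eta> * n}"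
  have "real (card ?A) * (\<eta> * n) \<le> (\<Sum>v\<in>?A. real (deg_in R A v))"
    using sum_bounded_below[of ?A "\<eta> * n" "\<lambda>v. real (deg_in R A v)"] by simp
  also have "\<dots> \<le> real (deg_sum R A)"
    unfolding deg_sum_def of_nat_sum using fin by (intro sum_mono2) auto
  finally have 1: "real (card ?A) * (\<eta> * n) \<le> real (deg_sum R A)" .
  have "real (card ?B) * (\<eta> * n) \<le> (\<Sum>v\<in>?B. real (deg_in R B v))"
    using sum_bounded_below[of ?B "\<eta> * n" "\<lambda>v. real (deg_in R B v)"] by simp
  also have "\<dots> \<le> real (deg_sum R B)"
    unfolding deg_sum_def of_nat_sum using fin by (intro sum_mono2) auto
  finally have 2: "real (card ?B) * (\<eta> * n) \<le> real (deg_sum R B)" .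
  have "card (high \<eta>) = card ?A + card ?B"
    unfolding high_def using fin disj by (intro card_Un_disjoint) auto
  then have "(\<eta> * card (high \<eta>)) * n = real (card ?A) * (\<eta> * n) + real (card ?B) * (\<eta> * n)"
    by (simp add: algebra_simps)
  also have "\<dots> \<le> s * n ^ 2" using 1 2 inner by simp
  also have "\<dots> = (s * n) * n" by (simp add: power2_eq_square)
  finally show ?thesis using n(2) by simp
qed

text \<open>Of its at least n / 2 neighbours, \<open>x\<close> has fewer than \<eta> n in
  \<open>A\<close>, and \<open>B\<close> exceeds n / 2 by at most s n.\<close>

lemma missing_le:
  assumes "x \<in> A - high \<eta>"
  shows "card {y \<in> B. \<not> R x y} \<le> (\<eta> + s) * n"
proof -
  have "real (deg_in R A x) < \<eta> * n" using assms by (auto simp: high_def)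
  moreover have "d x \<ge> n / 2" using min_deg assms by simp
  moreover have "real (card {y \<in> B. \<not> R x y}) = card B - real (deg_in R B x)"
    using deg_in_compl[OF fin(2), of R x] by simp
  ultimately show ?thesis using sizeB d_eq[of x] by (simp add: algebra_simps)
qed

lemma high_deg:
  assumes "w \<in> high \<eta>" "\<eta> \<le> 1 / 4"
  shows "deg_in R A w \<ge> \<eta> * n" "deg_in R B w \<ge> \<eta> * n"
proof -
  have "\<eta> * n \<le> n / 4" using assms(2) n(2) by simp
  moreover have "d w \<ge> n / 2" using min_deg assms(1) high_subset by blast
  moreover have "real (deg_in R A w) \<le> deg_in R B w \<and> deg_in R A w \<ge> \<eta> * n \<or>
    real (deg_in R B w) \<le> deg_in R A w \<and> deg_in R B w \<ge> \<eta> * n"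
    using assms(1) cutA cutB unfolding high_def by auto
  ultimately show "deg_in R A w \<ge> \<eta> * n" "deg_in R B w \<ge> \<eta> * n"
    using d_eq[of w] by auto
qed

text \<open>The two bounds differ because the pyramid takes its centre and corners from
  \<open>A\<close>, any four vertices, and then needs common neighbours of these four in
  \<open>B\<close>.\<close>

lemma common_nbrs_of_three:
  fixes \<mu> :: real
  assumes w: "distinct [w1, w2, w3]" "{w1, w2, w3} \<subseteq> A \<union> B"
  shows "card {x \<in> A - high \<mu>. \<forall>w\<in>{w1, w2, w3}. R w x} < 4 \<or>
    card {y \<in> B. \<forall>w\<in>{w1, w2, w3}. R w y} < 4 * ((\<mu> + s) * n) + 3" (is "card ?X < 4 \<or> real (card ?Y) < _")
proof (rule ccontr)
  assume "\<not> ?thesis"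
  then have c: "card ?X \<ge> 4" "card ?Y \<ge> 4 * ((\<mu> + s) * n) + 3" by auto
  have "has_pyramid R ({w1, w2, w3} \<union> ?X \<union> ?Y)"
  proof (rule pyramid_of_three[OF sym irr w(1) _ _ _ c])
    show "card {y \<in> ?Y. \<not> R x y} \<le> (\<mu> + s) * n" if "x \<in> ?X" for x
    proof -
      have "card {y \<in> ?Y. \<not> R x y} \<le> card {y \<in> B. \<not> R x y}"
        using fin by (intro card_mono) auto
      then show ?thesis using missing_le[of x \<mu>] that by simp
    qed
  qed (use fin disj in auto)
  moreover have "{w1, w2, w3} \<union> ?X \<union> ?Y \<subseteq> A \<union> B" using w(2) by auto
  ultimately show False using free has_pyramid_mono by blast
qed

text \<open>Each triple in \<open>W\<close> has few common neighbours in \<open>A\<close> or few in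
  \<open>B\<close>. Deleting these few vertices for every triple makes the condition exact: no three
  vertices of \<open>W\<close> are seen by both some \<open>x\<close> and some
  \<open>y\<close>.\<close>

definition core :: "'a set \<Rightarrow> real \<Rightarrow> 'a set \<Rightarrow> 'a set \<Rightarrow> bool" where
  "core W \<tau> A' B' \<longleftrightarrow> A' \<subseteq> A \<and> B' \<subseteq> B \<and> real (card (A - A')) + card (B - B') \<le> \<tau> * n \<and>
     (\<forall>x\<in>A'. \<forall>y\<in>B'. card {w \<in> W. R w x \<and> R w y} \<le> 2)"

text \<open>The loss in \<tau> is \<open>high \<mu>\<close>, of size at most s n / \<mu>, and for
  each of at most \<open>K ^ 3\<close> ordered triples the common neighbours on its poor
  side.\<close>

lemma core_exists:
  fixes \<mu> \<tau> :: real
  assumes W: "W \<subseteq> A \<union> B" "card W \<le> K" and \<mu>: "\<mu> > 0"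
    and \<tau>: "s / \<mu> * n + real K ^ 3 * (4 * ((\<mu> + s) * n) + 7) \<le> \<tau> * n"
  obtains A' B' where "core W \<tau> A' B'"
proof -
  have fW: "finite W" using W(1) fin finite_subset by blast
  define T where "T = {t \<in> W \<times> W \<times> W. case t of (w1, w2, w3) \<Rightarrow> distinct [w1, w2, w3]}"
  define ws where "ws t = (case t of (w1, w2, w3) \<Rightarrow> {w1, w2, w3})" for t :: "'a \<times> 'a \<times> 'a"
  define X where "X t = {x \<in> A - high \<mu>. \<forall>w\<in>ws t. R w x}" for t
  define Y where "Y t = {y \<in> B. \<forall>w\<in>ws t. R w y}" for t
  define A' where "A' = A - high \<mu> - (\<Union>t\<in>{t \<in> T. card (X t) < 4}. X t)"
  define B' where "B' = B - (\<Union>t\<in>{t \<in> T. \<not> card (X t) < 4}. Y t)"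
  let ?e = "4 * ((\<mu> + s) * n) + 3"
  have e: "?e \<ge> 3" using \<mu> s n(2) by simp
  have fT: "finite T" using fW by (simp add: T_def)
  have "card T \<le> card (W \<times> W \<times> W)" using fW by (intro card_mono) (auto simp: T_def)
  also have "\<dots> = card W ^ 3" by (simp add: card_cartesian_product power3_eq_cube)
  also have "\<dots> \<le> K ^ 3" using W(2) by (rule power_mono) simp
  finally have "card T \<le> K ^ 3" .
  from of_nat_mono[OF this, where 'a = real] have cT: "real (card T) \<le> real K ^ 3" by simp
  have Y: "card (Y t) \<le> ?e" if "t \<in> T" "\<not> card (X t) < 4" for t
  proof -
    obtain w1 w2 w3 where t: "t = (w1, w2, w3)" by (cases t)
    have "distinct [w1, w2, w3]" "{w1, w2, w3} \<subseteq> A \<union> B"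
      using that(1) W(1) unfolding T_def t by auto
    from common_nbrs_of_three[OF this, of \<mu>] that(2) show ?thesis
      unfolding X_def Y_def ws_def t by simp
  qed
  have "card (A - A') \<le> card (high \<mu> \<union> (\<Union>t\<in>{t \<in> T. card (X t) < 4}. X t))"
    using finite_high fT fin by (intro card_mono) (auto simp: A'_def X_def)
  also have "\<dots> \<le> card (high \<mu>) + card (\<Union>t\<in>{t \<in> T. card (X t) < 4}. X t)"
    by (rule card_Un_le)
  also have "card (\<Union>t\<in>{t \<in> T. card (X t) < 4}. X t) \<le> (\<Sum>t\<in>{t \<in> T. card (X t) < 4}. card (X t))"
    using fT by (intro card_UN_le) simp
  also have "\<dots> \<le> of_nat (card {t \<in> T. card (X t) < 4}) * 4"
    by (rule sum_bounded_above) auto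
  also have "card {t \<in> T. card (X t) < 4} \<le> card T" using fT by (intro card_mono) auto
  finally have "card (A - A') \<le> card (high \<mu>) + card T * 4" by simp
  from of_nat_mono[OF this, where 'a = real]
  have 1: "real (card (A - A')) \<le> card (high \<mu>) + 4 * real (card T)" by simp
  have "card (B - B') \<le> card (\<Union>t\<in>{t \<in> T. \<not> card (X t) < 4}. Y t)"
    using fT fin by (intro card_mono) (auto simp: B'_def Y_def)
  also have "\<dots> \<le> (\<Sum>t\<in>{t \<in> T. \<not> card (X t) < 4}. card (Y t))"
    using fT by (intro card_UN_le) simp
  finally have "card (B - B') \<le> (\<Sum>t\<in>{t \<in> T. \<not> card (X t) < 4}. card (Y t))" .
  from of_nat_mono[OF this, where 'a = real]
  have "real (card (B - B')) \<le> (\<Sum>t\<in>{t \<in> T. \<not> card (X t) < 4}. real (card (Y t)))"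
    by simp
  also have "\<dots> \<le> real (card {t \<in> T. \<not> card (X t) < 4}) * ?e"
    using Y by (intro sum_bounded_above) auto
  also have "\<dots> \<le> card T * ?e"
    using fT e by (intro mult_right_mono) (auto intro: card_mono)
  finally have 2: "real (card (B - B')) \<le> card T * ?e" .
  have 3: "real (card (high \<mu>)) \<le> s / \<mu> * n"
    using card_high[of \<mu>] \<mu> by (simp add: field_simps)
  have "real (card (A - A')) + card (B - B') \<le> s / \<mu> * n + card T * (?e + 4)"
    using 1 2 3 by (simp add: algebra_simps)
  also have "\<dots> \<le> s / \<mu> * n + real K ^ 3 * (?e + 4)"
    using cT e by (intro add_left_mono mult_right_mono) auto
  also have "\<dots> \<le> \<tau> * n" using \<tau> by (simp add: algebra_simps)
  finally have c: "real (card (A - A')) + card (B - B') \<le> \<tau> * n" .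
  have "card {w \<in> W. R w x \<and> R w y} \<le> 2" if xy: "x \<in> A'" "y \<in> B'" for x y
  proof (rule ccontr)
    assume "\<not> ?thesis"
    then have "card {w \<in> W. R w x \<and> R w y} \<ge> 3" by simp
    then obtain w1 w2 w3 where w: "w1 \<in> {w \<in> W. R w x \<and> R w y}" "w2 \<in> {w \<in> W. R w x \<and> R w y}"
      "w3 \<in> {w \<in> W. R w x \<and> R w y}" "w1 \<noteq> w2" "w1 \<noteq> w3" "w2 \<noteq> w3"
      by (rule obtain_distinct3)
    let ?t = "(w1, w2, w3)"
    have t: "?t \<in> T" using w by (simp add: T_def)
    have "x \<in> X ?t" "y \<in> Y ?t" using w xy by (auto simp: X_def Y_def ws_def A'_def B'_def)
    then show False using xy t unfolding A'_def B'_def by blast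
  qed
  then have "core W \<tau> A' B'"
    unfolding core_def using c by (auto simp: A'_def B'_def)
  then show thesis by (rule that)
qed

lemma deg_in_core:
  assumes "core W \<tau> A' B'"
  shows "real (deg_in R A w) \<le> deg_in R A' w + real (card (A - A'))"
    "real (deg_in R B w) \<le> deg_in R B' w + real (card (B - B'))"
    "real (card (A - A')) \<le> \<tau> * n" "real (card (B - B')) \<le> \<tau> * n"
proof -
  have sub: "A' \<subseteq> A" "B' \<subseteq> B" using assms by (auto simp: core_def)
  have le: "deg_in R S w \<le> deg_in R S' w + card (S - S')" if "S' \<subseteq> S" "finite S" for S S'
  proof -
    have f: "finite S'" "finite (S - S')" using that finite_subset by auto
    have "deg_in R S w = deg_in R (S' \<union> (S - S')) w"
      using that by (intro arg_cong[where f = "\<lambda>S. deg_in R S w"]) auto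
    also have "\<dots> \<le> deg_in R S' w + deg_in R (S - S') w" by (rule deg_in_Un_le[OF f])
    also have "\<dots> \<le> deg_in R S' w + card (S - S')" using deg_in_le_card[OF f(2)] by simp
    finally show ?thesis .
  qed
  show "real (deg_in R A w) \<le> deg_in R A' w + real (card (A - A'))"
    using of_nat_mono[OF le[OF sub(1) fin(1)], where 'a = real] by simp
  show "real (deg_in R B w) \<le> deg_in R B' w + real (card (B - B'))"
    using of_nat_mono[OF le[OF sub(2) fin(2)], where 'a = real] by simp
  show "real (card (A - A')) \<le> \<tau> * n" "real (card (B - B')) \<le> \<tau> * n"
    using assms by (auto simp: core_def)
qed

text \<open>Each \<open>w\<close> keeps \<eta> n / 2 neighbours in both parts of the core. By
  averaging, some \<open>y\<close> sees a fraction \<eta> / 2 of \<open>W\<close>, and some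
  \<open>x\<close> sees a fraction \<eta> / 2 of those; the core allows at most two, so |W| \<eta>^2
  / 4 \<le> 2.\<close>

lemma card_high_of_core:
  fixes \<eta> \<tau> :: real
  assumes core: "core W \<tau> A' B'" and W: "W \<subseteq> high \<eta>" and \<eta>: "\<eta> > 0" "\<eta> \<le> 1 / 4" "\<tau> \<le> \<eta> / 2"
  shows "card W * \<eta> ^ 2 \<le> 8"
proof (cases "W = {}")
  case False
  have sub: "A' \<subseteq> A" "B' \<subseteq> B" using core by (auto simp: core_def)
  have fin': "finite A'" "finite B'" "finite W"
    using sub fin W finite_high finite_subset by blast+
  have card': "card A' \<le> n" "card B' \<le> n"
    using card_mono[OF fin(1) sub(1)] card_mono[OF fin(2) sub(2)] n(1) by simp_all
  have \<tau>n: "\<tau> * n \<le> \<eta> / 2 * n" using \<eta>(3) n(2) by simp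
  have dA: "real (deg_in R A' w) \<ge> \<eta> / 2 * n" and dB: "real (deg_in R B' w) \<ge> \<eta> / 2 * n" if "w \<in> W" for w
    using high_deg[of w \<eta>] that W \<eta>(2) deg_in_core(1,2)[OF core, of w] deg_in_core(3,4)[OF core] \<tau>n by (auto simp: algebra_simps)
  have "real (card W) * (\<eta> / 2 * n) \<le> (\<Sum>w\<in>W. real (deg_in R B' w))"
    using sum_bounded_below[of W "\<eta> / 2 * n" "\<lambda>w. real (deg_in R B' w)"] dB by simp
  also have "\<dots> = (\<Sum>y\<in>B'. real (deg_in R W y))"
    using arg_cong[OF deg_in_swap[OF sym fin'(3,2)], where f = real] by simp
  finally have "(real (card W) * (\<eta> / 2)) * n \<le> (\<Sum>y\<in>B'. real (deg_in R W y))" by (simp add: mult_ac)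
  moreover have "real (card W) > 0" using False fin' by (simp add: card_gt_0_iff)
  ultimately obtain y where y: "y \<in> B'" "real (deg_in R W y) \<ge> real (card W) * (\<eta> / 2)"
    using averaging[OF fin'(2) card'(2), of "real (card W) * (\<eta> / 2)" "\<lambda>y. real (deg_in R W y)"] \<eta>(1) n(2) by auto
  define Q where "Q = {w \<in> W. R y w}"
  have Q: "finite Q" "real (card Q) \<ge> real (card W) * (\<eta> / 2)" "Q \<subseteq> W"
    using y fin' by (auto simp: Q_def deg_in_def)
  have "real (card W) * (\<eta> / 2) > 0" using \<open>real (card W) > 0\<close> \<eta>(1) by simp
  then have Q0: "real (card Q) > 0" using Q(2) by linarith
  have "real (card Q) * (\<eta> / 2 * n) \<le> (\<Sum>w\<in>Q. real (deg_in R A' w))"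
    using sum_bounded_below[of Q "\<eta> / 2 * n" "\<lambda>w. real (deg_in R A' w)"] dA Q(3) by auto
  also have "\<dots> = (\<Sum>x\<in>A'. real (deg_in R Q x))"
    using arg_cong[OF deg_in_swap[OF sym Q(1) fin'(1)], where f = real] by simp
  finally have "(real (card Q) * (\<eta> / 2)) * n \<le> (\<Sum>x\<in>A'. real (deg_in R Q x))" by (simp add: mult_ac)
  then obtain x where x: "x \<in> A'" "real (deg_in R Q x) \<ge> real (card Q) * (\<eta> / 2)"
    using averaging[OF fin'(1) card'(1), of "real (card Q) * (\<eta> / 2)" "\<lambda>x. real (deg_in R Q x)"] \<eta>(1) n(2) Q0 by auto
  have "{w \<in> Q. R x w} = {w \<in> W. R w x \<and> R w y}"
    using sympD[OF sym] by (auto simp: Q_def)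
  then have "deg_in R Q x \<le> 2" using core x(1) y(1) by (simp add: deg_in_def core_def)
  then have "real (card Q) * (\<eta> / 2) \<le> 2" using x(2) by linarith
  moreover have "real (card W) * (\<eta> / 2) * (\<eta> / 2) \<le> real (card Q) * (\<eta> / 2)"
    using Q(2) \<eta>(1) by (intro mult_right_mono) auto
  moreover have "card W * \<eta> ^ 2 = 4 * (real (card W) * (\<eta> / 2) * (\<eta> / 2))"
    by (simp add: power2_eq_square)
  ultimately show ?thesis by linarith
qed simp

text \<open>
  For \<open>x\<close> and \<open>y\<close> seen by the largest numbers \<open>p\<close> and \<open>q\<close> of vertices of \<open>W\<close> we have
  \<open>p + q \<le> |W| + 2\<close>; this bounds the total degree of \<open>W\<close>.
\<close>
lemma excess_of_core:
  fixes \<tau> :: real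
  assumes core: "core W \<tau> A' B'" and W: "W \<subseteq> A \<union> B" "W \<noteq> {}" and \<tau>: "\<tau> \<ge> 0"
  shows "(\<Sum>w\<in>W. d w - n / 2) + 2 * (n - card {v \<in> A \<union> B. \<exists>w\<in>W. R w v}) \<le> n + card W * (s + \<tau>) * n"
proof -
  let ?N = "{v \<in> A \<union> B. \<exists>w\<in>W. R w v}"
  have sub: "A' \<subseteq> A" "B' \<subseteq> B" using core by (auto simp: core_def)
  have fin': "finite A'" "finite B'" "finite W"
    using sub fin W finite_subset by blast+
  have k0: "card W \<noteq> 0" using W fin' by simp
  show ?thesis
  \<comment> \<open>For a single vertex the factor \<open>card W - 2\<close> below is negative;
    there \<open>d w \<ge> n / 2\<close> gives the claim directly.\<close>
  proof (cases "card W = 1")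
    case True
    then obtain w where w: "W = {w}" by (auto simp: card_1_singleton_iff)
    then have "real (card ?N) = d w" by (simp add: deg_in_def)
    moreover have "d w \<ge> n / 2" using W w min_deg by auto
    moreover have "(s + \<tau>) * n \<ge> 0" using s \<tau> n(2) by simp
    ultimately show ?thesis using w by simp
  next
    case False
    then have k: "real (card W) \<ge> 2" using k0 by simp
    let ?k = "real (card W)" and ?h = "(1 / 2 + s) * n"
    obtain p where p: "\<And>x. x \<in> A' \<Longrightarrow> deg_in R W x \<le> p" "p = 0 \<or> (\<exists>x\<in>A'. deg_in R W x = p)"
      using obtain_max_value[OF fin'(1)] by blast
    obtain q where q: "\<And>y. y \<in> B' \<Longrightarrow> deg_in R W y \<le> q" "q = 0 \<or> (\<exists>y\<in>B'. deg_in R W y = q)"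
      using obtain_max_value[OF fin'(2)] by blast
    have pk: "p \<le> card W" "q \<le> card W" using p(2) q(2) deg_in_le_card[OF fin'(3), of R] by auto
    have "p + q \<le> card W + 2"
    proof (cases "p = 0 \<or> q = 0")
      case True
      then show ?thesis using pk by auto
    next
      case False
      then obtain x y where xy: "x \<in> A'" "deg_in R W x = p" "y \<in> B'" "deg_in R W y = q"
        using p(2) q(2) by blast
      have "p + q = card {w \<in> W. R x w} + card {w \<in> W. R y w}"
        using xy by (simp add: deg_in_def)
      also have "\<dots> = card ({w \<in> W. R x w} \<union> {w \<in> W. R y w}) + card ({w \<in> W. R x w} \<inter> {w \<in> W. R y w})"
        using fin'(3) by (intro card_Un_Int) auto
      also have "{w \<in> W. R x w} \<inter> {w \<in> W. R y w} = {w \<in> W. R w x \<and> R w y}"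
        using sympD[OF sym] by auto
      also have "card \<dots> \<le> 2" using core xy by (simp add: core_def)
      also have "card ({w \<in> W. R x w} \<union> {w \<in> W. R y w}) \<le> card W"
        using fin'(3) by (intro card_mono) auto
      finally show ?thesis by simp
    qed
    then have pq: "real p + real q \<le> ?k + 2" "real p \<le> ?k" "real q \<le> ?k" using pk by linarith+
    define \<alpha> where "\<alpha> = real (card (A' \<inter> ?N))"
    define \<beta> where "\<beta> = real (card (B' \<inter> ?N))"
    have sumle: "(\<Sum>w\<in>W. real (deg_in R S w)) \<le> real r * card (S \<inter> ?N)"
      if S: "S \<subseteq> A \<union> B" "finite S" and r: "\<And>x. x \<in> S \<Longrightarrow> deg_in R W x \<le> r" for S r
    proof -
      have "(\<Sum>w\<in>W. deg_in R S w) = (\<Sum>x\<in>S. deg_in R W x)"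
        by (rule deg_in_swap[OF sym fin'(3) S(2)])
      also have "\<dots> = (\<Sum>x\<in>S \<inter> ?N. deg_in R W x)"
      proof (rule sum.mono_neutral_right[OF S(2)])
        have "deg_in R W x = 0" if "x \<in> S - S \<inter> ?N" for x
        proof -
          have "{w \<in> W. R x w} = {}" using that S(1) sympD[OF sym] by blast
          then show ?thesis unfolding deg_in_def by (metis card.empty)
        qed
        then show "\<forall>x\<in>S - S \<inter> ?N. deg_in R W x = 0" by blast
      qed auto
      also have "\<dots> \<le> of_nat (card (S \<inter> ?N)) * r"
        using r by (intro sum_bounded_above) auto
      finally have "(\<Sum>w\<in>W. deg_in R S w) \<le> r * card (S \<inter> ?N)" by (simp add: mult.commute)
      from of_nat_mono[OF this, where 'a = real] show ?thesis by simp
    qed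
    have sumA: "(\<Sum>w\<in>W. real (deg_in R A' w)) \<le> real p * \<alpha>"
      unfolding \<alpha>_def using sub p(1) fin'(1) by (intro sumle) auto
    have sumB: "(\<Sum>w\<in>W. real (deg_in R B' w)) \<le> real q * \<beta>"
      unfolding \<beta>_def using sub q(1) fin'(2) by (intro sumle) auto
    have "d w \<le> deg_in R A' w + (deg_in R B' w + \<tau> * n)" for w
    proof -
      have "real (card (A - A')) + card (B - B') \<le> \<tau> * n" using core by (simp add: core_def)
      then show ?thesis using deg_in_core(1,2)[OF core, of w] d_eq[of w] by linarith
    qed
    then have "(\<Sum>w\<in>W. d w) \<le> (\<Sum>w\<in>W. deg_in R A' w + (deg_in R B' w + \<tau> * n))"
      by (intro sum_mono) simp
    also have "\<dots> = (\<Sum>w\<in>W. real (deg_in R A' w)) + (\<Sum>w\<in>W. real (deg_in R B' w)) + ?k * (\<tau> * n)"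
      by (simp add: sum.distrib)
    also have "\<dots> \<le> real p * \<alpha> + real q * \<beta> + ?k * (\<tau> * n)" using sumA sumB by simp
    finally have 1: "(\<Sum>w\<in>W. d w) \<le> real p * \<alpha> + real q * \<beta> + ?k * (\<tau> * n)" .
    have "card (A' \<inter> ?N) \<le> card A" "card (B' \<inter> ?N) \<le> card B"
      using sub fin by (auto intro!: card_mono)
    then have ab: "0 \<le> \<alpha>" "0 \<le> \<beta>" "\<alpha> \<le> ?h" "\<beta> \<le> ?h" using sizeA sizeB unfolding \<alpha>_def \<beta>_def by auto
    have h0: "?h \<ge> 0" using s n(2) by simp
    \<comment> \<open>Subtracting 2 from each weight splits off 2 (\<alpha> + \<beta>), which is at
      most twice the size of the neighbourhood. The remaining weights add up to at most
      \<open>?k - 2\<close>, even if one of them is negative and is dropped.\<close>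
    have "(real p - 2) * \<alpha> + (real q - 2) * \<beta> \<le> (?k - 2) * ?h"
    proof (cases "real p \<ge> 2 \<and> real q \<ge> 2")
      case True
      then have "(real p - 2) * \<alpha> + (real q - 2) * \<beta> \<le> (real p - 2) * ?h + (real q - 2) * ?h"
        using ab by (intro add_mono mult_left_mono) auto
      also have "\<dots> = (real p + real q - 4) * ?h" by (simp add: algebra_simps)
      also have "\<dots> \<le> (?k - 2) * ?h" using pq h0 by (intro mult_right_mono) auto
      finally show ?thesis .
    next
      case False
      have le: "(real r - 2) * \<gamma> \<le> (?k - 2) * ?h" if "real r \<le> ?k" "0 \<le> \<gamma>" "\<gamma> \<le> ?h" for r \<gamma>
      proof -
        have "(real r - 2) * \<gamma> \<le> (?k - 2) * \<gamma>" using that by (intro mult_right_mono) auto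
        also have "\<dots> \<le> (?k - 2) * ?h" using that k by (intro mult_left_mono) auto
        finally show ?thesis .
      qed
      have neg: "(real r - 2) * \<gamma> \<le> 0" if "\<not> real r \<ge> 2" "0 \<le> \<gamma>" for r \<gamma>
        using that by (intro mult_nonpos_nonneg) auto
      show ?thesis
        using False le[OF pq(2) ab(1,3)] le[OF pq(3) ab(2,4)] neg[OF _ ab(1), of p] neg[OF _ ab(2), of q] by fastforce
    qed
    moreover have "\<alpha> + \<beta> \<le> card ?N"
    proof -
      have "card (A' \<inter> ?N) + card (B' \<inter> ?N) = card ((A' \<inter> ?N) \<union> (B' \<inter> ?N))"
        using fin' sub disj by (intro card_Un_disjoint[symmetric]) auto
      also have "\<dots> \<le> card ?N" using fin by (intro card_mono) auto
      finally show ?thesis unfolding \<alpha>_def \<beta>_def by linarith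
    qed
    ultimately have "(\<Sum>w\<in>W. d w) \<le> (?k - 2) * ?h + 2 * card ?N + ?k * (\<tau> * n)"
      using 1 by (simp add: algebra_simps)
    moreover have "(\<Sum>w\<in>W. d w - n / 2) = (\<Sum>w\<in>W. d w) - ?k * (n / 2)"
      by (simp add: sum_subtractf)
    moreover have "s * n \<ge> 0" using s n(2) by simp
    ultimately show ?thesis by (simp add: algebra_simps)
  qed
qed

end

text \<open>Edges with an end in the neighbourhood of some \<open>w\<close> are charged to that
  \<open>w\<close>; the others lie outside all these neighbourhoods.\<close>

lemma deg_sum_split_touching:
  assumes "finite S" "finite W"
  shows "deg_sum R S \<le> (\<Sum>w\<in>W. deg_sum (\<lambda>x y. R x y \<and> (R w x \<or> R w y)) S) + deg_sum R (S - {v. \<exists>w\<in>W. R w v})"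
proof -
  let ?N = "{v. \<exists>w\<in>W. R w v}" and ?T = "\<lambda>w x y. R x y \<and> (R w x \<or> R w y)"
  have le: "deg_in R S x \<le> (\<Sum>w\<in>W. deg_in (?T w) S x) + (if x \<in> S - ?N then deg_in R (S - ?N) x else 0)"
    if "x \<in> S" for x
  proof -
    have "{u \<in> S. R x u} \<subseteq> (\<Union>w\<in>W. {u \<in> S. ?T w x u}) \<union> {u \<in> S - ?N. x \<in> S - ?N \<and> R x u}"
      using that by auto
    then have "card {u \<in> S. R x u} \<le> card ((\<Union>w\<in>W. {u \<in> S. ?T w x u}) \<union> {u \<in> S - ?N. x \<in> S - ?N \<and> R x u})"
      using assms by (intro card_mono) auto
    also have "\<dots> \<le> card (\<Union>w\<in>W. {u \<in> S. ?T w x u}) + card {u \<in> S - ?N. x \<in> S - ?N \<and> R x u}"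
      by (rule card_Un_le)
    also have "card (\<Union>w\<in>W. {u \<in> S. ?T w x u}) \<le> (\<Sum>w\<in>W. card {u \<in> S. ?T w x u})"
      using assms(2) by (rule card_UN_le)
    also have "card {u \<in> S - ?N. x \<in> S - ?N \<and> R x u} = (if x \<in> S - ?N then deg_in R (S - ?N) x else 0)"
    proof (cases "x \<in> S - ?N")
      case True
      then show ?thesis by (simp add: deg_in_def)
    next
      case False
      then have "{u \<in> S - ?N. x \<in> S - ?N \<and> R x u} = {}" by blast
      then show ?thesis by (simp only: False if_False card.empty)
    qed
    finally show ?thesis unfolding deg_in_def by simp
  qed
  have "deg_sum R S \<le> (\<Sum>x\<in>S. (\<Sum>w\<in>W. deg_in (?T w) S x) + (if x \<in> S - ?N then deg_in R (S - ?N) x else 0))"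
    unfolding deg_sum_def using le by (rule sum_mono)
  also have "\<dots> = (\<Sum>w\<in>W. \<Sum>x\<in>S. deg_in (?T w) S x) + (\<Sum>x\<in>S - ?N. deg_in R (S - ?N) x)"
    using assms(1) sum.swap[of "\<lambda>x w. deg_in (?T w) S x" W S]
    by (simp add: sum.distrib sum.inter_filter[symmetric] set_diff_eq)
  finally show ?thesis unfolding deg_sum_def .
qed

section \<open>The edge count for a fixed pair of scales\<close>

context max_cut
begin

lemma high_swap: "max_cut.high R B A n \<eta> = high \<eta>"
  unfolding max_cut.high_def[OF swapped] high_def by (rule Un_commute)

text \<open>\<open>s \<le> \<eta> ^ 2\<close> turns Markov's bound into |high \<eta>| \<le> \<eta>
  n, so each class keeps nearly n / 2 vertices, well above \<open>11 * m\<close>.\<close>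

lemma low_almost_complete:
  fixes \<eta> :: real
  assumes \<eta>: "\<eta> > 0" "\<eta> \<le> 1 / 100" "s \<le> \<eta> ^ 2" and m1: "(\<eta> + s) * n \<ge> 1"
  shows "almost_complete R (A - high \<eta>) (B - high \<eta>) ((\<eta> + s) * n)"
proof -
  interpret swp: max_cut R B A n s by (rule swapped)
  have "\<eta> * card (high \<eta>) \<le> \<eta> * (\<eta> * n)"
  proof -
    have "s * n \<le> \<eta> ^ 2 * n" using \<eta>(3) n(2) by simp
    then show ?thesis using card_high[of \<eta>] by (simp add: power2_eq_square mult_ac)
  qed
  then have ch: "card (high \<eta>) \<le> \<eta> * n" using \<eta>(1) by simp
  have "\<eta> ^ 2 \<le> 1 / 100 * (1 / 100)"
    unfolding power2_eq_square using \<eta> by (intro mult_mono) auto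
  then have s': "s \<le> 1 / 10000" using \<eta>(3) by simp
  then have "s * n \<le> 1 / 10000 * n" "\<eta> * n \<le> 1 / 100 * n"
    using \<eta>(2) n(2) by (intro mult_right_mono; simp)+
  moreover have "11 * ((\<eta> + s) * n) = 11 * (\<eta> * n) + 11 * (s * n)" "(1 / 2 - s) * n = n / 2 - s * n"
    by (simp_all add: algebra_simps)
  ultimately have big: "(1 / 2 - s) * n - \<eta> * n \<ge> 11 * ((\<eta> + s) * n)"
    using n(2) by linarith
  have diff: "real (card (S - high \<eta>)) \<ge> real (card S) - card (high \<eta>)" for S
    using diff_card_le_card_Diff[OF finite_high, of S \<eta>] by linarith
  show ?thesis
  proof
    show "\<not> has_pyramid R (A - high \<eta> \<union> (B - high \<eta>))"
      using free has_pyramid_mono[of R _ "A \<union> B"] by blast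
    show "real (card {y \<in> B - high \<eta>. \<not> R x y}) \<le> (\<eta> + s) * n" if "x \<in> A - high \<eta>" for x
      using missing_le[OF that] card_mono[of "{y \<in> B. \<not> R x y}" "{y \<in> B - high \<eta>. \<not> R x y}"] fin by fastforce
    show "real (card {x \<in> A - high \<eta>. \<not> R y x}) \<le> (\<eta> + s) * n" if "y \<in> B - high \<eta>" for y
      using swp.missing_le[of y \<eta>] high_swap that card_mono[of "{x \<in> A. \<not> R y x}" "{x \<in> A - high \<eta>. \<not> R y x}"] fin by fastforce
    have "\<eta> * n \<le> (\<eta> + s) * n" using s n(2) by simp
    then show "real (deg_in R (A - high \<eta>) x) \<le> (\<eta> + s) * n" if "x \<in> A - high \<eta>" for x
      using that deg_in_mono[of "A - high \<eta>" A R x] fin unfolding high_def by fastforce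
    show "real (deg_in R (B - high \<eta>) y) \<le> (\<eta> + s) * n" if "y \<in> B - high \<eta>" for y
      using that deg_in_mono[of "B - high \<eta>" B R y] fin \<open>\<eta> * n \<le> (\<eta> + s) * n\<close> unfolding high_def by fastforce
    have c: "real (card A) \<ge> (1 / 2 - s) * n" "real (card B) \<ge> (1 / 2 - s) * n"
      using sizeA sizeB n(1) by (simp_all add: algebra_simps)
    show "11 * ((\<eta> + s) * n) \<le> real (card (A - high \<eta>))" using c(1) diff[of A] ch big by linarith
    show "11 * ((\<eta> + s) * n) \<le> real (card (B - high \<eta>))" using c(2) diff[of B] ch big by linarith
  qed (use sym irr fin disj m1 in auto)
qed

text \<open>Two scales enter: \<open>w\<close> has \<eta> n neighbours in \<open>B\<close>, enough
  against the \<open>6 * m + 3\<close> lost to missing pairs at the smaller scale. The bound is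
  \<open>4 * (3 - 1) * m\<close> from \<open>matching_exists\<close>, as three disjoint edges are
  excluded.\<close>

lemma deg_sum_touching_le:
  fixes \<eta> \<eta>' m :: real
  assumes ac: "almost_complete R (A - high \<eta>') (B - high \<eta>') m" and m: "m = (\<eta>' + s) * n"
    and \<eta>: "\<eta> \<le> 1 / 4" "\<eta>' \<le> \<eta>" "6 * m + 3 \<le> \<eta> * n" and w: "w \<in> high \<eta>"
  shows "deg_sum (\<lambda>x y. R x y \<and> (R w x \<or> R w y)) (A - high \<eta>') \<le> 8 * m"
proof (rule ccontr)
  let ?Q = "\<lambda>x y. R x y \<and> (R w x \<or> R w y)"
  interpret ac: almost_complete R "A - high \<eta>'" "B - high \<eta>'" m by (rule ac)
  assume "\<not> ?thesis"
  then have big: "deg_sum ?Q (A - high \<eta>') > 4 * (real 3 - 1) * m" by simp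
  have "symp ?Q" "irreflp ?Q" using sym irr unfolding symp_def irreflp_def by blast+
  moreover have "real (deg_in ?Q (A - high \<eta>') v) \<le> m" if "v \<in> A - high \<eta>'" for v
    using deg_in_le_deg_in[of "A - high \<eta>'" ?Q v R] ac.degA[OF that] ac.fin(1) by fastforce
  ultimately have "\<exists>M. matching ?Q (A - high \<eta>') M \<and> card M = 3"
    using ac.fin(1) big ac.m1 by (intro matching_exists[where D = m]) auto
  then obtain M where M: "matching ?Q (A - high \<eta>') M" "card M = 3" by blast
  let ?Y = "{y \<in> B. R w y}"
  have "has_pyramid R (insert w ((A - high \<eta>') \<union> ?Y))"
  proof (rule pyramid_of_centre_matching[OF sym irr, where m = m and M = M])
    show "matching R (A - high \<eta>') M" using M(1) unfolding matching_def by blast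
    show "R w p \<or> R w q" if "(p, q) \<in> M" for p q using matchingD(4)[OF M(1) that] by blast
    show "w \<notin> A - high \<eta>'" using w high_antimono[OF \<eta>(2)] by blast
    show "real (card {y \<in> ?Y. \<not> R x y}) \<le> m" if "x \<in> A - high \<eta>'" for x
      using missing_le[OF that] card_mono[of "{y \<in> B. \<not> R x y}" "{y \<in> ?Y. \<not> R x y}"] fin m by fastforce
    show "6 * m + 3 \<le> real (card ?Y)"
      using high_deg(2)[OF w \<eta>(1)] \<eta>(3) by (simp add: deg_in_def)
  qed (use M(2) fin disj in auto)
  moreover have "insert w ((A - high \<eta>') \<union> ?Y) \<subseteq> A \<union> B" using w high_subset by blast
  ultimately show False using free has_pyramid_mono by blast
qed

lemma deg_sum_le_touching:
  fixes \<eta> \<eta>' m :: real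
  assumes ac: "almost_complete R (A - high \<eta>') (B - high \<eta>') m" and m: "m = (\<eta>' + s) * n"
    and \<eta>: "\<eta> \<le> 1 / 4" "\<eta>' \<le> \<eta>" "6 * m + 3 \<le> \<eta> * n"
  shows "deg_sum R (A - high \<eta>') \<le> card (high \<eta>) * (8 * m) +
    4 * real (card (A - high \<eta>' - {v. \<exists>w\<in>high \<eta>. R w v}))"
proof -
  interpret ac: almost_complete R "A - high \<eta>'" "B - high \<eta>'" m by (rule ac)
  let ?S = "A - high \<eta>'" and ?N = "{v. \<exists>w\<in>high \<eta>. R w v}"
  have "real (deg_sum R ?S) \<le> (\<Sum>w\<in>high \<eta>. real (deg_sum (\<lambda>x y. R x y \<and> (R w x \<or> R w y)) ?S)) + deg_sum R (?S - ?N)"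
    using of_nat_mono[OF deg_sum_split_touching[OF ac.fin(1) finite_high, of R \<eta>], where 'a = real] by simp
  also have "\<dots> \<le> card (high \<eta>) * (8 * m) + deg_sum R (?S - ?N)"
    using deg_sum_touching_le[OF ac m \<eta>] by (intro add_right_mono sum_bounded_above) auto
  also have "deg_sum R (?S - ?N) \<le> 4 * real (card (?S - ?N))"
    using of_nat_mono[OF ac.sparse[of "?S - ?N"], where 'a = real] by auto
  finally show ?thesis by simp
qed

text \<open>The rest is compared with a balanced complete bipartite graph on n - |U| vertices.
  Expanding (n - |U|)^2 / 2 yields a term -n for each vertex of \<open>U\<close>, so a deleted
  vertex costs only its doubled excess over n / 2.\<close>

lemma deg_sum_accounting:
  assumes U: "U \<subseteq> A \<union> B"
  shows "deg_sum R (A \<union> B) \<le> n ^ 2 / 2 + real (card U) ^ 2 / 2 + (\<Sum>w\<in>U. 2 * d w - n)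
    + (real (deg_sum R (A - U)) + deg_sum R (B - U) - 2 * real (\<Sum>x\<in>A - U. card {y \<in> B - U. \<not> R x y}))"
proof -
  let ?A = "A - U" and ?B = "B - U"
  have fU: "finite U" "finite ?A" "finite ?B" "finite (?A \<union> ?B)" using U fin finite_subset by auto
  have d: "d u = real (deg_in R U u) + deg_in R (?A \<union> ?B) u" for u
  proof -
    have "deg_in R (U \<union> (?A \<union> ?B)) u = deg_in R U u + deg_in R (?A \<union> ?B) u"
      by (rule deg_in_Un[OF fU(1,4)]) auto
    moreover have "U \<union> (?A \<union> ?B) = A \<union> B" using U by auto
    ultimately show ?thesis by simp
  qed
  have "deg_sum R (A \<union> B) = deg_sum R (U \<union> (?A \<union> ?B))"
    using U by (intro arg_cong[where f = "deg_sum R"]) auto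
  also have "\<dots> = deg_sum R U + deg_sum R (?A \<union> ?B) + 2 * (\<Sum>u\<in>U. deg_in R (?A \<union> ?B) u)"
    by (rule deg_sum_Un[OF sym fU(1,4)]) auto
  finally have "real (deg_sum R (A \<union> B)) = (\<Sum>u\<in>U. real (deg_in R U u) + 2 * deg_in R (?A \<union> ?B) u) + deg_sum R (?A \<union> ?B)"
    by (simp add: deg_sum_def[of R U] sum.distrib sum_distrib_left)
  also have "(\<Sum>u\<in>U. real (deg_in R U u) + 2 * deg_in R (?A \<union> ?B) u) \<le> (\<Sum>u\<in>U. 2 * d u)"
    using d by (intro sum_mono) simp
  finally have 1: "real (deg_sum R (A \<union> B)) \<le> (\<Sum>u\<in>U. 2 * d u) + deg_sum R (?A \<union> ?B)" by simp
  have "deg_sum R (?A \<union> ?B) = deg_sum R ?A + deg_sum R ?B + 2 * (\<Sum>x\<in>?A. deg_in R ?B x)"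
    by (rule deg_sum_Un[OF sym fU(2,3)]) (use disj in auto)
  moreover have "(\<Sum>x\<in>?A. deg_in R ?B x) + (\<Sum>x\<in>?A. card {y \<in> ?B. \<not> R x y}) = card ?A * card ?B"
    by (simp only: sum.distrib[symmetric] deg_in_compl[OF fU(3)] sum_constant) simp
  ultimately have "deg_sum R (?A \<union> ?B) + 2 * (\<Sum>x\<in>?A. card {y \<in> ?B. \<not> R x y}) =
    deg_sum R ?A + deg_sum R ?B + 2 * (card ?A * card ?B)"
    by linarith
  from arg_cong[OF this, where f = real]
  have 2: "real (deg_sum R (?A \<union> ?B)) + 2 * real (\<Sum>x\<in>?A. card {y \<in> ?B. \<not> R x y}) =
    real (deg_sum R ?A) + deg_sum R ?B + 2 * (real (card ?A) * card ?B)" by simp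
  have "card A + card B = card (A \<union> B)" by (rule card_Un_disjoint[OF fin disj, symmetric])
  also have "\<dots> = card (U \<union> (?A \<union> ?B))" using U by (intro arg_cong[where f = card]) auto
  also have "\<dots> = card U + card (?A \<union> ?B)" using fU by (intro card_Un_disjoint) auto
  also have "card (?A \<union> ?B) = card ?A + card ?B" using fU disj by (intro card_Un_disjoint) auto
  finally have nk: "n - card U = real (card ?A) + card ?B" using n(1) by linarith
  have "0 \<le> (real (card ?A) - card ?B) ^ 2" by simp
  then have "2 * (real (card ?A) * card ?B) \<le> (n - card U) ^ 2 / 2"
    unfolding nk by (simp add: power2_eq_square algebra_simps)
  also have "\<dots> = n ^ 2 / 2 + real (card U) ^ 2 / 2 - card U * n"
    by (simp add: power2_eq_square algebra_simps add_divide_distrib diff_divide_distrib)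
  finally show ?thesis
    using 1 2 by (simp add: sum_subtractf)
qed

text \<open>All of \<open>high \<eta>'\<close> is deleted. If \<open>high \<eta>\<close> is empty,
  \<open>deg_sum_inner_le\<close> makes the missing pairs cancel. Otherwise the inner edges cost 4
  (n - |N|) up to errors, for the neighbourhood N of \<open>high \<eta>\<close>, and the doubled
  \<open>excess_of_core\<close> carries exactly this term on its left.\<close>

lemma one_scale:
  fixes \<eta> \<eta>' \<tau> \<rho> m k :: real
  assumes \<eta>: "0 < \<eta>" "\<eta> \<le> 1 / 4" "\<eta>' \<le> \<eta>" "0 < \<eta>'" "\<eta>' \<le> 1 / 100" "s \<le> \<eta>' ^ 2"
    and m: "m = (\<eta>' + s) * n" "m \<ge> 1" "6 * m + 3 \<le> \<eta> * n"
    and core: "core (high \<eta>) \<tau> A' B'" "\<tau> \<ge> 0" and k: "k = real (card (high \<eta>))"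
    and \<rho>: "(\<Sum>w\<in>high \<eta>' - high \<eta>. 2 * d w - n) \<le> \<rho> * n"
  shows "deg_sum R (A \<union> B) \<le> n ^ 2 / 2 + 2 * n + (real (card (high \<eta>')) ^ 2 / 2 + \<rho> * n +
    2 * k * (s + \<tau>) * n + 16 * m * k + 4 * s * n + 300 * m)"
proof -
  have ac: "almost_complete R (A - high \<eta>') (B - high \<eta>') m"
    unfolding m(1) using \<eta> m by (intro low_almost_complete) auto
  interpret ac: almost_complete R "A - high \<eta>'" "B - high \<eta>'" m by (rule ac)
  interpret swp: max_cut R B A n s by (rule swapped)
  let ?A = "A - high \<eta>'" and ?B = "B - high \<eta>'"
  let ?miss = "\<Sum>x\<in>?A. card {y \<in> ?B. \<not> R x y}"
  note acc = deg_sum_accounting[OF high_subset, of \<eta>']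
  have pos: "0 \<le> 2 * k * (s + \<tau>) * n" "0 \<le> 16 * m * k" "0 \<le> 4 * s * n" "0 \<le> 300 * m"
    using k s core(2) n(2) m(2) by simp_all
  show ?thesis
  proof (cases "high \<eta> = {}")
    case True
    have "real (card ?A) \<le> (1 / 2 + s) * n" "real (card ?B) \<le> (1 / 2 + s) * n"
      using sizeA sizeB card_mono[OF fin(1), of ?A] card_mono[OF fin(2), of ?B] by auto
    from ac.deg_sum_inner_le[OF this]
    have "real (deg_sum R ?A) + deg_sum R ?B - 2 * real ?miss \<le> 2 * n + 4 * s * n + 300 * m"
      unfolding ac.missing_def by (simp add: algebra_simps)
    moreover have "(\<Sum>w\<in>high \<eta>'. 2 * d w - n) \<le> \<rho> * n" using \<rho> True by simp
    ultimately show ?thesis using acc pos by linarith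
  next
    case False
    let ?N = "{v. \<exists>w\<in>high \<eta>. R w v}"
    let ?N' = "{v \<in> A \<union> B. \<exists>w\<in>high \<eta>. R w v}"
    have 1: "real (deg_sum R ?A) \<le> k * (8 * m) + 4 * real (card (?A - ?N))"
      using deg_sum_le_touching[OF ac m(1) \<eta>(2,3) m(3)] k by simp
    have "almost_complete R (B - swp.high \<eta>') (A - swp.high \<eta>') m"
      using ac.swapped by (simp add: high_swap)
    from swp.deg_sum_le_touching[OF this m(1) \<eta>(2,3) m(3)]
    have 2: "real (deg_sum R ?B) \<le> k * (8 * m) + 4 * real (card (?B - ?N))"
      using k by (simp add: high_swap)
    have 3: "(\<Sum>w\<in>high \<eta>. 2 * d w - n) + 4 * (n - card ?N') \<le> 2 * n + 2 * (k * (s + \<tau>) * n)"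
    proof -
      have "(\<Sum>w\<in>high \<eta>. 2 * d w - n) = 2 * (\<Sum>w\<in>high \<eta>. d w - n / 2)"
        by (simp add: sum_distrib_left right_diff_distrib)
      then show ?thesis
        using excess_of_core[OF core(1) high_subset False core(2)] k by simp
    qed
    have "card (?A - ?N) + card (?B - ?N) = card ((?A - ?N) \<union> (?B - ?N))"
      using fin disj by (intro card_Un_disjoint[symmetric]) auto
    also have "\<dots> \<le> card (A \<union> B - ?N')" using fin by (intro card_mono) auto
    also have "\<dots> = card (A \<union> B) - card ?N'" using fin by (intro card_Diff_subset) auto
    finally have "card (?A - ?N) + card (?B - ?N) \<le> card (A \<union> B) - card ?N'" .
    moreover have "card ?N' \<le> card (A \<union> B)" using fin by (intro card_mono) auto
    moreover have "real (card (A \<union> B)) = n" using card_Un_disjoint[OF fin disj] n(1) by simp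
    ultimately have 4: "real (card (?A - ?N)) + card (?B - ?N) \<le> n - card ?N'" by linarith
    have "(\<Sum>w\<in>high \<eta>'. 2 * d w - n) = (\<Sum>w\<in>high \<eta>' - high \<eta>. 2 * d w - n) + (\<Sum>w\<in>high \<eta>. 2 * d w - n)"
      by (rule sum.subset_diff[OF high_antimono[OF \<eta>(3)] finite_high])
    moreover have "0 \<le> real ?miss" by (rule of_nat_0_le_iff)
    ultimately show ?thesis
      using acc 1 2 3 4 \<rho> pos by (simp add: algebra_simps)
  qed
qed

end

section \<open>Two consecutive scales and the choice of constants\<close>

context max_cut
begin

text \<open>
  Among \<open>N\<close> scales \<open>e 0 > e 1 > \<dots>\<close> there are two consecutive ones between which the high vertices
  contribute little to the excess of the degrees over \<open>n / 2\<close>.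
\<close>
lemma deg_sum_le_scales:
  fixes e :: "nat \<Rightarrow> real" and \<epsilon> \<mu> \<tau> :: real and N K :: nat
  assumes \<epsilon>: "0 < \<epsilon>" "\<epsilon> < 1" and e: "e 0 = 1 / 4" "\<And>i. e (Suc i) = \<epsilon> * e i ^ 2 / 4000"
    and N: "real N \<ge> 24 / \<epsilon>" and K: "real K * e N ^ 2 > 8"
    and \<tau>: "0 < \<tau>" "\<tau> \<le> e N / 2" "32 * real K * \<tau> \<le> \<epsilon>"
    and \<mu>: "0 < \<mu>" "32 * real K ^ 3 * \<mu> \<le> \<tau>"
    and s': "s \<le> \<mu>" "4 * s \<le> \<tau> * \<mu>" "s \<le> e N ^ 2" "32 * s \<le> \<epsilon>" "s \<le> \<tau>"
    and n': "e N * n \<ge> 6" "28 * real K ^ 3 \<le> \<tau> * n" "4 * real K ^ 2 \<le> \<epsilon> * n"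
  shows "deg_sum R (A \<union> B) \<le> n ^ 2 / 2 + (2 + \<epsilon>) * n"
proof -
  have epos: "0 < e i" for i by (induction i) (simp_all add: e \<epsilon>(1))
  have step: "e (Suc i) \<le> e i / 16000" if "e i \<le> 1 / 4" for i
  proof -
    have "\<epsilon> * e i ^ 2 \<le> 1 * (e i * (1 / 4))"
      unfolding power2_eq_square using \<epsilon> epos[of i] that by (intro mult_mono) auto
    then show ?thesis unfolding e(2) by simp
  qed
  have e4: "e i \<le> 1 / 4" for i
  proof (induction i)
    case (Suc i)
    then show ?case using step[of i] epos[of i] by linarith
  qed (simp add: e)
  have step: "e (Suc i) \<le> e i / 16000" for i using step e4 by blast
  have anti: "e j \<le> e i" if "i \<le> j" for i j
  proof (rule lift_Suc_antimono_le[OF _ that])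
    show "e (Suc l) \<le> e l" for l using step[of l] epos[of l] by linarith
  qed
  have core_ex: "\<exists>A' B'. core W \<tau> A' B'" if W: "W \<subseteq> A \<union> B" "card W \<le> K" for W
  proof -
    have "s / \<mu> \<le> \<tau> / 4" using s'(2) \<mu>(1) by (simp add: field_simps)
    then have 1: "s / \<mu> * n \<le> \<tau> / 4 * n" using n(2) by (intro mult_right_mono) auto
    have "real K ^ 3 * (4 * (\<mu> + s)) \<le> real K ^ 3 * (8 * \<mu>)" using s'(1) by (intro mult_left_mono) auto
    also have "\<dots> \<le> \<tau> / 4" using \<mu>(2) by simp
    finally have 2: "real K ^ 3 * (4 * (\<mu> + s)) * n \<le> \<tau> / 4 * n" using n(2) by (intro mult_right_mono) auto
    have 3: "real K ^ 3 * (4 * ((\<mu> + s) * n) + 7) = real K ^ 3 * (4 * (\<mu> + s)) * n + 7 * real K ^ 3"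
      by (simp add: algebra_simps)
    have "s / \<mu> * n + real K ^ 3 * (4 * ((\<mu> + s) * n) + 7) \<le> \<tau> * n"
      unfolding 3 using 1 2 n'(2) mult_pos_pos[OF \<tau>(1) n(2)] by linarith
    from core_exists[OF W \<mu>(1) this] show ?thesis by blast
  qed
  \<comment> \<open>A core is available only for sets of at most \<open>K\<close> vertices, so a
    subset of exactly \<open>K\<close> high vertices is tested, and \<open>K * e N ^ 2 > 8\<close>
    refutes it.\<close>
  have cN: "card (high (e N)) \<le> K"
  proof (rule ccontr)
    assume "\<not> ?thesis"
    then have "K \<le> card (high (e N))" by simp
    then obtain W where W: "W \<subseteq> high (e N)" "card W = K" by (rule obtain_subset_with_card_n)
    obtain A' B' where "core W \<tau> A' B'" using core_ex[of W] W high_subset by blast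
    from card_high_of_core[OF this W(1) epos e4 \<tau>(2)] show False using K W(2) by simp
  qed
  have sub: "high (e i) \<subseteq> high (e N)" if "i \<le> N" for i by (rule high_antimono[OF anti[OF that]])
  have cK: "card (high (e i)) \<le> K" if "i \<le> N" for i
    using card_mono[OF finite_high sub[OF that]] cN by simp
  have \<tau>s: "0 \<le> s + \<tau>" "real K * (s + \<tau>) \<le> \<epsilon> / 16"
  proof -
    have "real K * (s + \<tau>) \<le> real K * (2 * \<tau>)" using s'(5) by (intro mult_left_mono) auto
    then show "real K * (s + \<tau>) \<le> \<epsilon> / 16" using \<tau>(3) by simp
  qed (use s \<tau>(1) in simp)
  have ks: "real (card (high (e i))) * (s + \<tau>) * n \<le> \<epsilon> / 16 * n" if "i \<le> N" for i
  proof -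
    have "real (card (high (e i))) * (s + \<tau>) \<le> real K * (s + \<tau>)"
      using cK[OF that] \<tau>s(1) by (intro mult_right_mono) auto
    then have "real (card (high (e i))) * (s + \<tau>) \<le> \<epsilon> / 16" using \<tau>s(2) by linarith
    then show ?thesis using n(2) by (intro mult_right_mono) auto
  qed
  define S where "S i = (\<Sum>w\<in>high (e i). 2 * d w - n)" for i
  have S0: "S 0 \<ge> 0"
    unfolding S_def using min_deg high_subset[of "e 0"] by (intro sum_nonneg) (auto simp: field_simps)
  \<comment> \<open>The neighbourhood has at most n vertices, so \<open>excess_of_core\<close> gives
    at most 2 n + \<epsilon> n / 8.\<close>
  have SN: "S N < 3 * n"
  proof (cases "high (e N) = {}")
    case False
    obtain A' B' where core: "core (high (e N)) \<tau> A' B'" using core_ex[OF high_subset cN] by blast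
    have "card {v \<in> A \<union> B. \<exists>w\<in>high (e N). R w v} \<le> card (A \<union> B)" using fin by (intro card_mono) auto
    then have "real (card {v \<in> A \<union> B. \<exists>w\<in>high (e N). R w v}) \<le> n"
      using card_Un_disjoint[OF fin disj] n(1) by simp
    then have "(\<Sum>w\<in>high (e N). d w - n / 2) \<le> n + \<epsilon> / 16 * n"
      using excess_of_core[OF core high_subset False] \<tau>(1) ks[of N] by simp
    moreover have "S N = 2 * (\<Sum>w\<in>high (e N). d w - n / 2)"
      unfolding S_def by (simp add: sum_distrib_left right_diff_distrib)
    moreover have "\<epsilon> * n < n" using \<epsilon> n(2) by simp
    ultimately show ?thesis using n(2) by linarith
  qed (use n(2) in \<open>simp add: S_def\<close>)
  \<comment> \<open>The increments of \<open>S\<close> sum to less than 3 n, and there are at least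
    24 / \<epsilon> of them.\<close>
  have "\<exists>i<N. S (Suc i) - S i \<le> \<epsilon> / 8 * n"
  proof (rule ccontr)
    assume "\<not> ?thesis"
    then have "(\<Sum>i<N. \<epsilon> / 8 * n) \<le> (\<Sum>i<N. S (Suc i) - S i)" by (intro sum_mono) force
    also have "\<dots> = S N - S 0" by (rule sum_lessThan_telescope)
    finally have "real N * (\<epsilon> / 8) * n \<le> S N" using S0 by simp
    moreover have "3 * n \<le> real N * (\<epsilon> / 8) * n"
      using N \<epsilon>(1) n(2) by (intro mult_right_mono) (auto simp: field_simps)
    ultimately show False using SN by linarith
  qed
  then obtain i where i: "i < N" "S (Suc i) - S i \<le> \<epsilon> / 8 * n" by blast
  define \<eta> where "\<eta> = e i"
  define \<eta>' where "\<eta>' = e (Suc i)"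
  define k where "k = real (card (high \<eta>))"
  define m where "m = (\<eta>' + s) * n"
  have \<eta>: "0 < \<eta>" "\<eta> \<le> 1 / 4" "0 < \<eta>'" "\<eta>' \<le> \<eta> / 16000" "\<eta>' = \<epsilon> * \<eta> ^ 2 / 4000" "e N \<le> \<eta>'" "e N \<le> \<eta>"
    unfolding \<eta>_def \<eta>'_def by (rule epos e4 step e(2) anti; use i(1) in simp)+
  have sN: "s \<le> \<eta>' ^ 2" using s'(3) power_mono[OF \<eta>(6), of 2] epos[of N] by linarith
  have "\<eta>' ^ 2 \<le> \<eta>'" unfolding power2_eq_square using \<eta> by (intro mult_left_le) auto
  then have "\<eta>' + s \<le> 2 * \<eta>'" using sN by simp
  then have m2: "m \<le> 2 * \<eta>' * n" unfolding m_def using n(2) by (intro mult_right_mono) auto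
  have "e N * n \<le> \<eta>' * n" "e N * n \<le> \<eta> * n" using \<eta> n(2) by (intro mult_right_mono; simp)+
  then have en: "6 \<le> \<eta>' * n" "6 \<le> \<eta> * n" using n'(1) by linarith+
  have \<eta>n: "\<eta>' * n \<le> \<eta> / 16000 * n" using \<eta> n(2) by (intro mult_right_mono) auto
  have m1: "m \<ge> 1" unfolding m_def distrib_right using en(1) s n(2) by (smt (verit) mult_pos_pos)
  have m6: "6 * m + 3 \<le> \<eta> * n" using m2 en(2) \<eta>n by simp
  obtain A' B' where core: "core (high \<eta>) \<tau> A' B'"
    using core_ex[OF high_subset cK[of i]] i(1) unfolding \<eta>_def by auto
  have k8: "k * \<eta> ^ 2 \<le> 8"
    unfolding k_def using \<eta> \<tau>(2) by (intro card_high_of_core[OF core]) auto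
  have "S (Suc i) = (\<Sum>w\<in>high \<eta>' - high \<eta>. 2 * d w - n) + S i"
    unfolding S_def \<eta>_def \<eta>'_def
    by (rule sum.subset_diff[OF high_antimono finite_high]) (simp add: anti)
  then have \<rho>: "(\<Sum>w\<in>high \<eta>' - high \<eta>. 2 * d w - n) \<le> \<epsilon> / 8 * n" using i(2) by simp
  have "\<eta>' \<le> \<eta>" "\<eta>' \<le> 1 / 100" using \<eta> by linarith+
  from one_scale[OF \<eta>(1,2) this(1) \<eta>(3) this(2) sN m_def m1 m6 core _ k_def \<rho>] \<tau>(1)
  have main: "deg_sum R (A \<union> B) \<le> n ^ 2 / 2 + 2 * n + (real (card (high \<eta>')) ^ 2 / 2 + \<epsilon> / 8 * n +
    2 * k * (s + \<tau>) * n + 16 * m * k + 4 * s * n + 300 * m)" by simp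
  have "real (card (high \<eta>')) ^ 2 \<le> real K ^ 2"
    using cK[of "Suc i"] i(1) unfolding \<eta>'_def by (intro power_mono) auto
  then have t1: "real (card (high \<eta>')) ^ 2 / 2 \<le> \<epsilon> / 8 * n" using n'(3) by linarith
  have t2: "2 * k * (s + \<tau>) * n \<le> \<epsilon> / 8 * n"
    using ks[of i] i(1) unfolding k_def \<eta>_def by simp
  \<comment> \<open>This term dictates the recursion of \<open>e\<close>: with
    \<open>k \<le> 8 / \<eta> ^ 2\<close> and \<open>m \<le> 2 * \<eta>' * n\<close> it is at most
    256 \<eta>' n / \<eta>^2, so \<eta>' must be a small multiple of \<epsilon> \<eta>^2.\<close>
  have "16 * m * k \<le> 16 * (2 * \<eta>' * n) * k" using m2 unfolding k_def by (intro mult_right_mono mult_left_mono) auto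
  also have "\<dots> = \<epsilon> * n * (k * \<eta> ^ 2) / 125" unfolding \<eta>(5) by simp
  also have "\<dots> \<le> \<epsilon> * n * 8 / 125" using k8 \<epsilon>(1) n(2) by (intro divide_right_mono mult_left_mono) auto
  also have "\<dots> \<le> \<epsilon> / 8 * n" using \<epsilon>(1) n(2) by simp
  finally have t3: "16 * m * k \<le> \<epsilon> / 8 * n" .
  have t4: "4 * s * n \<le> \<epsilon> / 8 * n" using s'(4) n(2) by (intro mult_right_mono) auto
  have "\<eta> ^ 2 \<le> 1 / 4 * (1 / 4)" unfolding power2_eq_square using \<eta> by (intro mult_mono) auto
  then have "\<epsilon> * \<eta> ^ 2 \<le> \<epsilon> * (1 / 16)" using \<epsilon>(1) by (intro mult_left_mono) auto
  then have "600 * \<eta>' \<le> \<epsilon> / 8" unfolding \<eta>(5) using \<epsilon>(1) by simp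
  then have "600 * \<eta>' * n \<le> \<epsilon> / 8 * n" using n(2) by (intro mult_right_mono) auto
  then have t5: "300 * m \<le> \<epsilon> / 8 * n" using m2 by simp
  \<comment> \<open>There are six error terms, each at most \<epsilon> n / 8.\<close>
  have "\<epsilon> * n > 0" using \<epsilon>(1) n(2) by simp
  then show ?thesis using main t1 t2 t3 t4 t5 by (simp add: algebra_simps)
qed

end

text \<open>Each constant depends only on earlier ones: \<epsilon>, the scales \<open>e\<close>,
  their number \<open>N\<close>, the bound \<open>K\<close> on high vertices, the loss \<tau> of a
  core, the threshold \<mu> inside \<open>core_exists\<close>, then \<open>s\<close>, and finally
  \<open>n\<^sub>0\<close>.\<close>

lemma max_cut_bound:
  fixes \<epsilon> :: real
  assumes \<epsilon>: "0 < \<epsilon>" "\<epsilon> < 1"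
  obtains s n\<^sub>0 :: real where "s > 0" "\<And>(R :: 'a \<Rightarrow> 'a \<Rightarrow> bool) A B n. max_cut R A B n s \<Longrightarrow> n \<ge> n\<^sub>0 \<Longrightarrow>
    deg_sum R (A \<union> B) \<le> n ^ 2 / 2 + (2 + \<epsilon>) * n"
proof -
  define e where "e = rec_nat (1 / 4) (\<lambda>_ x :: real. \<epsilon> * x ^ 2 / 4000)"
  have e: "e 0 = 1 / 4" "\<And>i. e (Suc i) = \<epsilon> * e i ^ 2 / 4000" by (simp_all add: e_def)
  have epos: "0 < e i" for i by (induction i) (simp_all add: e \<epsilon>(1))
  obtain N :: nat where N: "real N \<ge> 24 / \<epsilon>" using real_arch_simple by blast
  obtain K :: nat where K: "real K > 8 / e N ^ 2" using reals_Archimedean2 by blast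
  have "8 / e N ^ 2 > 0" using epos[of N] by simp
  then have K0: "real K > 0" using K by linarith
  have K8: "real K * e N ^ 2 > 8" using K epos[of N] by (simp add: field_simps)
  define \<tau> where "\<tau> = min (e N / 2) (\<epsilon> / (32 * real K))"
  have \<tau>: "0 < \<tau>" "\<tau> \<le> e N / 2" using epos[of N] \<epsilon> K0 by (auto simp: \<tau>_def)
  have "\<tau> \<le> \<epsilon> / (32 * real K)" by (simp add: \<tau>_def)
  then have \<tau>3: "32 * real K * \<tau> \<le> \<epsilon>" using K0 by (simp add: pos_le_divide_eq mult.commute)
  define \<mu> where "\<mu> = \<tau> / (32 * real K ^ 3)"
  have \<mu>: "0 < \<mu>" "32 * real K ^ 3 * \<mu> \<le> \<tau>" using \<tau>(1) K0 by (auto simp: \<mu>_def)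
  define s where "s = Min {\<mu>, \<tau> * \<mu> / 4, e N ^ 2, \<epsilon> / 32, \<tau>}"
  have s: "s > 0" "s \<le> \<mu>" "4 * s \<le> \<tau> * \<mu>" "s \<le> e N ^ 2" "32 * s \<le> \<epsilon>" "s \<le> \<tau>"
    using \<mu>(1) \<tau>(1) \<epsilon>(1) epos[of N] unfolding s_def by auto
  define n\<^sub>0 where "n\<^sub>0 = Max {6 / e N, 28 * real K ^ 3 / \<tau>, 4 * real K ^ 2 / \<epsilon>}"
  show thesis
  proof (rule that[of s n\<^sub>0, OF s(1)])
    fix R :: "'a \<Rightarrow> 'a \<Rightarrow> bool" and A B and n :: real
    assume cut: "max_cut R A B n s" and n: "n \<ge> n\<^sub>0"
    have "n \<ge> 6 / e N" "n \<ge> 28 * real K ^ 3 / \<tau>" "n \<ge> 4 * real K ^ 2 / \<epsilon>"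
      using n unfolding n\<^sub>0_def by auto
    then have "e N * n \<ge> 6" "28 * real K ^ 3 \<le> \<tau> * n" "4 * real K ^ 2 \<le> \<epsilon> * n"
      using epos[of N] \<tau>(1) \<epsilon>(1) by (simp_all add: field_simps)
    then show "deg_sum R (A \<union> B) \<le> n ^ 2 / 2 + (2 + \<epsilon>) * n"
      using max_cut.deg_sum_le_scales[OF cut \<epsilon> e N K8 \<tau> \<tau>3 \<mu> s(2-6)] by blast
  qed
qed

lemma min_degree_bound:
  fixes \<epsilon> :: real
  assumes \<epsilon>: "0 < \<epsilon>" "\<epsilon> < 1"
  obtains n\<^sub>0 :: nat where "\<And>(R :: 'a \<Rightarrow> 'a \<Rightarrow> bool) V. symp R \<Longrightarrow> irreflp R \<Longrightarrow> finite V \<Longrightarrow> \<not> has_pyramid R V \<Longrightarrow>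
    (\<And>v. v \<in> V \<Longrightarrow> deg_in R V v \<ge> card V / 2) \<Longrightarrow> card V \<ge> n\<^sub>0 \<Longrightarrow>
    deg_sum R V \<le> real (card V) ^ 2 / 2 + (2 + \<epsilon>) * card V"
proof -
  obtain s n\<^sub>1 :: real where s: "s > 0" and bound: "\<And>(R :: 'a \<Rightarrow> 'a \<Rightarrow> bool) A B n. max_cut R A B n s \<Longrightarrow>
    n \<ge> n\<^sub>1 \<Longrightarrow> deg_sum R (A \<union> B) \<le> n ^ 2 / 2 + (2 + \<epsilon>) * n"
    using max_cut_bound[OF \<epsilon>] by blast
  \<comment> \<open>The 7 is that of \<open>almost_bipartite\<close>; \<open>7 * c \<le> s\<close>
    controls the inner edges and \<open>7 * c \<le> s ^ 2\<close> the square of the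
    imbalance.\<close>
  define c where "c = min s 1 ^ 2 / 7"
  have "min s 1 ^ 2 \<le> s" "min s 1 ^ 2 \<le> s ^ 2"
  proof -
    have "min s 1 ^ 2 \<le> s * 1" unfolding power2_eq_square using s by (intro mult_mono) auto
    then show "min s 1 ^ 2 \<le> s" by simp
  qed (use s in \<open>auto intro: power_mono\<close>)
  then have c: "c > 0" "7 * c \<le> s" "7 * c \<le> s ^ 2" using s by (auto simp: c_def)
  obtain n\<^sub>2 :: nat where n\<^sub>2: "real n\<^sub>2 > max (max n\<^sub>1 (18 / c ^ 64)) 0" using reals_Archimedean2 by blast
  show thesis
  proof (rule that[of n\<^sub>2])
    fix R :: "'a \<Rightarrow> 'a \<Rightarrow> bool" and V
    assume R: "symp R" "irreflp R" and V: "finite V" and free: "\<not> has_pyramid R V"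
      and deg: "\<And>v. v \<in> V \<Longrightarrow> deg_in R V v \<ge> card V / 2" and nV: "card V \<ge> n\<^sub>2"
    let ?n = "real (card V)"
    have n: "?n \<ge> n\<^sub>1" "?n > 18 / c ^ 64" "?n > 0" using nV n\<^sub>2 by linarith+
    have V0: "V \<noteq> {}" using n(3) by auto
    have "c ^ 64 * ?n > 18" using n(2) c(1) by (simp add: field_simps)
    then have "(\<Sum>x\<in>V. deg_sum R {y \<in> V. R x y}) \<le> c * ?n ^ 3"
      using has_pyramid_of_many_triangles[OF R V, of c] free c(1) card_triangles[OF V, of R] by fastforce
    from almost_bipartite[OF R(1) V V0 _ deg this] obtain A0 where
      A0: "A0 \<subseteq> V" "deg_sum R A0 + deg_sum R (V - A0) \<le> 7 * c * ?n ^ 2" using c(1) by auto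
    obtain A B where cut: "A \<union> B = V" "A \<inter> B = {}"
      "deg_sum R A + deg_sum R B \<le> deg_sum R A0 + deg_sum R (V - A0)"
      "\<And>v. v \<in> A \<Longrightarrow> deg_in R A v \<le> deg_in R B v" "\<And>v. v \<in> B \<Longrightarrow> deg_in R B v \<le> deg_in R A v"
      using obtain_max_cut[OF R V A0(1)] by blast
    have fin: "finite A" "finite B" using cut(1) V by auto
    have nAB: "?n = real (card A) + real (card B)" using card_Un_disjoint[OF fin cut(2)] cut(1) by simp
    have inner: "real (deg_sum R A + deg_sum R B) \<le> 7 * c * ?n ^ 2" using A0(2) cut(3) by linarith
    \<comment> \<open>Nearly all edges cross the cut, so |A| |B| is almost n^2 / 4; the deficit is
      the square of |A| - n / 2.\<close>
    have "?n * (?n / 2) \<le> (\<Sum>v\<in>V. real (deg_in R V v))"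
      using sum_bounded_below[of V "?n / 2" "\<lambda>v. real (deg_in R V v)"] deg by simp
    also have "\<dots> = real (deg_sum R V)" by (simp add: deg_sum_def)
    also have "deg_sum R V = deg_sum R A + deg_sum R B + 2 * (\<Sum>x\<in>A. deg_in R B x)"
      using deg_sum_Un[OF R(1) fin cut(2)] cut(1) by simp
    also have "(\<Sum>x\<in>A. deg_in R B x) \<le> of_nat (card A) * card B"
      using deg_in_le_card[OF fin(2)] by (intro sum_bounded_above) auto
    finally have "?n * (?n / 2) \<le> 7 * c * ?n ^ 2 + 2 * (real (card A) * card B)" using inner by simp
    then have AB: "real (card A) * card B \<ge> ?n ^ 2 / 4 - s ^ 2 * ?n ^ 2 / 2"
      using mult_right_mono[OF c(3), of "?n ^ 2"] by (simp add: power2_eq_square)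
    have size: "real (card X) \<le> (1 / 2 + s) * ?n" if X: "real (card X) * (?n - card X) \<ge> ?n ^ 2 / 4 - s ^ 2 * ?n ^ 2 / 2" for X :: "'a set"
    proof -
      have "(real (card X) - ?n / 2) ^ 2 \<le> (s * ?n) ^ 2"
        using X zero_le_power2[of "s * ?n"] by (simp add: power2_eq_square algebra_simps)
      then have "real (card X) - ?n / 2 \<le> s * ?n"
        by (rule power2_le_imp_le) (use s n(3) in simp)
      then show ?thesis by (simp add: algebra_simps)
    qed
    have "max_cut R A B ?n s"
    proof
      show "real (card A) \<le> (1 / 2 + s) * ?n" by (rule size) (use AB nAB in simp)
      show "real (card B) \<le> (1 / 2 + s) * ?n" by (rule size) (use AB nAB in \<open>simp add: mult.commute\<close>)
      show "real (deg_sum R A + deg_sum R B) \<le> s * ?n ^ 2"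
        using inner mult_right_mono[OF c(2), of "?n ^ 2"] by simp
    qed (use R fin cut free nAB n(3) s deg in auto)
    from bound[OF this n(1)] show "deg_sum R V \<le> ?n ^ 2 / 2 + (2 + \<epsilon>) * card V"
      using cut(1) by simp
  qed
qed

text \<open>Deleting a vertex of degree below n / 2 loses less than n, while the claimed bound drops
  by n - 1 / 2 + 2 + \<epsilon>. The deletion is therefore safe, and \<open>C\<close> absorbs all
  graphs below the threshold.\<close>

lemma pyramid_free_bound:
  fixes \<epsilon> :: real
  assumes \<epsilon>: "0 < \<epsilon>" "\<epsilon> < 1"
  obtains C :: real where "\<And>(R :: 'a \<Rightarrow> 'a \<Rightarrow> bool) V. symp R \<Longrightarrow> irreflp R \<Longrightarrow> finite V \<Longrightarrow> \<not> has_pyramid R V \<Longrightarrow>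
    deg_sum R V \<le> real (card V) ^ 2 / 2 + (2 + \<epsilon>) * card V + C"
proof -
  obtain n\<^sub>0 :: nat where n\<^sub>0: "\<And>(R :: 'a \<Rightarrow> 'a \<Rightarrow> bool) V. symp R \<Longrightarrow> irreflp R \<Longrightarrow> finite V \<Longrightarrow> \<not> has_pyramid R V \<Longrightarrow>
    (\<And>v. v \<in> V \<Longrightarrow> deg_in R V v \<ge> card V / 2) \<Longrightarrow> card V \<ge> n\<^sub>0 \<Longrightarrow>
    deg_sum R V \<le> real (card V) ^ 2 / 2 + (2 + \<epsilon>) * card V"
    using min_degree_bound[OF \<epsilon>] by blast
  show thesis
  proof (rule that[of "real n\<^sub>0 ^ 2"])
    fix R :: "'a \<Rightarrow> 'a \<Rightarrow> bool" and V
    assume R: "symp R" "irreflp R" and V: "finite V" "\<not> has_pyramid R V"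
    show "deg_sum R V \<le> real (card V) ^ 2 / 2 + (2 + \<epsilon>) * card V + real n\<^sub>0 ^ 2"
      using V
    proof (induction V rule: finite_psubset_induct)
      case (psubset V)
      let ?n = "real (card V)"
      consider (small) "card V < n\<^sub>0" | (deg) "card V \<ge> n\<^sub>0" "\<And>v. v \<in> V \<Longrightarrow> deg_in R V v \<ge> ?n / 2"
        | (low) v where "v \<in> V" "deg_in R V v < ?n / 2"
        by force
      then show ?case
      proof cases
        case small
        have "deg_sum R V \<le> of_nat (card V) * card V"
          unfolding deg_sum_def using deg_in_le_card[OF psubset.hyps(1)] by (intro sum_bounded_above) auto
        also have "\<dots> \<le> n\<^sub>0 * n\<^sub>0" using small by (intro mult_mono) auto
        finally have "deg_sum R V \<le> n\<^sub>0 * n\<^sub>0" .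
        from of_nat_mono[OF this, where 'a = real]
        have "real (deg_sum R V) \<le> real n\<^sub>0 ^ 2" by (simp add: power2_eq_square)
        moreover have "0 \<le> ?n ^ 2 / 2 + (2 + \<epsilon>) * ?n" using \<epsilon>(1) by simp
        ultimately show ?thesis by linarith
      next
        case deg
        have "real (deg_sum R V) \<le> ?n ^ 2 / 2 + (2 + \<epsilon>) * ?n"
          by (rule n\<^sub>0[OF R psubset.hyps(1) psubset.prems deg(2,1)])
        then show ?thesis using zero_le_power2[of "real n\<^sub>0"] by linarith
      next
        case low
        have V': "finite (V - {v})" "\<not> has_pyramid R (V - {v})" "V - {v} \<subset> V"
          using psubset low(1) has_pyramid_mono[of R "V - {v}" V] by auto
        have cV: "real (card (V - {v})) = ?n - 1"
          using low(1) psubset.hyps(1) card_Suc_Diff1[of V v] by linarith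
        have "deg_sum R V = deg_sum R (V - {v}) + 2 * deg_in R (V - {v}) v"
          using deg_sum_insert[OF R V'(1), of v] low(1) by (simp add: insert_absorb)
        moreover have "deg_in R (V - {v}) v \<le> deg_in R V v"
          using psubset.hyps(1) by (intro deg_in_mono) auto
        ultimately have "real (deg_sum R V) \<le> deg_sum R (V - {v}) + ?n" using low(2) by linarith
        also have "real (deg_sum R (V - {v})) \<le> (?n - 1) ^ 2 / 2 + (2 + \<epsilon>) * (?n - 1) + real n\<^sub>0 ^ 2"
          using psubset.IH[OF V'(3,2)] cV by simp
        also have "(?n - 1) ^ 2 / 2 = ?n ^ 2 / 2 - ?n + 1 / 2"
          by (simp add: power2_eq_square algebra_simps diff_divide_distrib add_divide_distrib)
        finally show ?thesis using \<epsilon>(1) by (simp add: algebra_simps)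
      qed
    qed
  qed
qed

subsection \<open>The upper bound\<close>

lemma verts_pyramid_3:
  "verts (triangular_pyramid 3) = {(1,1), (2,1), (2,2), (3,1), (3,2), (3,3), (4,1), (4,2), (4,3), (4,4)}"
proof -
  have "(1 \<le> i \<and> i \<le> 3 + 1 \<and> 1 \<le> r \<and> r \<le> i) \<longleftrightarrow>
    (i, r) \<in> {(1,1), (2,1), (2,2), (3,1), (3,2), (3,3), (4,1), (4,2), (4,3), (4,4)}" for i r :: nat
    by simp presburger
  then show ?thesis
    unfolding triangular_pyramid_def fst_conv
    by (simp only: set_eq_iff split_paired_All mem_Collect_eq prod.case) blast
qed

lemma contains_copy_if_has_pyramid:
  assumes pyr: "has_pyramid (\<lambda>u v. {u, v} \<in> edges G) (verts G)"
  shows "contains_copy G (triangular_pyramid 3)"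
proof -
  obtain c h1 h2 h3 h4 h5 h6 k1 k2 k3 where
    D: "distinct [c, h1, h2, h3, h4, h5, h6, k1, k2, k3]" and
    V: "{c, h1, h2, h3, h4, h5, h6, k1, k2, k3} \<subseteq> verts G" and
    E: "{c, h1} \<in> edges G" "{c, h2} \<in> edges G" "{c, h3} \<in> edges G" "{c, h4} \<in> edges G"
      "{c, h5} \<in> edges G" "{c, h6} \<in> edges G" "{h1, h2} \<in> edges G" "{h2, h3} \<in> edges G"
      "{h3, h4} \<in> edges G" "{h4, h5} \<in> edges G" "{h5, h6} \<in> edges G" "{h6, h1} \<in> edges G"
      "{k1, h1} \<in> edges G" "{k1, h2} \<in> edges G" "{k2, h3} \<in> edges G" "{k2, h4} \<in> edges G"
      "{k3, h5} \<in> edges G" "{k3, h6} \<in> edges G"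
    using pyr unfolding has_pyramid_def by (elim exE conjE) (rule that)
  \<comment> \<open>The vertices row by row: rows \<open>1, ..., i - 1\<close> hold i (i - 1) / 2
    entries, whence the index in \<open>f\<close>.\<close>
  define l where "l = [k1, h1, h2, h6, c, h3, k3, h5, h4, k2]"
  define f where "f p = (case p of (i, r) \<Rightarrow> l ! (i * (i - 1) div 2 + (r - 1)))" for p :: "nat \<times> nat"
  have f: "f (1,1) = k1" "f (2,1) = h1" "f (2,2) = h2" "f (3,1) = h6" "f (3,2) = c" "f (3,3) = h3"
    "f (4,1) = k3" "f (4,2) = h5" "f (4,3) = h4" "f (4,4) = k2"
    by (simp_all add: f_def l_def)
  have "f (2, Suc (Suc 0)) = h2" "f (3, Suc (Suc 0)) = c" "f (4, Suc (Suc 0)) = h5"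
    by (simp_all add: f_def l_def)
  note f' = f[unfolded One_nat_def] this
  have "inj_on f (verts (triangular_pyramid 3))"
    unfolding verts_pyramid_3 using D iffD2[OF distinct_rev D] by (simp add: f f')
  moreover have "f ` verts (triangular_pyramid 3) \<subseteq> verts G"
    unfolding verts_pyramid_3 using V by (simp add: f f')
  moreover have "f ` e \<in> edges G" if "e \<in> edges (triangular_pyramid 3)" for e
  proof -
    have cases: "(i = 2 \<and> r = 1) \<or> (i = 3 \<and> r = 1) \<or> (i = 3 \<and> r = 2) \<or> (i = 4 \<and> r = 1) \<or> (i = 4 \<and> r = 2) \<or> (i = 4 \<and> r = 3)"
      if "i \<le> 4" "1 \<le> r" "r \<le> i - 1" for i r :: nat
      using that by presburger
    from that consider
      (1) i r where "e = {(i, r), (i, r + 1)}" "i \<le> 4" "1 \<le> r" "r \<le> i - 1"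
      | (2) i r where "e = {(i - 1, r), (i, r)}" "i \<le> 4" "1 \<le> r" "r \<le> i - 1"
      | (3) i r where "e = {(i - 1, r), (i, r + 1)}" "i \<le> 4" "1 \<le> r" "r \<le> i - 1"
      unfolding triangular_pyramid_def by auto
    then show ?thesis
    proof cases
      case (1 i r)
      from cases[OF 1(2-4)] show ?thesis
        unfolding 1(1) using E by (elim disjE conjE) (simp_all add: f f' insert_commute)
    next
      case (2 i r)
      from cases[OF 2(2-4)] show ?thesis
        unfolding 2(1) using E by (elim disjE conjE) (simp_all add: f f' insert_commute)
    next
      case (3 i r)
      from cases[OF 3(2-4)] show ?thesis
        unfolding 3(1) using E by (elim disjE conjE) (simp_all add: f f' insert_commute)
    qed
  qed
  ultimately show ?thesis unfolding contains_copy_def by blast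
qed

text \<open>Handshake lemma, by double counting incidences.\<close>

lemma deg_sum_edges:
  assumes "simple_graph G"
  shows "deg_sum (\<lambda>u v. {u, v} \<in> edges G) (verts G) = 2 * card (edges G)"
proof -
  let ?R = "\<lambda>u v. {u, v} \<in> edges G"
  have fV: "finite (verts G)" and E: "edges G \<subseteq> [verts G]\<^bsup>2\<^esup>"
    using assms by (auto simp: simple_graph_def)
  have fE: "finite (edges G)" using finite_subset[OF E] fV by (simp add: finite_imp_finite_nsets)
  have edge: "e \<subseteq> verts G \<and> card e = 2" if "e \<in> edges G" for e
    using that E by (auto simp: nsets_def)
  have "deg_sum ?R (verts G) = (\<Sum>v\<in>verts G. card {e \<in> edges G. v \<in> e})"
    unfolding deg_sum_def deg_in_def
  proof (rule sum.cong[OF refl])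
    fix v assume "v \<in> verts G"
    show "card {u \<in> verts G. {v, u} \<in> edges G} = card {e \<in> edges G. v \<in> e}"
    proof (rule bij_betw_same_card[of "\<lambda>u. {v, u}"])
      have "\<exists>u\<in>{u \<in> verts G. {v, u} \<in> edges G}. e = {v, u}" if e: "e \<in> edges G" "v \<in> e" for e
      proof -
        obtain x y where "e = {x, y}" using edge[OF e(1)] unfolding card_2_iff by blast
        then obtain u where "e = {v, u}" using e(2) by (auto simp: insert_commute)
        then show ?thesis using e edge[OF e(1)] by blast
      qed
      then show "bij_betw (\<lambda>u. {v, u}) {u \<in> verts G. {v, u} \<in> edges G} {e \<in> edges G. v \<in> e}"
        unfolding bij_betw_def by (auto simp: inj_on_def doubleton_eq_iff)
    qed
  qed
  also have "\<dots> = (\<Sum>v\<in>verts G. \<Sum>e\<in>edges G. if v \<in> e then 1 else 0)"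
    using fE by (simp add: sum.If_cases Int_def)
  also have "\<dots> = (\<Sum>e\<in>edges G. \<Sum>v\<in>verts G. if v \<in> e then 1 else 0)"
    by (rule sum.swap)
  also have "\<dots> = (\<Sum>e\<in>edges G. 2)"
  proof (rule sum.cong[OF refl])
    fix e assume e: "e \<in> edges G"
    then have "{v \<in> verts G. v \<in> e} = e" using edge by blast
    then show "(\<Sum>v\<in>verts G. if v \<in> e then 1 else 0) = (2 :: nat)"
      using fV edge[OF e] by (simp add: sum.If_cases Int_def)
  qed
  finally show ?thesis by simp
qed

lemma edges_triangular_pyramid_nonempty: "edges (triangular_pyramid 3) \<noteq> {}"
  using card_edges_triangular_pyramid_3 by (metis card.empty zero_neq_numeral)

lemma ex_upper_bound:
  fixes \<epsilon> :: real
  assumes "0 < \<epsilon>" "\<epsilon> < 1"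
  obtains C :: real where "\<And>n. real (ex n (triangular_pyramid 3)) \<le> real n ^ 2 / 4 + (1 + \<epsilon>) * n + C"
proof -
  obtain C :: real where C: "\<And>(R :: nat \<Rightarrow> nat \<Rightarrow> bool) V. symp R \<Longrightarrow> irreflp R \<Longrightarrow> finite V \<Longrightarrow> \<not> has_pyramid R V \<Longrightarrow>
    deg_sum R V \<le> real (card V) ^ 2 / 2 + (2 + \<epsilon>) * card V + C"
    using pyramid_free_bound[OF assms] by blast
  show thesis
  proof (rule that[of "C / 2"])
    fix n
    have "ex n (triangular_pyramid 3) \<in> ex_edge_counts n (triangular_pyramid 3)"
      unfolding ex_def by (intro Max_in finite_ex_edge_counts ex_edge_counts_nonempty edges_triangular_pyramid_nonempty)
    then obtain G :: "nat ugraph" where G: "simple_graph G" "card (verts G) = n"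
      "\<not> contains_copy G (triangular_pyramid 3)" "ex n (triangular_pyramid 3) = card (edges G)"
      unfolding ex_edge_counts_def by blast
    let ?R = "\<lambda>u v. {u, v} \<in> edges G"
    have symp: "symp ?R" by (auto simp: symp_def insert_commute)
    have irr: "irreflp ?R"
      using G(1) by (force simp: irreflp_def simple_graph_def nsets_def)
    have fin: "finite (verts G)" using G(1) by (simp add: simple_graph_def)
    have "\<not> has_pyramid ?R (verts G)" using contains_copy_if_has_pyramid[of G] G(3) by blast
    from C[OF symp irr fin this]
    show "real (ex n (triangular_pyramid 3)) \<le> real n ^ 2 / 4 + (1 + \<epsilon>) * n + C / 2"
      unfolding deg_sum_edges[OF G(1)] G(2,4) distrib_right
      using mult_nonneg_nonneg[of \<epsilon> "real n"] assms(1) by linarith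
  qed
qed

subsection \<open>The lower bound\<close>

text \<open>The vertices 0 and 1 dominate, and the remaining ones are bipartitioned by
  parity.\<close>

definition join_graph :: "nat \<Rightarrow> nat ugraph" where
  "join_graph n = ({..<n}, {{x, y} | x y. x < y \<and> y < n \<and> (x < 2 \<or> odd (x + y))})"

lemma simple_join_graph: "simple_graph (join_graph n)"
  by (auto simp: simple_graph_def join_graph_def nsets_def)

text \<open>Each of the three disjoint triangles at the corners needs one of the vertices \<open>0\<close> and \<open>1\<close>.\<close>
lemma join_graph_pyramid_free: "\<not> contains_copy (join_graph n) (triangular_pyramid 3)"
proof
  assume "contains_copy (join_graph n) (triangular_pyramid 3)"
  then obtain f where inj: "inj_on f (verts (triangular_pyramid 3))"
    and E: "\<And>e. e \<in> edges (triangular_pyramid 3) \<Longrightarrow> f ` e \<in> edges (join_graph n)"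
    unfolding contains_copy_def by blast
  have adj: "u < 2 \<or> v < 2 \<or> odd (u + v)" if "{u, v} \<in> edges (join_graph n)" for u v
    using that by (auto simp: join_graph_def doubleton_eq_iff)
  have tri: "f a < 2 \<or> f b < 2 \<or> f c < 2"
    if "{a, b} \<in> edges (triangular_pyramid 3)" "{b, c} \<in> edges (triangular_pyramid 3)"
      "{a, c} \<in> edges (triangular_pyramid 3)" for a b c
    using adj[of "f a" "f b"] adj[of "f b" "f c"] adj[of "f a" "f c"] E[OF that(1)] E[OF that(2)] E[OF that(3)]
    by auto
  have horizontal: "{(i, r), (i, r + 1)} \<in> edges (triangular_pyramid 3)" if "i \<le> 4" "1 \<le> r" "r + 1 \<le> i" for i r
    unfolding triangular_pyramid_def using that by fastforce
  have down: "{(i, r), (i + 1, r)} \<in> edges (triangular_pyramid 3)" if "i \<le> 3" "1 \<le> r" "r \<le> i" for i r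
    unfolding triangular_pyramid_def snd_conv
    by (rule UnI1, rule UnI2, rule CollectI, rule exI[of _ "i + 1"], rule exI[of _ r]) (use that in simp)
  have across: "{(i, r), (i + 1, r + 1)} \<in> edges (triangular_pyramid 3)" if "i \<le> 3" "1 \<le> r" "r \<le> i" for i r
    unfolding triangular_pyramid_def snd_conv
    by (rule UnI2, rule CollectI, rule exI[of _ "i + 1"], rule exI[of _ r]) (use that in simp)
  have t: "f (i, r) < 2 \<or> f (i + 1, r) < 2 \<or> f (i + 1, r + 1) < 2" if "i \<le> 3" "1 \<le> r" "r \<le> i" for i r
    by (rule tri[OF down[OF that] _ across[OF that]]) (rule horizontal; use that in simp)
  have low: "\<exists>p\<in>{(i, r), (i + 1, r), (i + 1, r + 1)}. f p < 2" if "i \<le> 3" "1 \<le> r" "r \<le> i" for i r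
    using t[OF that] by blast
  have "\<exists>p\<in>{(1, 1), (1 + 1, 1), (1 + 1, 1 + 1)}. f p < 2" by (rule low) simp_all
  then obtain a where a: "a \<in> {(1, 1), (1 + 1, 1), (1 + 1, 1 + 1)}" "f a < 2" by (rule bexE)
  have "\<exists>p\<in>{(3, 1), (3 + 1, 1), (3 + 1, 1 + 1)}. f p < 2" by (rule low) simp_all
  then obtain b where b: "b \<in> {(3, 1), (3 + 1, 1), (3 + 1, 1 + 1)}" "f b < 2" by (rule bexE)
  have "\<exists>p\<in>{(3, 3), (3 + 1, 3), (3 + 1, 3 + 1)}. f p < 2" by (rule low) simp_all
  then obtain c where c: "c \<in> {(3, 3), (3 + 1, 3), (3 + 1, 3 + 1)}" "f c < 2" by (rule bexE)
  \<comment> \<open>The coordinates separate the corner triangles: rows up to 2, later rows with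
    position up to 2, and later rows with position from 3 on.\<close>
  have a': "a \<in> verts (triangular_pyramid 3)" "fst a \<le> 2"
    using a(1) by (elim insertE emptyE; simp add: triangular_pyramid_def)+
  have b': "b \<in> verts (triangular_pyramid 3)" "fst b \<ge> 3" "snd b \<le> 2"
    using b(1) by (elim insertE emptyE; simp add: triangular_pyramid_def)+
  have c': "c \<in> verts (triangular_pyramid 3)" "fst c \<ge> 3" "snd c \<ge> 3"
    using c(1) by (elim insertE emptyE; simp add: triangular_pyramid_def)+
  have "a \<noteq> b" "a \<noteq> c" "b \<noteq> c" using a'(2) b'(2,3) c'(2,3) by force+
  then have "f a \<noteq> f b" "f a \<noteq> f c" "f b \<noteq> f c"
    using inj_onD[OF inj _ a'(1) b'(1)] inj_onD[OF inj _ a'(1) c'(1)] inj_onD[OF inj _ b'(1) c'(1)] by blast+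
  then show False using a(2) b(2) c(2) by linarith
qed

lemma card_edges_join_graph: "card (edges (join_graph n)) = (\<Sum>y<n. card {x. x < y \<and> (x < 2 \<or> odd (x + y))})"
proof -
  let ?S = "SIGMA y:{..<n}. {x. x < y \<and> (x < 2 \<or> odd (x + y))}"
  have "edges (join_graph n) = (\<lambda>(y, x). {x, y}) ` ?S"
    by (auto simp: join_graph_def image_def)
  moreover have "inj_on (\<lambda>(y, x). {x, y}) ?S"
    by (auto simp: inj_on_def doubleton_eq_iff)
  ultimately show ?thesis by (simp add: card_image)
qed

lemma card_smaller_neighbours:
  assumes "y \<ge> 2"
  shows "(y - 1) div 2 + 2 \<le> card {x :: nat. x < y \<and> (x < 2 \<or> odd (x + y))}"
proof -
  \<comment> \<open>The numbers of opposite parity to \<open>y\<close> that are at least 2, in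
    descending order; 0 and 1 are added apart.\<close>
  let ?I = "(\<lambda>i. y - 1 - 2 * i) ` {..<(y - 1) div 2}"
  have ge: "y - 1 - 2 * i \<ge> 2" if "i < (y - 1) div 2" for i using that by linarith
  have "card ?I = (y - 1) div 2"
    by (subst card_image) (auto simp: inj_on_def dest!: ge)
  moreover have "?I \<inter> {0, 1} = {}" using ge by force
  moreover have "card (?I \<union> {0, 1}) = card ?I + card {0, 1 :: nat}"
    using \<open>?I \<inter> {0, 1} = {}\<close> by (intro card_Un_disjoint) auto
  moreover have "card (?I \<union> {0, 1}) \<le> card {x. x < y \<and> (x < 2 \<or> odd (x + y))}"
  proof (rule card_mono)
    have "odd (y - 1 - 2 * i + y) \<and> y - 1 - 2 * i < y" if "i < (y - 1) div 2" for i
      using ge[OF that] by presburger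
    then show "?I \<union> {0, 1} \<subseteq> {x. x < y \<and> (x < 2 \<or> odd (x + y))}" using assms by auto
  qed simp
  ultimately show ?thesis by simp
qed

text \<open>At even n \<ge> 2 the right side grows by 2 n, one less than n^2 does; the parity term
  lends this 1 and takes it back at odd n.\<close>

lemma sum_half_below: "n ^ 2 + (if even n then 4 else 3) \<le> 4 * (\<Sum>y<n. (y - 1) div 2) + 4 * n + 4" for n :: nat
proof (induction n)
  case (Suc n)
  show ?case
  proof (cases "even n")
    case True
    then obtain k where "n = 2 * k" by (elim evenE)
    then show ?thesis using Suc by (cases k) (simp_all add: power2_eq_square algebra_simps)
  next
    case False
    then obtain k where "n = 2 * k + 1" by (elim oddE)
    then show ?thesis using Suc by (simp add: power2_eq_square algebra_simps)
  qed
qed simp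

lemma card_edges_join_graph_ge: "real n ^ 2 / 4 + n - 5 \<le> card (edges (join_graph n))"
proof -
  \<comment> \<open>Vertices below 2 do not have both dominating vertices beneath them; the
    correction totals at most 4.\<close>
  have "(y - 1) div 2 + 2 \<le> card {x. x < y \<and> (x < 2 \<or> odd (x + y))} + (if y < 2 then 2 else 0)" for y :: nat
  proof (cases "y < 2")
    case True
    then have "(y - 1) div 2 = 0" by simp
    then show ?thesis using True by simp
  qed (use card_smaller_neighbours[of y] in simp)
  then have "(\<Sum>y<n. (y - 1) div 2 + 2) \<le> (\<Sum>y<n. card {x. x < y \<and> (x < 2 \<or> odd (x + y))} + (if y < 2 then 2 else 0))"
    by (intro sum_mono) blast
  also have "\<dots> = card (edges (join_graph n)) + (\<Sum>y<n. if y < 2 then 2 else 0)"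
    by (simp only: sum.distrib card_edges_join_graph)
  also have "(\<Sum>y<n. if y < 2 then 2 else 0) \<le> (4 :: nat)"
  proof -
    have "(\<Sum>y<n. if y < 2 then 2 else 0) = (\<Sum>y\<in>{y \<in> {..<n}. y < 2}. 2 :: nat)"
      by (rule sum.inter_filter[symmetric]) simp
    also have "\<dots> \<le> (\<Sum>y\<in>{..<2::nat}. 2)" by (rule sum_mono2) auto
    finally show ?thesis by simp
  qed
  also have "(\<Sum>y<n. (y - 1) div 2 + 2) = (\<Sum>y<n. (y - 1) div 2) + 2 * n"
    by (simp only: sum.distrib) simp
  finally have "(\<Sum>y<n. (y - 1) div 2) + 2 * n \<le> card (edges (join_graph n)) + 4"
    by simp
  then have "n ^ 2 + 4 * n \<le> 4 * card (edges (join_graph n)) + 20"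
    using sum_half_below[of n] by (auto split: if_splits)
  from of_nat_mono[OF this, where 'a = real] show ?thesis by simp
qed

lemma ex_lower_bound: "real n ^ 2 / 4 + n - 5 \<le> ex n (triangular_pyramid 3)"
proof -
  have "card (edges (join_graph n)) \<in> ex_edge_counts n (triangular_pyramid 3)"
    unfolding ex_edge_counts_def using simple_join_graph join_graph_pyramid_free
    by (intro CollectI exI[of _ "join_graph n"]) (auto simp: join_graph_def)
  then have "card (edges (join_graph n)) \<le> ex n (triangular_pyramid 3)"
    unfolding ex_def by (intro Max_ge finite_ex_edge_counts)
  then show ?thesis using card_edges_join_graph_ge[of n] by linarith
qed

theorem theorem5:
  shows "(\<lambda>n. real (ex n (triangular_pyramid 3)) - (1 / 4 * real n ^ 2 + real n)) \<in> o(\<lambda>n. real n)"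
proof (rule landau_o.smallI)
  fix c :: real
  assume c: "c > 0"
  \<comment> \<open>Half of \<open>c\<close> covers the linear error \<epsilon> n, the other half
    the constant \<open>C\<close> once n is large.\<close>
  define \<epsilon> where "\<epsilon> = min (c / 2) (1 / 2)"
  have \<epsilon>: "0 < \<epsilon>" "\<epsilon> < 1" "\<epsilon> \<le> c / 2" using c by (auto simp: \<epsilon>_def)
  obtain C :: real where C: "\<And>n. real (ex n (triangular_pyramid 3)) \<le> real n ^ 2 / 4 + (1 + \<epsilon>) * n + C"
    using ex_upper_bound[OF \<epsilon>(1,2)] by blast
  have "\<forall>\<^sub>F n in sequentially. real n \<ge> max (2 * C / c) (5 / c)"
    using filterlim_real_sequentially unfolding filterlim_at_top by blast
  then show "\<forall>\<^sub>F n in sequentially. norm (real (ex n (triangular_pyramid 3)) - (1 / 4 * real n ^ 2 + real n)) \<le> c * norm (real n)"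
  proof eventually_elim
    case (elim n)
    then have n: "2 * C \<le> c * n" "5 \<le> c * n" using c by (simp_all add: field_simps)
    have "\<epsilon> * n \<le> c / 2 * n" using \<epsilon>(3) by (intro mult_right_mono) auto
    then have "real (ex n (triangular_pyramid 3)) - (1 / 4 * real n ^ 2 + real n) \<le> c * n"
      using C[of n] n(1) by (simp add: algebra_simps)
    moreover have "- (c * n) \<le> real (ex n (triangular_pyramid 3)) - (1 / 4 * real n ^ 2 + real n)"
      using ex_lower_bound[of n] n(2) by simp
    ultimately show ?case by (simp add: abs_le_iff)
  qed
qed

end
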